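(* Let $\kappa>\omega_1$ be regular, let $\mathcal{S}\subseteq\mathcal{P}([H_\kappa]^\omega)$ be a nonempty collection of stationary subsets of $[H_\kappa]^\omega$, and let $\vec{T}=\langle T_i\mid i<\omega_1\rangle$ be an $\omega_1$-sequence of pairwise disjoint stationary subsets of $\omega_1$. The following are equivalent: (1) $\mathcal{S}$ is projective stationary on $\vec{T}$. (2) $\langle\mathcal{S},\vec{T}\rangle$ is $\mathsf{SSP}$-projective stationary, i.e., the forcing notion $\mathbb{P}^{\mathsf{DSRP}}_{\mathcal{S},\vec{T}}$ preserves stationary subsets of $\omega_1$.
   Context: $[Y]^\omega$ denotes the set of countable subsets of $Y$; stationarity in $[H_\kappa]^\omega$ is generalized stationarity. A set $S\subseteq[H_\kappa]^\omega$ is projective stationary on $A\subseteq\omega_1$ if for every $B\subseteq A$ that is stationary in $\omega_1$, the set $\{M\in S\mid M\cap\omega_1\in B\}$ is a stationary subset of $[H_\kappa]^\omega$ (this is vacuous if $A$ is nonstationary). $\mathcal{S}$ is projective stationary on $\vec{T}$ if: (a) for every $i<\omega_1$ and every $S\in\mathcal{S}$, $S$ is projective stationary on $T_i$; and (b) $\bigcup\mathcal{S}$ is projective stationary on $\{\alpha\in\bigcup_{i<\omega_1}T_i\mid\forall\beta<\alpha\ \ \alpha\notin T_\beta\}$. The poset $\mathbb{P}^{\mathsf{DSRP}}_{\mathcal{S},\vec{T}}$ consists of all pairs $p=\langle\vec{Q}^p,\vec{S}^p\rangle$ such that for some $\delta^p,\lambda^p<\omega_1$: (1) $\vec{Q}^p=\langle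 Q^p_\alpha\mid\alpha\le\delta^p\rangle$ is a continuous $\in$-chain of elements of $[H_\kappa]^\omega$ (that is, $Q^p_\alpha\in Q^p_{\alpha+1}$ for $\alpha<\delta^p$, and $Q^p_\alpha=\bigcup_{\beta<\alpha}Q^p_\beta$ for limit $\alpha\le\delta^p$); (2) $\vec{S}^p=\langle S^p_i\mid i<\lambda^p\rangle$ with $S^p_i\in\mathcal{S}$ for every $i<\lambda^p$; (3) whenever $\alpha\le\delta^p$ and $i<\omega_1$ are such that $\alpha\in T_i$, then $i<\lambda^p$ and $Q^p_\alpha\in S^p_i$. The ordering is by extension of functions in both coordinates. $\mathsf{SSP}$ is the class of all forcing notions that preserve stationary subsets of $\omega_1$. *)

theory Defs
  imports Main "HOL-Library.Countable_Set" "HOL-Library.Disjoint_Sets"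
begin

unbundle cardinal_syntax

section \<open>A universe of well-founded sets\<close>

text \<open>
  For an infinite type \<open>'k\<close>, the type \<open>'k V\<close> consists of the (pure, well-founded) sets that are
  hereditarily of size at most \<open>|'k|\<close>. It is obtained in Aczel's manner, as the quotient of the
  well-founded \<open>'k\<close>-branching trees by extensional equality. The lemmas
  \<open>elts_inject\<close>, \<open>wf_mem\<close> and \<open>ex_elts_iff\<close> say that membership is extensional and well-founded
  and that exactly the collections of size at most \<open>|'k|\<close> are sets; this determines
  \<open>'k V\<close> up to isomorphism. For every cardinal \<open>\<kappa> \<le> |'k|\<close> all of \<open>H\<^sub>\<kappa>\<close> lives in it.
\<close>

datatype 'k tree = Empty | Node "'k \<Rightarrow> 'k tree"

primrec tree_eq :: "'k tree \<Rightarrow> 'k tree \<Rightarrow> bool" where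
  "tree_eq Empty = (\<lambda>t. t = Empty)"
| "tree_eq (Node f) = (\<lambda>t. case t of Empty \<Rightarrow> False | Node g \<Rightarrow>
     (\<forall>i. \<exists>j. tree_eq (f i) (g j)) \<and> (\<forall>j. \<exists>i. tree_eq (f i) (g j)))"

lemma tree_eq_refl: "tree_eq t t"
  by (induction t) auto

lemma tree_eq_sym: "tree_eq s t \<Longrightarrow> tree_eq t s"
  by (induction s arbitrary: t) (auto split: tree.splits, (meson rangeI)+)

lemma tree_eq_trans: "tree_eq s t \<Longrightarrow> tree_eq t u \<Longrightarrow> tree_eq s u"
  by (induction s arbitrary: t u) (auto split: tree.splits, (meson rangeI)+)

quotient_type 'k V = "'k tree" / tree_eq
  by (intro equivpI reflpI sympI transpI) (auto intro: tree_eq_refl tree_eq_sym tree_eq_trans)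

primrec children :: "'k tree \<Rightarrow> 'k tree set" where
  "children Empty = {}"
| "children (Node f) = range f"

definition elts :: "'k V \<Rightarrow> 'k V set" where
  "elts x = abs_V ` children (rep_V x)"

lemma tree_eq_iff:
  "tree_eq s t \<longleftrightarrow> (\<forall>a\<in>children s. \<exists>b\<in>children t. tree_eq a b) \<and>
     (\<forall>b\<in>children t. \<exists>a\<in>children s. tree_eq a b)"
  by (cases s; cases t) auto

lemma abs_V_eq_iff: "abs_V s = abs_V t \<longleftrightarrow> tree_eq s t"
  by (rule V.abs_eq_iff)

lemma tree_eq_iff_abs: "tree_eq s t \<longleftrightarrow> abs_V ` children s = abs_V ` children t"
proof -
  have "tree_eq s t \<longleftrightarrow> (\<forall>a\<in>children s. \<exists>b\<in>children t. abs_V a = abs_V b) \<and>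
      (\<forall>b\<in>children t. \<exists>a\<in>children s. abs_V a = abs_V b)"
    using tree_eq_iff[of s t] by (simp add: abs_V_eq_iff)
  also have "\<dots> \<longleftrightarrow> abs_V ` children s = abs_V ` children t"
    by (auto simp: image_iff set_eq_iff) metis+
  finally show ?thesis .
qed

lemma abs_rep_V: "abs_V (rep_V x) = x"
  by (rule Quotient3_abs_rep[OF Quotient3_V])

lemma elts_abs_V: "elts (abs_V t) = abs_V ` children t"
  unfolding elts_def using tree_eq_iff_abs abs_V_eq_iff abs_rep_V by metis

lemma elts_inject: "elts x = elts y \<longleftrightarrow> x = y"
  by (metis abs_rep_V abs_V_eq_iff elts_def tree_eq_iff_abs)

definition mem :: "('k V \<times> 'k V) set" where
  "mem = {(x, y). x \<in> elts y}"

lemma wf_mem: "wf mem"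
proof (rule wfUNIVI)
  fix Q :: "'k V \<Rightarrow> bool" and x
  assume step: "\<forall>x. (\<forall>y. (y, x) \<in> mem \<longrightarrow> Q y) \<longrightarrow> Q x"
  have "Q (abs_V t)" for t
  proof (induction t)
    case Empty
    show ?case using step[rule_format, of "abs_V Empty"] by (simp add: mem_def elts_abs_V)
  next
    case (Node f)
    show ?case using step[rule_format, of "abs_V (Node f)"] Node
      by (auto simp: mem_def elts_abs_V)
  qed
  then show "Q x" by (metis abs_rep_V)
qed

lemma ex_elts_iff: "(\<exists>x. elts x = A) \<longleftrightarrow> |A| \<le>o |UNIV :: 'k set|" for A :: "'k V set"
proof
  assume "\<exists>x. elts x = A"
  then obtain x where x: "elts x = A" by blast
  show "|A| \<le>o |UNIV :: 'k set|"
  proof (cases "rep_V x")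
    case Empty
    then have "A = {}" using x by (simp add: elts_def)
    then show ?thesis by (simp add: card_of_empty)
  next
    case (Node f)
    then have "A = range (abs_V \<circ> f)" using x by (simp add: elts_def image_comp)
    then show ?thesis using card_of_image by metis
  qed
next
  assume A: "|A| \<le>o |UNIV :: 'k set|"
  show "\<exists>x. elts x = A"
  proof (cases "A = {}")
    case True
    then have "elts (abs_V Empty) = A" by (simp add: elts_abs_V)
    then show ?thesis by blast
  next
    case False
    then obtain f :: "'k \<Rightarrow> 'k V" where "range f = A" using A by (meson card_of_ordLeq2)
    then have "elts (abs_V (Node (rep_V \<circ> f))) = A"
      by (simp add: elts_abs_V image_comp comp_def abs_rep_V)
    then show ?thesis by blast
  qed
qed

text \<open>Only meaningful for collections of size at most \<open>|'k|\<close>, see \<open>elts_vset\<close>.\<close>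

definition vset :: "'k V set \<Rightarrow> 'k V" where
  "vset A = (THE x. elts x = A)"

lemma vset_elts: "vset (elts x) = x"
  unfolding vset_def by (simp add: elts_inject)

lemma elts_vset: "|A| \<le>o |UNIV :: 'k set| \<Longrightarrow> elts (vset A) = A" for A :: "'k V set"
  by (metis ex_elts_iff vset_elts)

text \<open>The sets whose transitive closure has size less than \<open>\<kappa>\<close>.\<close>

definition H :: "'k rel \<Rightarrow> 'k V set" where
  "H \<kappa> = {x. |{y. (y, x) \<in> mem\<^sup>+}| <o \<kappa>}"


section \<open>Countable ordinals, stationary sets\<close>

definition transitive :: "'k V \<Rightarrow> bool" where
  "transitive x \<longleftrightarrow> (\<forall>y\<in>elts x. elts y \<subseteq> elts x)"

definition Ord :: "'k V \<Rightarrow> bool" where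
  "Ord \<alpha> \<longleftrightarrow> transitive \<alpha> \<and> (\<forall>\<beta>\<in>elts \<alpha>. transitive \<beta>)"

definition osuc :: "'k V \<Rightarrow> 'k V" where
  "osuc \<alpha> = vset (insert \<alpha> (elts \<alpha>))"

definition limit :: "'k V \<Rightarrow> bool" where
  "limit \<alpha> \<longleftrightarrow> Ord \<alpha> \<and> elts \<alpha> \<noteq> {} \<and> (\<forall>\<beta>\<in>elts \<alpha>. osuc \<beta> \<in> elts \<alpha>)"

definition \<omega>1 :: "'k V set" where
  "\<omega>1 = {\<alpha>. Ord \<alpha> \<and> countable (elts \<alpha>)}"

text \<open>Here \<open>W\<close> is the collection of all members of a limit ordinal. The premise of the last clause says
  that \<open>\<alpha>\<close> is a limit point of \<open>C\<close>.\<close>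

definition club_in :: "'k V set \<Rightarrow> 'k V set \<Rightarrow> bool" where
  "club_in W C \<longleftrightarrow> C \<subseteq> W \<and>
     (\<forall>\<alpha>\<in>W. \<exists>\<beta>\<in>C. \<alpha> \<in> elts \<beta>) \<and>
     (\<forall>\<alpha>\<in>W. elts \<alpha> \<noteq> {} \<and> (\<forall>\<beta>\<in>elts \<alpha>. \<exists>\<gamma>\<in>C. \<gamma> \<in> elts \<alpha> \<and> \<beta> \<in> elts \<gamma>) \<longrightarrow> \<alpha> \<in> C)"

definition stationary_in :: "'k V set \<Rightarrow> 'k V set \<Rightarrow> bool" where
  "stationary_in W B \<longleftrightarrow> B \<subseteq> W \<and> (\<forall>C. club_in W C \<longrightarrow> (\<exists>\<alpha>\<in>C. \<alpha> \<in> B))"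

text \<open>
  Countable subsets are taken as elements of \<open>'k V\<close>, so that one of them can be a member of another.
\<close>

definition ctble_subsets :: "'k V set \<Rightarrow> 'k V set" where
  "ctble_subsets Y = {M. elts M \<subseteq> Y \<and> countable (elts M)}"

definition club_ctble :: "'k V set \<Rightarrow> 'k V set \<Rightarrow> bool" where
  "club_ctble Y C \<longleftrightarrow> C \<subseteq> ctble_subsets Y \<and>
     (\<forall>M\<in>ctble_subsets Y. \<exists>N\<in>C. elts M \<subseteq> elts N) \<and>
     (\<forall>X :: nat \<Rightarrow> 'k V. (\<forall>n. X n \<in> C \<and> elts (X n) \<subseteq> elts (X (Suc n))) \<longrightarrow>
        vset (\<Union>n. elts (X n)) \<in> C)"

definition stationary_ctble :: "'k V set \<Rightarrow> 'k V set \<Rightarrow> bool" where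
  "stationary_ctble Y S \<longleftrightarrow> S \<subseteq> ctble_subsets Y \<and> (\<forall>C. club_ctble Y C \<longrightarrow> S \<inter> C \<noteq> {})"


section \<open>Names and forcing\<close>

text \<open>
  A name is a set of pairs of a name and a condition, here given as the range of a partial
  function on \<open>'i\<close>.
\<close>

datatype ('i, 'p) name = Name "'i \<rightharpoonup> ('i, 'p) name \<times> 'p"

primrec entries :: "('i, 'p) name \<Rightarrow> (('i, 'p) name \<times> 'p) set" where
  "entries (Name f) = ran f"

lemma wf_entries: "wf {(x, s). \<exists>c. (x, c) \<in> entries s}"
proof (rule wfUNIVI)
  fix Q :: "('i, 'p) name \<Rightarrow> bool" and s
  assume step: "\<forall>s. (\<forall>x. (x, s) \<in> {(x, s). \<exists>c. (x, c) \<in> entries s} \<longrightarrow> Q x) \<longrightarrow> Q s"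
  show "Q s"
  proof (induction s)
    case (Name f)
    have "Q x" if xc: "(x, c) \<in> ran f" for x c
    proof (rule Name)
      obtain a where "f a = Some (x, c)" using xc by (auto simp: ran_def)
      from this[symmetric] show "Some (x, c) \<in> range f" by (rule range_eqI)
      show "(x, c) \<in> set_option (Some (x, c))" by simp
      show "x \<in> Basic_BNFs.fsts (x, c)" by simp
    qed
    then show ?case using step[rule_format, of "Name f"] by auto
  qed
qed

text \<open>
  Names are taken over the index type \<open>'k V \<times> 'p\<close>. This is large enough to have a check name for
  every collection of ground-model sets, and a name \<open>{(check P \<alpha>, p) | (\<alpha>, p) \<in> R}\<close> for every
  \<open>R \<subseteq> \<omega>1 \<times> P\<close>, so that every subset of \<open>\<omega>1\<close> in the generic extension has a name here.
\<close>

type_synonym ('k, 'p) vname = "('k V \<times> 'p, 'p) name"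

function check :: "'p set \<Rightarrow> 'k V \<Rightarrow> ('k, 'p) vname" where
  "check P x = Name (\<lambda>(y, p). if y \<in> elts x \<and> p \<in> P then Some (check P y, p) else None)"
  by auto
termination
  by (relation "inv_image mem snd") (simp_all add: wf_mem, simp add: mem_def)

declare check.simps [simp del]

definition check_set :: "'p set \<Rightarrow> 'k V set \<Rightarrow> ('k, 'p) vname" where
  "check_set P A = Name (\<lambda>(y, p). if y \<in> A \<and> p \<in> P then Some (check P y, p) else None)"

lemma entries_check: "entries (check P x) = {(check P y, p) | y p. y \<in> elts x \<and> p \<in> P}"
  by (subst check.simps) (auto simp: ran_def)

lemma entries_check_set: "entries (check_set P A) = {(check P y, p) | y p. y \<in> A \<and> p \<in> P}"
  by (auto simp: check_set_def ran_def)

context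
  fixes P :: "'p set" and le :: "'p \<Rightarrow> 'p \<Rightarrow> bool"
begin

inductive is_name :: "('i, 'p) name \<Rightarrow> bool" where
  "(\<And>x c. (x, c) \<in> entries s \<Longrightarrow> c \<in> P) \<Longrightarrow> (\<And>x c. (x, c) \<in> entries s \<Longrightarrow> is_name x) \<Longrightarrow> is_name s"

definition dense_below :: "('p \<Rightarrow> bool) \<Rightarrow> 'p \<Rightarrow> bool" where
  "dense_below D p \<longleftrightarrow> (\<forall>q\<in>P. le q p \<longrightarrow> (\<exists>r\<in>P. le r q \<and> D r))"

text \<open>
  The forcing relation. The clauses for atomic formulas are those of Kunen's
  \<^emph>\<open>Set Theory\<close> (1980), Definition VII.3.3; a formula is represented by the predicate
  ``\<open>p\<close> forces it'' on conditions, and the connectives and quantifiers not in the basis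
  of negation, conjunction and universal quantification are treated as abbreviations.
\<close>

function forces_eq :: "('i, 'p) name \<Rightarrow> ('i, 'p) name \<Rightarrow> 'p \<Rightarrow> bool" where
  "forces_eq s t p \<longleftrightarrow>
     (\<forall>(x, c)\<in>entries s. dense_below
        (\<lambda>q. le q c \<longrightarrow> (\<exists>(y, d)\<in>entries t. le q d \<and> forces_eq x y q)) p) \<and>
     (\<forall>(y, d)\<in>entries t. dense_below
        (\<lambda>q. le q d \<longrightarrow> (\<exists>(x, c)\<in>entries s. le q c \<and> forces_eq x y q)) p)"
  by auto
termination
  by (relation "inv_image {(x, s). \<exists>c. (x, c) \<in> entries s} fst") (auto simp: wf_entries)

declare forces_eq.simps [simp del]

definition forces_mem :: "('i, 'p) name \<Rightarrow> ('i, 'p) name \<Rightarrow> 'p \<Rightarrow> bool" where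
  "forces_mem s t = dense_below (\<lambda>q. \<exists>(y, d)\<in>entries t. le q d \<and> forces_eq s y q)"

definition fNot :: "('p \<Rightarrow> bool) \<Rightarrow> 'p \<Rightarrow> bool" where
  "fNot \<phi> p \<longleftrightarrow> (\<forall>q\<in>P. le q p \<longrightarrow> \<not> \<phi> q)"

definition fAnd :: "('p \<Rightarrow> bool) \<Rightarrow> ('p \<Rightarrow> bool) \<Rightarrow> 'p \<Rightarrow> bool" where
  "fAnd \<phi> \<psi> p \<longleftrightarrow> \<phi> p \<and> \<psi> p"

definition fAll :: "(('i, 'p) name \<Rightarrow> 'p \<Rightarrow> bool) \<Rightarrow> 'p \<Rightarrow> bool" where
  "fAll \<phi> p \<longleftrightarrow> (\<forall>x. is_name x \<longrightarrow> \<phi> x p)"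

definition fImp :: "('p \<Rightarrow> bool) \<Rightarrow> ('p \<Rightarrow> bool) \<Rightarrow> 'p \<Rightarrow> bool" where
  "fImp \<phi> \<psi> = fNot (fAnd \<phi> (fNot \<psi>))"

definition fEx :: "(('i, 'p) name \<Rightarrow> 'p \<Rightarrow> bool) \<Rightarrow> 'p \<Rightarrow> bool" where
  "fEx \<phi> = fNot (fAll (\<lambda>x. fNot (\<phi> x)))"

definition fBall :: "('i, 'p) name \<Rightarrow> (('i, 'p) name \<Rightarrow> 'p \<Rightarrow> bool) \<Rightarrow> 'p \<Rightarrow> bool" where
  "fBall A \<phi> = fAll (\<lambda>x. fImp (forces_mem x A) (\<phi> x))"

definition fBex :: "('i, 'p) name \<Rightarrow> (('i, 'p) name \<Rightarrow> 'p \<Rightarrow> bool) \<Rightarrow> 'p \<Rightarrow> bool" where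
  "fBex A \<phi> = fEx (\<lambda>x. fAnd (forces_mem x A) (\<phi> x))"

text \<open>
  The formulas of \<^const>\<open>club_in\<close> and \<^const>\<open>stationary_in\<close>, evaluated in the generic extension.
\<close>

definition forces_club_in :: "('i, 'p) name \<Rightarrow> ('i, 'p) name \<Rightarrow> 'p \<Rightarrow> bool" where
  "forces_club_in W C =
     fAnd (fBall C (\<lambda>\<alpha>. forces_mem \<alpha> W))
    (fAnd (fBall W (\<lambda>\<alpha>. fBex C (\<lambda>\<beta>. forces_mem \<alpha> \<beta>)))
          (fBall W (\<lambda>\<alpha>. fImp
             (fAnd (fEx (\<lambda>\<beta>. forces_mem \<beta> \<alpha>))
                   (fBall \<alpha> (\<lambda>\<beta>. fBex C (\<lambda>\<gamma>. fAnd (forces_mem \<gamma> \<alpha>) (forces_mem \<beta> \<gamma>)))))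
             (forces_mem \<alpha> C))))"

definition forces_stationary_in :: "('i, 'p) name \<Rightarrow> ('i, 'p) name \<Rightarrow> 'p \<Rightarrow> bool" where
  "forces_stationary_in W B =
     fAnd (fBall B (\<lambda>\<alpha>. forces_mem \<alpha> W))
          (fAll (\<lambda>C. fImp (forces_club_in W C) (fBex C (\<lambda>\<alpha>. forces_mem \<alpha> B))))"

text \<open>
  Every stationary \<open>B \<subseteq> W\<close> of the ground model is forced to be stationary in \<open>W\<close>. For \<open>W = \<omega>1\<close> this
  entails that \<open>\<omega>1\<close> is not collapsed, since a cofinal \<open>\<omega>\<close>-sequence of successor ordinals would be a
  club missing the ground-model set of limit ordinals.
\<close>

definition preserves_stationary_subsets :: "'k V set \<Rightarrow> bool" where
  "preserves_stationary_subsets W \<longleftrightarrow> (\<forall>B. stationary_in W B \<longrightarrow>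
     (\<forall>p\<in>P. forces_stationary_in (check_set P W) (check_set P B) p))"

end


section \<open>Projective stationarity and the poset\<close>

definition projective_stationary_on :: "'k rel \<Rightarrow> 'k V set \<Rightarrow> 'k V set \<Rightarrow> bool" where
  "projective_stationary_on \<kappa> S A \<longleftrightarrow> (\<forall>B\<subseteq>A. stationary_in \<omega>1 B \<longrightarrow>
     stationary_ctble (H \<kappa>) {M\<in>S. vset (elts M \<inter> \<omega>1) \<in> B})"

text \<open>An \<open>\<omega>1\<close>-sequence is a function on \<^typ>\<open>'k V\<close> of which only the values on \<open>\<omega>1\<close> matter.\<close>

definition projective_stationary_on_seq ::
    "'k rel \<Rightarrow> 'k V set set \<Rightarrow> ('k V \<Rightarrow> 'k V set) \<Rightarrow> bool" where
  "projective_stationary_on_seq \<kappa> \<S> T \<longleftrightarrow>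
     (\<forall>i\<in>\<omega>1. \<forall>S\<in>\<S>. projective_stationary_on \<kappa> S (T i)) \<and>
     projective_stationary_on \<kappa> (\<Union>\<S>) {\<alpha> \<in> (\<Union>i\<in>\<omega>1. T i). \<forall>\<beta>\<in>elts \<alpha>. \<alpha> \<notin> T \<beta>}"

text \<open>
  A sequence whose length is an ordinal is a partial function defined on the members of its length.
\<close>

type_synonym 'k dsrp_cond = "('k V \<rightharpoonup> 'k V) \<times> ('k V \<rightharpoonup> 'k V set)"

definition continuous_mem_chain :: "'k rel \<Rightarrow> 'k V \<Rightarrow> ('k V \<rightharpoonup> 'k V) \<Rightarrow> bool" where
  "continuous_mem_chain \<kappa> \<delta> Q \<longleftrightarrow>
     dom Q = insert \<delta> (elts \<delta>) \<and> ran Q \<subseteq> ctble_subsets (H \<kappa>) \<and>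
     (\<forall>\<alpha>\<in>elts \<delta>. the (Q \<alpha>) \<in> elts (the (Q (osuc \<alpha>)))) \<and>
     (\<forall>\<alpha>\<in>dom Q. limit \<alpha> \<longrightarrow> elts (the (Q \<alpha>)) = (\<Union>\<beta>\<in>elts \<alpha>. elts (the (Q \<beta>))))"

definition DSRP :: "'k rel \<Rightarrow> 'k V set set \<Rightarrow> ('k V \<Rightarrow> 'k V set) \<Rightarrow> 'k dsrp_cond set" where
  "DSRP \<kappa> \<S> T = {(Q, S). \<exists>\<delta>\<in>\<omega>1. \<exists>l\<in>\<omega>1.
     continuous_mem_chain \<kappa> \<delta> Q \<and>
     dom S = elts l \<and> ran S \<subseteq> \<S> \<and>
     (\<forall>\<alpha>\<in>dom Q. \<forall>i\<in>\<omega>1. \<alpha> \<in> T i \<longrightarrow> i \<in> elts l \<and> the (Q \<alpha>) \<in> the (S i))}"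

definition DSRP_le :: "'k dsrp_cond \<Rightarrow> 'k dsrp_cond \<Rightarrow> bool" where
  "DSRP_le p q \<longleftrightarrow> fst q \<subseteq>\<^sub>m fst p \<and> snd q \<subseteq>\<^sub>m snd p"

definition SSP_projective_stationary ::
    "'k rel \<Rightarrow> 'k V set set \<Rightarrow> ('k V \<Rightarrow> 'k V set) \<Rightarrow> bool" where
  "SSP_projective_stationary \<kappa> \<S> T \<longleftrightarrow>
     preserves_stationary_subsets (DSRP \<kappa> \<S> T) DSRP_le (\<omega>1 :: 'k V set)"

end

theory Submission
  imports Defs
begin

text \<open>
  Below any condition, a generic filter adds a continuous \<open>\<in>\<close>-chain of countable sets \<open>Q\<^sub>\<alpha>\<close> with
  union \<open>H\<^sub>\<kappa>\<close>, indexed by all ordinals of the ground model's \<open>\<omega>1\<close>. This rests on two facts.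
  A condition can be prolonged by one step so that its new top contains a prescribed countable subset
  of \<open>H\<^sub>\<kappa>\<close> (\<open>extend_successor\<close>), because every \<open>S \<in> \<S>\<close> is stationary. And it can be prolonged
  to any countable length (\<open>extend_length\<close>): to reach a limit \<open>\<delta> \<in> T\<^sub>i\<close>, pick \<open>M \<in> S\<^sub>i\<close> closed
  under the relevant choices, thread a descending sequence of conditions through \<open>M\<close> that meets
  every requirement indexed by an element of \<open>M\<close> (\<open>generic_sequence\<close>), and put \<open>M\<close> on top of
  the union (\<open>limit_condition\<close>).

  From projective stationarity to preservation: let \<open>B\<close> be stationary and let a condition force that
  \<open>C\<close> is club. Thread a sequence through some \<open>M\<close> with \<open>\<delta> = M \<inter> \<omega>1 \<in> B\<close>, deciding on the way
  elements of \<open>C\<close> that are cofinal in \<open>\<delta>\<close>. A lower bound of the sequence forces \<open>\<delta> \<in> C\<close>. The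
  lower bound exists provided that \<open>M \<in> S\<^sub>i\<close> whenever \<open>\<delta> \<in> T\<^sub>i\<close>, and this is arranged by shrinking
  \<open>B\<close> with Fodor's lemma (\<open>stationary_split\<close>, \<open>projective_targets\<close>). If \<open>B\<close> misses all
  \<open>T\<^sub>i\<close>, there is nothing to do. If \<open>B \<subseteq> T\<^sub>\<beta>\<close> for a fixed \<open>\<beta>\<close>, first let the condition decide
  \<open>S\<^sub>\<beta>\<close> and then choose \<open>M \<in> S\<^sub>\<beta>\<close> by part (a) of projective stationarity. Otherwise \<open>\<delta> \<in> T\<^sub>i\<close>
  only for \<open>i \<ge> \<delta>\<close>; the sequence decides only \<open>S\<^sub>j\<close> with \<open>j \<in> M\<close>, that is \<open>j < \<delta>\<close>, so
  \<open>S\<^sub>i\<close> is still free and can be any member of \<open>\<S>\<close> that contains \<open>M\<close>. Part (b) provides one.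

  From preservation to projective stationarity: for a club \<open>C\<close> in \<open>[H\<^sub>\<kappa>]\<^sup>\<omega>\<close> and a stationary \<open>B\<close> it
  suffices to find a condition and an \<open>\<alpha> \<in> B\<close> with \<open>Q\<^sub>\<alpha> \<in> C\<close> and \<open>Q\<^sub>\<alpha> \<inter> \<omega>1 = \<alpha>\<close>
  (\<open>SSP_meets_club\<close>), since the poset then puts \<open>Q\<^sub>\<alpha>\<close> into the required \<open>S\<^sub>i\<close>. One could show
  that in the extension the good \<open>\<alpha>\<close> contain a club, but the usual closure argument takes the
  supremum of an \<open>\<omega>\<close>-sequence of the extension and so presupposes that \<open>\<omega>1\<close> is not collapsed.
  Instead the poset names a set of \<open>marks\<close>: from a mark \<open>\<gamma>\<close> proceed to the least successor ordinal
  \<open>\<xi>\<close> such that \<open>Q\<^sub>\<xi>\<close> contains a member of \<open>C\<close> that covers everything listed up to \<open>\<gamma>\<close>, and take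
  limits at limits. This set is club in the ground model's \<open>\<omega>1\<close> whether or not that is collapsed
  (\<open>marks_unbounded\<close>, \<open>marks_closed\<close>), and its limit members are good (\<open>marks_limit_good\<close>). Preservation, applied to the
  limit ordinals in \<open>B\<close>, gives the desired \<open>\<alpha>\<close>.
\<close>

section \<open>Ordinals\<close>

lemma mem_irrefl: "x \<notin> elts x"
  using wf_mem by (metis case_prodI mem_Collect_eq mem_def wf_not_refl)

lemma mem_asym: "x \<in> elts y \<Longrightarrow> y \<notin> elts x"
  using wf_mem by (metis case_prodI mem_Collect_eq mem_def wf_not_sym)

lemma elts_eqI: "elts x = elts y \<Longrightarrow> x = y"
  by (simp add: elts_inject)

lemma mem_induct: "(\<And>x. (\<And>y. y \<in> elts x \<Longrightarrow> Q y) \<Longrightarrow> Q x) \<Longrightarrow> Q x"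
  using wf_mem by (rule wf_induct_rule) (auto simp: mem_def)

lemma mem_minimal:
  assumes "x \<in> A"
  obtains m where "m \<in> A" "\<And>y. y \<in> elts m \<Longrightarrow> y \<notin> A"
  using wfE_min[OF wf_mem assms] by (metis case_prodI mem_Collect_eq mem_def)

lemma Ord_mem_trans: "Ord \<alpha> \<Longrightarrow> \<beta> \<in> elts \<alpha> \<Longrightarrow> \<gamma> \<in> elts \<beta> \<Longrightarrow> \<gamma> \<in> elts \<alpha>"
  by (auto simp: Ord_def transitive_def)

lemma Ord_in_Ord: "Ord \<alpha> \<Longrightarrow> \<beta> \<in> elts \<alpha> \<Longrightarrow> Ord \<beta>"
  unfolding Ord_def by (meson subsetD transitive_def)

lemma OrdI: "(\<And>\<beta>. \<beta> \<in> elts \<alpha> \<Longrightarrow> Ord \<beta>) \<Longrightarrow> (\<And>\<beta>. \<beta> \<in> elts \<alpha> \<Longrightarrow> elts \<beta> \<subseteq> elts \<alpha>) \<Longrightarrow> Ord \<alpha>"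
  by (auto simp: Ord_def transitive_def)

lemma Ord_linear: "Ord \<alpha> \<Longrightarrow> Ord \<beta> \<Longrightarrow> \<alpha> \<in> elts \<beta> \<or> \<alpha> = \<beta> \<or> \<beta> \<in> elts \<alpha>"
proof (induction \<alpha> arbitrary: \<beta> rule: mem_induct)
  case (1 \<alpha>)
  note outer = 1
  from \<open>Ord \<beta>\<close> show ?case
  proof (induction \<beta> rule: mem_induct)
    case (1 \<beta>)
    show ?case
    proof (rule ccontr)
      assume neg: "\<not> ?case"
      have "elts \<alpha> \<subseteq> elts \<beta>"
        using outer 1 neg Ord_in_Ord Ord_mem_trans by (metis subsetI)
      moreover have "elts \<beta> \<subseteq> elts \<alpha>"
        using outer 1 neg Ord_in_Ord Ord_mem_trans by (metis subsetI)
      ultimately show False using neg elts_eqI by blast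
    qed
  qed
qed

lemma \<omega>1_Ord: "\<alpha> \<in> \<omega>1 \<Longrightarrow> Ord \<alpha>"
  by (simp add: \<omega>1_def)

lemma \<omega>1_countable: "\<alpha> \<in> \<omega>1 \<Longrightarrow> countable (elts \<alpha>)"
  by (simp add: \<omega>1_def)

lemma \<omega>1_trans: "\<alpha> \<in> \<omega>1 \<Longrightarrow> \<beta> \<in> elts \<alpha> \<Longrightarrow> \<gamma> \<in> elts \<beta> \<Longrightarrow> \<gamma> \<in> elts \<alpha>"
  using Ord_mem_trans \<omega>1_Ord by blast

lemma \<omega>1_mem: "\<alpha> \<in> \<omega>1 \<Longrightarrow> \<beta> \<in> elts \<alpha> \<Longrightarrow> \<beta> \<in> \<omega>1"
  unfolding \<omega>1_def using Ord_in_Ord Ord_mem_trans countable_subset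
  by (metis (no_types, lifting) mem_Collect_eq subsetI)

lemma \<omega>1_linear: "\<alpha> \<in> \<omega>1 \<Longrightarrow> \<beta> \<in> \<omega>1 \<Longrightarrow> \<alpha> \<in> elts \<beta> \<or> \<alpha> = \<beta> \<or> \<beta> \<in> elts \<alpha>"
  using Ord_linear \<omega>1_Ord by blast

lemma limit_elts_nonempty: "limit \<alpha> \<Longrightarrow> elts \<alpha> \<noteq> {}"
  by (simp add: limit_def)

lemma limit_osuc: "limit \<alpha> \<Longrightarrow> \<beta> \<in> elts \<alpha> \<Longrightarrow> osuc \<beta> \<in> elts \<alpha>"
  by (simp add: limit_def)

lemma stationary_meets: "stationary_in W B \<Longrightarrow> club_in W C \<Longrightarrow> \<exists>\<alpha>\<in>B. \<alpha> \<in> C"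
  by (auto simp: stationary_in_def)

lemma stationary_subset: "stationary_in W B \<Longrightarrow> B \<subseteq> W"
  by (auto simp: stationary_in_def)

lemma nonstationary_club: "\<not> stationary_in W B \<Longrightarrow> B \<subseteq> W \<Longrightarrow> \<exists>C. club_in W C \<and> (\<forall>\<alpha>\<in>C. \<alpha> \<notin> B)"
  by (auto simp: stationary_in_def)

text \<open>
  When the index type is infinite, countable collections are sets and every ordinal has a successor.
\<close>

locale infinite_branching =
  fixes index_type :: "'k itself"
  assumes infinite_index: "infinite (UNIV :: 'k set)"
begin

lemma elts_vset_countable: "countable A \<Longrightarrow> elts (vset A) = A" for A :: "'k V set"
proof (rule elts_vset)
  assume "countable A"
  then have "|A| \<le>o |UNIV :: nat set|" using card_of_ordLeq unfolding countable_def by blast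
  moreover have "|UNIV :: nat set| \<le>o |UNIV :: 'k set|"
    using infinite_index infinite_iff_card_of_nat by blast
  ultimately show "|A| \<le>o |UNIV :: 'k set|" by (rule ordLeq_transitive)
qed

lemma elts_osuc: "elts (osuc \<alpha>) = insert \<alpha> (elts \<alpha>)" for \<alpha> :: "'k V"
proof -
  have "|elts \<alpha>| \<le>o |UNIV :: 'k set|" using ex_elts_iff by blast
  moreover have "|{\<alpha>}| \<le>o |UNIV :: 'k set|" by (simp add: card_of_singl_ordLeq)
  ultimately have "|{\<alpha>} \<union> elts \<alpha>| \<le>o |UNIV :: 'k set|"
    using card_of_Un_ordLeq_infinite_Field[of "|UNIV :: 'k set|"] infinite_index card_of_Card_order
    by (metis Field_card_of)
  then show ?thesis by (simp add: osuc_def elts_vset)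
qed

lemma mem_osuc: "\<alpha> \<in> elts (osuc \<alpha>)" for \<alpha> :: "'k V"
  by (simp add: elts_osuc)

lemma osuc_inject: "osuc \<alpha> = osuc \<beta> \<Longrightarrow> \<alpha> = \<beta>" for \<alpha> \<beta> :: "'k V"
proof -
  assume eq: "osuc \<alpha> = osuc \<beta>"
  have "\<alpha> \<in> elts (osuc \<beta>)" "\<beta> \<in> elts (osuc \<alpha>)" using mem_osuc[of \<alpha>] mem_osuc[of \<beta>] eq by simp_all
  then show ?thesis unfolding elts_osuc using mem_asym by blast
qed

lemma osuc_\<omega>1: "\<alpha> \<in> \<omega>1 \<Longrightarrow> osuc \<alpha> \<in> \<omega>1" for \<alpha> :: "'k V"
  unfolding \<omega>1_def using Ord_in_Ord Ord_mem_trans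
  by (auto simp: elts_osuc) (rule OrdI, auto simp: elts_osuc, blast)

lemma osuc_le: "\<beta> \<in> \<omega>1 \<Longrightarrow> \<alpha> \<in> elts \<beta> \<Longrightarrow> osuc \<alpha> = \<beta> \<or> osuc \<alpha> \<in> elts \<beta>" for \<alpha> :: "'k V"
  using \<omega>1_linear[of "osuc \<alpha>" \<beta>] osuc_\<omega>1[of \<alpha>] \<omega>1_mem[of \<beta> \<alpha>] elts_osuc[of \<alpha>] mem_asym mem_irrefl
  by (metis insertE)

lemma not_limit_osuc: "\<not> limit (osuc \<alpha>)" for \<alpha> :: "'k V"
  using limit_osuc mem_irrefl mem_osuc by blast

lemma limitI:
  fixes \<alpha> :: "'k V"
  assumes "\<alpha> \<in> \<omega>1" "elts \<alpha> \<noteq> {}" "\<And>\<beta>. \<beta> \<in> elts \<alpha> \<Longrightarrow> \<exists>\<gamma>. \<gamma> \<in> elts \<alpha> \<and> \<beta> \<in> elts \<gamma>"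
  shows "limit \<alpha>"
  unfolding limit_def using assms osuc_le \<omega>1_Ord \<omega>1_mem \<omega>1_trans by metis

lemma \<omega>1_cases:
  fixes \<alpha> :: "'k V"
  assumes "\<alpha> \<in> \<omega>1"
  obtains "elts \<alpha> = {}" | \<beta> where "\<beta> \<in> \<omega>1" "\<alpha> = osuc \<beta>" | "limit \<alpha>"
  using assms osuc_le \<omega>1_mem \<omega>1_Ord unfolding limit_def by metis

lemma vset_\<omega>1I:
  fixes A :: "'k V set"
  assumes "countable A" "A \<subseteq> \<omega>1" "\<And>\<beta>. \<beta> \<in> A \<Longrightarrow> elts \<beta> \<subseteq> A"
  shows "vset A \<in> \<omega>1"
  using assms \<omega>1_Ord OrdI[of "vset A"] by (auto simp: \<omega>1_def elts_vset_countable)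

text \<open>
  Regularity of \<open>\<omega>1\<close>: the countable set together with all members of its elements is itself an ordinal.
\<close>

lemma countable_bounded:
  fixes A :: "'k V set"
  assumes "countable A" "A \<subseteq> \<omega>1"
  obtains \<alpha> where "\<alpha> \<in> \<omega>1" "A \<subseteq> elts \<alpha>"
proof -
  let ?B = "A \<union> (\<Union>\<beta>\<in>A. elts \<beta>)"
  have c: "countable ?B" using assms \<omega>1_countable by blast
  have "vset ?B \<in> \<omega>1"
  proof (rule vset_\<omega>1I[OF c])
    show "?B \<subseteq> \<omega>1" using assms \<omega>1_mem by (auto dest: subsetD)
    show "elts \<beta> \<subseteq> ?B" if "\<beta> \<in> ?B" for \<beta>
      using that assms(2) \<omega>1_trans by (fastforce dest: subsetD)
  qed
  then show ?thesis using that[of "vset ?B"] elts_vset_countable[OF c] by auto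
qed

lemma limit_common_bound:
  fixes \<alpha> :: "'k V"
  assumes "limit \<alpha>" "finite A" "A \<subseteq> elts \<alpha>"
  shows "\<exists>\<beta>\<in>elts \<alpha>. A \<subseteq> elts \<beta>"
  using assms(2,3)
proof (induction A)
  case empty
  then show ?case using limit_elts_nonempty[OF assms(1)] by blast
next
  case (insert x A)
  then obtain \<beta> where b: "\<beta> \<in> elts \<alpha>" "A \<subseteq> elts \<beta>" by blast
  have O: "Ord \<alpha>" using assms(1) by (simp add: limit_def)
  have x: "osuc x \<in> elts \<alpha>" using insert.prems assms(1) limit_osuc by blast
  have "Ord \<beta>" "Ord (osuc x)" using O b x Ord_in_Ord by auto
  then consider "\<beta> \<in> elts (osuc x) \<or> \<beta> = osuc x" | "osuc x \<in> elts \<beta>" using Ord_linear by blast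
  then show ?case
  proof cases
    case 1
    then have "insert x A \<subseteq> elts (osuc x)"
      using b mem_osuc \<open>Ord (osuc x)\<close> Ord_mem_trans by blast
    then show ?thesis using x by blast
  next
    case 2
    then have "insert x A \<subseteq> elts \<beta>" using b mem_osuc \<open>Ord \<beta>\<close> Ord_mem_trans by blast
    then show ?thesis using b by blast
  qed
qed

section \<open>Stationarity and closure under countably valued functions\<close>

text \<open>
  Functions from finite sequences to countable sets play the role of Skolem functions; a set closed
  under them replaces a countable elementary submodel.
\<close>

definition countable_valued :: "'a set \<Rightarrow> ('a list \<Rightarrow> 'a set) \<Rightarrow> bool" where
  "countable_valued Y F \<longleftrightarrow> (\<forall>xs\<in>lists Y. countable (F xs) \<and> F xs \<subseteq> Y)"

definition closed_under :: "('a list \<Rightarrow> 'a set) \<Rightarrow> 'a set \<Rightarrow> bool" where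
  "closed_under F M \<longleftrightarrow> (\<forall>xs\<in>lists M. F xs \<subseteq> M)"

inductive_set Cl :: "('a list \<Rightarrow> 'a set) \<Rightarrow> 'a set \<Rightarrow> 'a set" for F A where
  base: "x \<in> A \<Longrightarrow> x \<in> Cl F A"
| step: "xs \<in> lists (Cl F A) \<Longrightarrow> y \<in> F xs \<Longrightarrow> y \<in> Cl F A"

lemma Cl_closed: "closed_under F (Cl F A)"
  by (auto simp: closed_under_def intro: Cl.step)

lemma Cl_least: "A \<subseteq> M \<Longrightarrow> closed_under F M \<Longrightarrow> Cl F A \<subseteq> M"
proof
  fix x assume M: "A \<subseteq> M" "closed_under F M" and "x \<in> Cl F A"
  from this(3) show "x \<in> M"
  proof induction
    case (step xs y)
    then have "xs \<in> lists M" by (auto simp: lists_eq_set)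
    then show ?case using step(2) M(2) by (auto simp: closed_under_def)
  qed (use M in auto)
qed

lemma Cl_mono: "A \<subseteq> B \<Longrightarrow> Cl F A \<subseteq> Cl F B"
  by (rule Cl_least) (auto intro: Cl.base simp: Cl_closed)

lemma lists_Union_chain:
  fixes X :: "nat \<Rightarrow> 'a set"
  assumes "\<And>n. X n \<subseteq> X (Suc n)" "xs \<in> lists (\<Union>n. X n)"
  shows "\<exists>n. xs \<in> lists (X n)"
  using assms(2)
proof (induction xs)
  case (Cons x xs)
  then obtain m n where mn: "xs \<in> lists (X m)" "x \<in> X n" by auto
  have "X i \<subseteq> X j" if "i \<le> j" for i j using lift_Suc_mono_le[of X] assms(1) that by blast
  then have "x # xs \<in> lists (X (max m n))"
    using mn lists_mono[of "X m" "X (max m n)"] by (meson Cons_in_lists_iff max.cobounded1 max.cobounded2 subsetD)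
  then show ?case by blast
qed simp

lemma Cl_countable:
  assumes "countable_valued Y F" "A \<subseteq> Y" "countable A"
  shows "countable (Cl F A)" "Cl F A \<subseteq> Y"
proof -
  define G where "G B = B \<union> (\<Union>xs\<in>lists B. F xs)" for B
  define U where "U n = (G ^^ n) A" for n
  have U: "countable (U n) \<and> U n \<subseteq> Y" for n
  proof (induction n)
    case (Suc n)
    have "F xs \<subseteq> Y \<and> countable (F xs)" if "xs \<in> lists (U n)" for xs
      using that Suc assms(1) lists_mono[of "U n" Y] by (auto simp: countable_valued_def)
    moreover have "U (Suc n) = U n \<union> (\<Union>xs\<in>lists (U n). F xs)" by (simp add: U_def G_def)
    ultimately show ?case using Suc by auto
  qed (simp add: U_def assms)
  have "Cl F A \<subseteq> (\<Union>n. U n)"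
  proof (rule Cl_least)
    show "A \<subseteq> (\<Union>n. U n)" using UN_upper[of 0 UNIV U] by (simp add: U_def)
    show "closed_under F (\<Union>n. U n)"
      unfolding closed_under_def
    proof (intro ballI subsetI)
      fix xs y assume xs: "xs \<in> lists (\<Union>n. U n)" and y: "y \<in> F xs"
      have "U n \<subseteq> U (Suc n)" for n by (auto simp: U_def G_def)
      then obtain n where "xs \<in> lists (U n)" using lists_Union_chain[of U] xs by blast
      then have "y \<in> U (Suc n)" using y by (auto simp: U_def G_def)
      then show "y \<in> (\<Union>n. U n)" by blast
    qed
  qed
  then show "countable (Cl F A)" "Cl F A \<subseteq> Y" using U by (auto intro: countable_subset)
qed

text \<open>
  An element of the closure is generated by finitely many points. Hence an ordinal that contains
  all countable ordinals in the hulls of its finite subsets contains all those in its own hull, which is how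
  \<open>stationary_lift\<close> uses it.
\<close>

lemma Cl_finitary: "x \<in> Cl F A \<Longrightarrow> \<exists>ys\<in>lists A. x \<in> Cl F (set ys)"
proof (induction rule: Cl.induct)
  case (base x)
  then show ?case by (intro bexI[of _ "[x]"]) (auto intro: Cl.base)
next
  case (step xs y)
  have "\<exists>ys\<in>lists A. set xs \<subseteq> Cl F (set ys)"
    using step(1)
  proof (induction xs)
    case (Cons a xs)
    then obtain ys zs where "ys \<in> lists A" "set xs \<subseteq> Cl F (set ys)" "zs \<in> lists A" "a \<in> Cl F (set zs)"
      by auto
    then show ?case
      using Cl_mono[of "set ys" "set (ys @ zs)" F] Cl_mono[of "set zs" "set (ys @ zs)" F]
      by (intro bexI[of _ "ys @ zs"]) auto
  qed auto
  then obtain ys where "ys \<in> lists A" "set xs \<subseteq> Cl F (set ys)" by blast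
  then show ?case using step(2) Cl.step[of xs F "set ys" y] by (auto simp: lists_eq_set)
qed

lemma club_closed_under:
  assumes "countable_valued Y F"
  shows "club_ctble Y {M :: 'k V. M \<in> ctble_subsets Y \<and> closed_under F (elts M)}"
  unfolding club_ctble_def
proof (intro conjI ballI allI impI)
  fix M :: "'k V" assume "M \<in> ctble_subsets Y"
  then have M: "elts M \<subseteq> Y" "countable (elts M)" by (auto simp: ctble_subsets_def)
  note c = Cl_countable[OF assms M]
  show "\<exists>N\<in>{M. M \<in> ctble_subsets Y \<and> closed_under F (elts M)}. elts M \<subseteq> elts N"
    by (rule bexI[of _ "vset (Cl F (elts M))"])
      (use c in \<open>auto simp: elts_vset_countable ctble_subsets_def Cl_closed intro: Cl.base\<close>)
next
  fix X :: "nat \<Rightarrow> 'k V"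
  assume X: "\<forall>n. X n \<in> {M. M \<in> ctble_subsets Y \<and> closed_under F (elts M)} \<and> elts (X n) \<subseteq> elts (X (Suc n))"
  have c: "countable (\<Union>n. elts (X n))" using X by (auto simp: ctble_subsets_def)
  have "closed_under F (\<Union>n. elts (X n))"
    unfolding closed_under_def
  proof
    fix xs assume "xs \<in> lists (\<Union>n. elts (X n))"
    then obtain n where "xs \<in> lists (elts (X n))" using lists_Union_chain[of "\<lambda>n. elts (X n)"] X by blast
    then have "F xs \<subseteq> elts (X n)" using X by (auto simp: closed_under_def)
    then show "F xs \<subseteq> (\<Union>n. elts (X n))" by blast
  qed
  then show "vset (\<Union>n. elts (X n)) \<in> {M. M \<in> ctble_subsets Y \<and> closed_under F (elts M)}"
    using c X by (auto simp: elts_vset_countable ctble_subsets_def)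
qed auto

text \<open>
  Weak stationarity: the clubs tested are only those of the form
  ``closed under \<open>F\<close>''. This is all that a generic sequence needs, and for the sets in
  \<open>stationary_lift\<close> it is easier to verify than stationarity.
\<close>

definition meets_closures :: "'k V set \<Rightarrow> 'k V set \<Rightarrow> bool" where
  "meets_closures Y S \<longleftrightarrow> S \<subseteq> ctble_subsets Y \<and>
     (\<forall>F. countable_valued Y F \<longrightarrow> (\<exists>M\<in>S. closed_under F (elts M)))"

lemma stationary_meets_closures: "stationary_ctble Y S \<Longrightarrow> meets_closures Y S" for S :: "'k V set"
  using club_closed_under[of Y] unfolding stationary_ctble_def meets_closures_def by blast

text \<open>
  The ordinals closed under \<open>F\<close> form a club. All other clubs of countable ordinals needed
  below (diagonal intersections, limit ordinals, closure points of Skolem hulls) are obtained from this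
  one by choosing \<open>F\<close>.
\<close>

lemma stationary_closed_ordinal:
  fixes B :: "'k V set"
  assumes "stationary_in \<omega>1 B" "countable_valued \<omega>1 F"
  shows "\<exists>\<alpha>\<in>B. limit \<alpha> \<and> closed_under F (elts \<alpha>)"
proof -
  \<comment> \<open>Closing under members and successors as well makes a closed set a limit ordinal.\<close>
  define G :: "'k V list \<Rightarrow> 'k V set" where
    "G xs = F xs \<union> (\<Union>\<beta>\<in>set xs. elts \<beta> \<union> {osuc \<beta>})" for xs
  have G: "countable_valued \<omega>1 G"
    unfolding countable_valued_def
  proof (intro ballI conjI)
    fix xs :: "'k V list" assume xs: "xs \<in> lists \<omega>1"
    then have "countable (F xs)" "F xs \<subseteq> \<omega>1" using assms(2) by (auto simp: countable_valued_def)
    moreover have "countable (elts \<beta> \<union> {osuc \<beta>})" "elts \<beta> \<union> {osuc \<beta>} \<subseteq> \<omega>1" if "\<beta> \<in> set xs" for \<beta>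
      using that xs \<omega>1_countable[of \<beta>] \<omega>1_mem[of \<beta>] osuc_\<omega>1[of \<beta>] by auto
    moreover have "countable (set xs)" by (simp add: countable_finite)
    ultimately show "countable (G xs)" "G xs \<subseteq> \<omega>1"
      unfolding G_def by (auto intro!: countable_UN)
  qed
  have "club_in \<omega>1 {\<alpha>\<in>\<omega>1. limit \<alpha> \<and> closed_under F (elts \<alpha>)}"
    unfolding club_in_def
  proof (intro conjI ballI impI)
    fix \<alpha> :: "'k V" assume a: "\<alpha> \<in> \<omega>1"
    let ?M = "Cl G {\<alpha>}"
    have c: "countable ?M" "?M \<subseteq> \<omega>1" using Cl_countable[OF G, of "{\<alpha>}"] a by auto
    have G_M: "y \<in> ?M" if "xs \<in> lists ?M" "y \<in> G xs" for xs y
      using that by (rule Cl.step)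
    have tr: "elts \<beta> \<subseteq> ?M" "osuc \<beta> \<in> ?M" if "\<beta> \<in> ?M" for \<beta>
      using G_M[of "[\<beta>]"] that by (auto simp: G_def)
    let ?\<gamma> = "vset ?M"
    have el: "elts ?\<gamma> = ?M" using elts_vset_countable c by blast
    have g: "?\<gamma> \<in> \<omega>1" using vset_\<omega>1I c tr by blast
    have am: "\<alpha> \<in> ?M" by (simp add: Cl.base)
    then have "limit ?\<gamma>" using g el tr by (auto simp: limit_def \<omega>1_Ord)
    moreover have "closed_under F ?M"
      using G_M unfolding closed_under_def G_def by blast
    ultimately show "\<exists>\<beta>\<in>{\<alpha> \<in> \<omega>1. limit \<alpha> \<and> closed_under F (elts \<alpha>)}. \<alpha> \<in> elts \<beta>"
      using g el am by (intro bexI[of _ ?\<gamma>]) auto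
  next
    fix \<alpha> :: "'k V" assume a: "\<alpha> \<in> \<omega>1"
      and lim: "elts \<alpha> \<noteq> {} \<and> (\<forall>\<beta>\<in>elts \<alpha>. \<exists>\<gamma>\<in>{\<alpha> \<in> \<omega>1. limit \<alpha> \<and> closed_under F (elts \<alpha>)}. \<gamma> \<in> elts \<alpha> \<and> \<beta> \<in> elts \<gamma>)"
    have l: "limit \<alpha>" using a lim by (intro limitI) blast+
    have "F xs \<subseteq> elts \<alpha>" if "xs \<in> lists (elts \<alpha>)" for xs
    proof -
      have "set xs \<subseteq> elts \<alpha>" using that by auto
      then obtain \<beta> where "\<beta> \<in> elts \<alpha>" "set xs \<subseteq> elts \<beta>"
        using limit_common_bound[OF l finite_set] by blast
      then obtain \<gamma> where "closed_under F (elts \<gamma>)" "\<gamma> \<in> elts \<alpha>" "\<gamma> \<in> \<omega>1" "\<beta> \<in> elts \<gamma>" using lim by blast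
      moreover have "xs \<in> lists (elts \<gamma>)"
        using \<open>set xs \<subseteq> elts \<beta>\<close> \<open>\<beta> \<in> elts \<gamma>\<close> \<open>\<gamma> \<in> \<omega>1\<close> \<omega>1_trans by (auto simp: lists_eq_set)
      ultimately show ?thesis using \<omega>1_trans[OF a] by (auto simp: closed_under_def)
    qed
    then show "\<alpha> \<in> {\<alpha> \<in> \<omega>1. limit \<alpha> \<and> closed_under F (elts \<alpha>)}" using a l by (auto simp: closed_under_def)
  qed auto
  then show ?thesis using stationary_meets[OF assms(1)] by blast
qed

text \<open>
  The diagonal intersection of a family of clubs meets every stationary set: an ordinal closed under
  ``next element of \<open>C\<close> above \<open>\<gamma>\<close>'' for all \<open>C \<in> \<C> \<beta>\<close> is a limit point of each such \<open>C\<close>. Allowing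
  countably many clubs for each \<open>\<beta>\<close> covers finite intersections at the same time.
\<close>

lemma stationary_diagonal:
  fixes B :: "'k V set"
  assumes "stationary_in \<omega>1 B"
    and "\<And>\<beta>. \<beta> \<in> \<omega>1 \<Longrightarrow> countable (\<C> \<beta>)"
    and "\<And>\<beta> C. \<beta> \<in> \<omega>1 \<Longrightarrow> C \<in> \<C> \<beta> \<Longrightarrow> club_in \<omega>1 C"
  shows "\<exists>\<alpha>\<in>B. limit \<alpha> \<and> (\<forall>\<beta>\<in>elts \<alpha>. \<forall>C\<in>\<C> \<beta>. \<alpha> \<in> C)"
proof -
  have "\<forall>C \<gamma>. \<exists>\<eta>. club_in \<omega>1 C \<and> \<gamma> \<in> \<omega>1 \<longrightarrow> \<eta> \<in> C \<and> \<gamma> \<in> elts \<eta>"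
    unfolding club_in_def by blast
  then obtain next_in where next_in: "\<And>C \<gamma>. club_in \<omega>1 C \<Longrightarrow> \<gamma> \<in> \<omega>1 \<Longrightarrow> next_in C \<gamma> \<in> C \<and> \<gamma> \<in> elts (next_in C \<gamma> :: 'k V)"
    by metis
  define F where "F xs = (case xs of [\<beta>, \<gamma>] \<Rightarrow> (\<lambda>C. next_in C \<gamma>) ` \<C> \<beta> | _ \<Rightarrow> {})" for xs
  have "countable_valued \<omega>1 F"
    unfolding countable_valued_def
  proof
    fix xs :: "'k V list" assume xs: "xs \<in> lists \<omega>1"
    show "countable (F xs) \<and> F xs \<subseteq> \<omega>1"
    proof (cases "\<exists>\<beta> \<gamma>. xs = [\<beta>, \<gamma>]")
      case True
      then obtain \<beta> \<gamma> where bg: "xs = [\<beta>, \<gamma>]" "\<beta> \<in> \<omega>1" "\<gamma> \<in> \<omega>1" using xs by auto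
      have "next_in C \<gamma> \<in> \<omega>1" if "C \<in> \<C> \<beta>" for C
        using assms(3)[OF bg(2) that] next_in[of C \<gamma>] bg(3) by (auto simp: club_in_def)
      then show ?thesis using assms(2)[OF bg(2)] bg(1) by (auto simp: F_def)
    next
      case False
      then have "F xs = {}" by (auto simp: F_def split: list.splits)
      then show ?thesis by simp
    qed
  qed
  then obtain \<alpha> where a: "\<alpha> \<in> B" "limit \<alpha>" "closed_under F (elts \<alpha>)"
    using stationary_closed_ordinal[OF assms(1)] by blast
  have a1: "\<alpha> \<in> \<omega>1" using a assms(1) stationary_subset by blast
  have "\<alpha> \<in> C" if "\<beta> \<in> elts \<alpha>" "C \<in> \<C> \<beta>" for \<beta> C
  proof -
    have C: "club_in \<omega>1 C" using that a1 assms(3) \<omega>1_mem by blast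
    have "\<exists>\<eta>\<in>C. \<eta> \<in> elts \<alpha> \<and> \<gamma> \<in> elts \<eta>" if g: "\<gamma> \<in> elts \<alpha>" for \<gamma>
    proof -
      have "[\<beta>, \<gamma>] \<in> lists (elts \<alpha>)" using g \<open>\<beta> \<in> elts \<alpha>\<close> by simp
      then have "F [\<beta>, \<gamma>] \<subseteq> elts \<alpha>" using a(3) unfolding closed_under_def by blast
      then have "next_in C \<gamma> \<in> elts \<alpha>" using \<open>C \<in> \<C> \<beta>\<close> by (auto simp: F_def)
      then show ?thesis using next_in[OF C] g a1 \<omega>1_mem by blast
    qed
    then show ?thesis using C a1 limit_elts_nonempty[OF a(2)] unfolding club_in_def by blast
  qed
  then show ?thesis using a by blast
qed

lemma stationary_limits:
  fixes B :: "'k V set"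
  assumes "stationary_in \<omega>1 B"
  shows "stationary_in \<omega>1 {\<alpha>\<in>B. limit \<alpha>}"
  unfolding stationary_in_def
proof (intro conjI allI impI)
  fix C :: "'k V set" assume "club_in \<omega>1 C"
  then obtain \<alpha> where "\<alpha> \<in> B" "limit \<alpha>" "\<forall>\<beta>\<in>elts \<alpha>. \<forall>C'\<in>{C}. \<alpha> \<in> C'"
    using stationary_diagonal[OF assms, of "\<lambda>_. {C}"] by auto
  then show "\<exists>\<alpha>\<in>C. \<alpha> \<in> {\<alpha>\<in>B. limit \<alpha>}" using limit_elts_nonempty by blast
qed (use stationary_subset[OF assms] in auto)

text \<open>
  Fodor's lemma for the partial function that sends \<open>\<alpha> \<in> T \<beta>\<close> with \<open>\<beta> < \<alpha>\<close> to \<open>\<beta>\<close>, combined with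
  splitting a stationary set into the points outside all \<open>T i\<close>, those that lie in no \<open>T \<beta>\<close> with
  \<open>\<beta> < \<alpha>\<close>, and those where the function is defined.
\<close>

lemma stationary_split:
  fixes B :: "'k V set"
  assumes "stationary_in \<omega>1 B"
  shows "stationary_in \<omega>1 (B - (\<Union>i\<in>\<omega>1. T i)) \<or>
    stationary_in \<omega>1 (B \<inter> {\<alpha> \<in> (\<Union>i\<in>\<omega>1. T i). \<forall>\<beta>\<in>elts \<alpha>. \<alpha> \<notin> T \<beta>}) \<or>
    (\<exists>\<beta>\<in>\<omega>1. stationary_in \<omega>1 (B \<inter> T \<beta>))"
proof (rule ccontr)
  assume neg: "\<not> ?thesis"
  note B = stationary_subset[OF assms]
  have sub: "B \<inter> X \<subseteq> \<omega>1" for X using B by blast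
  have "\<not> stationary_in \<omega>1 (B \<inter> - (\<Union>i\<in>\<omega>1. T i))" using neg by (simp add: Diff_eq)
  from nonstationary_club[OF this sub] obtain C0
    where C0: "club_in \<omega>1 C0" "\<And>\<alpha>. \<alpha> \<in> C0 \<Longrightarrow> \<alpha> \<notin> B \<inter> - (\<Union>i\<in>\<omega>1. T i)" by blast
  have "\<not> stationary_in \<omega>1 (B \<inter> {\<alpha> \<in> (\<Union>i\<in>\<omega>1. T i). \<forall>\<beta>\<in>elts \<alpha>. \<alpha> \<notin> T \<beta>})" using neg by simp
  from nonstationary_club[OF this sub] obtain C1 where C1: "club_in \<omega>1 C1"
    "\<And>\<alpha>. \<alpha> \<in> C1 \<Longrightarrow> \<alpha> \<notin> B \<inter> {\<alpha> \<in> (\<Union>i\<in>\<omega>1. T i). \<forall>\<beta>\<in>elts \<alpha>. \<alpha> \<notin> T \<beta>}" by blast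
  have "\<forall>\<beta>\<in>\<omega>1. \<exists>C. club_in \<omega>1 C \<and> (\<forall>\<alpha>\<in>C. \<alpha> \<notin> B \<inter> T \<beta>)"
    using neg nonstationary_club[OF _ sub] by simp
  then obtain C2 where C2: "\<And>\<beta>. \<beta> \<in> \<omega>1 \<Longrightarrow> club_in \<omega>1 (C2 \<beta>)"
    "\<And>\<alpha> \<beta>. \<beta> \<in> \<omega>1 \<Longrightarrow> \<alpha> \<in> C2 \<beta> \<Longrightarrow> \<alpha> \<notin> B \<inter> T \<beta>"
    by metis
  obtain \<alpha> where a: "\<alpha> \<in> B" "limit \<alpha>" "\<And>\<beta>. \<beta> \<in> elts \<alpha> \<Longrightarrow> \<alpha> \<in> C0 \<and> \<alpha> \<in> C1 \<and> \<alpha> \<in> C2 \<beta>"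
  proof -
    have "\<exists>\<alpha>\<in>B. limit \<alpha> \<and> (\<forall>\<beta>\<in>elts \<alpha>. \<forall>C\<in>{C0, C1, C2 \<beta>}. \<alpha> \<in> C)"
      by (rule stationary_diagonal[OF assms]) (use C0(1) C1(1) C2(1) in auto)
    then show ?thesis using that by auto
  qed
  then have "\<alpha> \<in> C0" "\<alpha> \<in> C1" using limit_elts_nonempty by blast+
  then obtain \<beta> where "\<beta> \<in> elts \<alpha>" "\<alpha> \<in> T \<beta>" using C0 C1 a by blast
  then show False using C2(2)[of \<beta> \<alpha>] a B \<omega>1_mem by blast
qed

text \<open>
  For club many \<open>\<alpha>\<close> the Skolem hull of \<open>\<alpha>\<close> has no further countable ordinals, so hulls of such
  \<open>\<alpha> \<in> B\<close> are the required sets.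
\<close>

lemma stationary_lift:
  fixes B Y :: "'k V set"
  assumes "stationary_in \<omega>1 B" "\<omega>1 \<subseteq> Y"
  shows "meets_closures Y {M \<in> ctble_subsets Y. vset (elts M \<inter> \<omega>1) \<in> B}"
  unfolding meets_closures_def
proof (intro conjI allI impI)
  fix F :: "'k V list \<Rightarrow> 'k V set" assume F: "countable_valued Y F"
  define G where "G xs = Cl F (set xs) \<inter> \<omega>1" for xs
  have "countable_valued \<omega>1 G"
    using Cl_countable(1)[OF F] assms(2)
    by (auto simp: countable_valued_def G_def lists_eq_set countable_finite intro!: countable_Int1)
  then obtain \<alpha> where a: "\<alpha> \<in> B" "closed_under G (elts \<alpha>)"
    using stationary_closed_ordinal[OF assms(1)] by blast
  have a1: "\<alpha> \<in> \<omega>1" using a assms(1) stationary_subset by blast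
  have aY: "elts \<alpha> \<subseteq> Y" "countable (elts \<alpha>)" using a1 assms(2) \<omega>1_mem \<omega>1_countable by blast+
  note c = Cl_countable[OF F aY]
  have "Cl F (elts \<alpha>) \<inter> \<omega>1 = elts \<alpha>"
  proof
    show "Cl F (elts \<alpha>) \<inter> \<omega>1 \<subseteq> elts \<alpha>"
      using a(2) Cl_finitary[of _ F "elts \<alpha>"] by (fastforce simp: closed_under_def G_def)
    show "elts \<alpha> \<subseteq> Cl F (elts \<alpha>) \<inter> \<omega>1" using a1 \<omega>1_mem by (auto intro: Cl.base)
  qed
  then show "\<exists>M\<in>{M \<in> ctble_subsets Y. vset (elts M \<inter> \<omega>1) \<in> B}. closed_under F (elts M)"
    using c a(1) Cl_closed
    by (intro bexI[of _ "vset (Cl F (elts \<alpha>))"]) (auto simp: elts_vset_countable ctble_subsets_def vset_elts)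
qed auto

text \<open>
  The substitute for a descending sequence of conditions that is generic over a countable model \<open>M\<close>.
  Here \<open>R q x q'\<close> says that \<open>q'\<close> extends \<open>q\<close> and fulfils the requirement indexed by \<open>x\<close>, and \<open>supp q\<close>
  collects the points that \<open>q\<close> mentions. A finite sequence of requirements leads
  to a condition by a fixed choice function, and \<open>M\<close> is taken closed under the map from the sequence
  to the support of that condition. Then enumerating \<open>M\<close> gives the sequence.
\<close>

lemma generic_sequence:
  fixes Y S :: "'k V set"
  assumes S: "meets_closures Y S" and p: "p \<in> D"
    and supp: "\<And>q. q \<in> D \<Longrightarrow> countable (supp q) \<and> supp q \<subseteq> Y" and ne: "supp p \<noteq> {}"
    and ext: "\<And>q x. q \<in> D \<Longrightarrow> x \<in> Y \<Longrightarrow> \<exists>q'\<in>D. R q x q'"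
  obtains M f where "M \<in> S" "f (0::nat) = p" "\<And>n. f n \<in> D" "\<And>n. supp (f n) \<subseteq> elts M"
    "\<And>n. \<exists>x\<in>elts M. R (f n) x (f (Suc n))" "\<And>x. x \<in> elts M \<Longrightarrow> \<exists>n. R (f n) x (f (Suc n))"
proof -
  have "\<forall>q x. \<exists>q'. q \<in> D \<and> x \<in> Y \<longrightarrow> q' \<in> D \<and> R q x q'" using ext by blast
  then obtain g where g: "\<And>q x. q \<in> D \<Longrightarrow> x \<in> Y \<Longrightarrow> g q x \<in> D \<and> R q x (g q x)" by metis
  define run where "run xs = foldl g p xs" for xs
  have run: "run xs \<in> D" if "xs \<in> lists Y" for xs
    using that by (induction xs rule: rev_induct) (auto simp: run_def p g)
  have "countable_valued Y (\<lambda>xs. supp (run xs))" using run supp by (auto simp: countable_valued_def)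
  then obtain M where M: "M \<in> S" "closed_under (\<lambda>xs. supp (run xs)) (elts M)"
    using S unfolding meets_closures_def by blast
  have MY: "elts M \<subseteq> Y" "countable (elts M)"
    using M(1) S by (auto simp: meets_closures_def ctble_subsets_def)
  have cl: "supp (run xs) \<subseteq> elts M" if "xs \<in> lists (elts M)" for xs
    using M(2) that by (simp add: closed_under_def)
  have "elts M \<noteq> {}" using cl[of "[]"] ne by (auto simp: run_def)
  define x where "x = from_nat_into (elts M)"
  have rng: "range x = elts M" using MY \<open>elts M \<noteq> {}\<close> by (simp add: x_def)
  then have xn: "x n \<in> elts M" for n by blast
  define f where "f n = run (map x [0..<n])" for n
  have l: "map x [0..<n] \<in> lists (elts M)" for n using xn by auto
  have fD: "f n \<in> D" for n unfolding f_def using l MY run lists_mono by blast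
  have R: "R (f n) (x n) (f (Suc n))" for n
  proof -
    have "f (Suc n) = g (f n) (x n)" by (simp add: f_def run_def)
    then show ?thesis using g[OF fD, of "x n"] xn MY by auto
  qed
  show ?thesis
  proof
    show "f 0 = p" by (simp add: f_def run_def)
    show "\<exists>n. R (f n) y (f (Suc n))" if "y \<in> elts M" for y using that R rng by (metis imageE)
  qed (use M fD R xn cl l in \<open>auto simp: f_def\<close>)
qed

end

section \<open>Forcing\<close>

locale forcing_notion =
  fixes P :: "'p set" and le :: "'p \<Rightarrow> 'p \<Rightarrow> bool"
  assumes le_refl: "p \<in> P \<Longrightarrow> le p p"
    and le_trans: "le p q \<Longrightarrow> le q r \<Longrightarrow> le p r"
begin

abbreviation "Feq \<equiv> forces_eq P le"
abbreviation "Fmem \<equiv> forces_mem P le"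

lemma dense_belowI: "(\<And>q. q \<in> P \<Longrightarrow> le q p \<Longrightarrow> \<exists>r\<in>P. le r q \<and> D r) \<Longrightarrow> dense_below P le D p"
  by (auto simp: dense_below_def)

lemma dense_belowD: "dense_below P le D p \<Longrightarrow> q \<in> P \<Longrightarrow> le q p \<Longrightarrow> \<exists>r\<in>P. le r q \<and> D r"
  by (auto simp: dense_below_def)

lemma dense_below_mono: "dense_below P le D p \<Longrightarrow> le q p \<Longrightarrow> dense_below P le D q"
  using le_trans unfolding dense_below_def by blast

lemma Feq_mono: "Feq s t p \<Longrightarrow> le q p \<Longrightarrow> Feq s t q"
  by (subst forces_eq.simps, subst (asm) forces_eq.simps) (auto dest: dense_below_mono)

lemma Fmem_mono: "Fmem s t p \<Longrightarrow> le q p \<Longrightarrow> Fmem s t q"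
  unfolding forces_mem_def by (rule dense_below_mono)

lemma name_induct:
  assumes "\<And>s. (\<And>x c. (x, c) \<in> entries s \<Longrightarrow> Q x) \<Longrightarrow> Q s"
  shows "Q (s :: ('i, 'p) name)"
  using wf_entries by (rule wf_induct_rule) (auto intro: assms)


text \<open>
  The density in the clauses for equality of names can be moved inside: a condition that is not
  itself below \<open>c\<close> satisfies the implication vacuously.
\<close>

lemma Feq_iff:
  "Feq s t p \<longleftrightarrow>
    (\<forall>(x, c)\<in>entries s. \<forall>q\<in>P. le q p \<longrightarrow> le q c \<longrightarrow>
       (\<exists>r\<in>P. le r q \<and> (\<exists>(y, d)\<in>entries t. le r d \<and> Feq x y r))) \<and>
    (\<forall>(y, d)\<in>entries t. \<forall>q\<in>P. le q p \<longrightarrow> le q d \<longrightarrow>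
       (\<exists>r\<in>P. le r q \<and> (\<exists>(x, c)\<in>entries s. le r c \<and> Feq x y r)))"
proof -
  have *: "dense_below P le (\<lambda>q. le q c \<longrightarrow> D q) p \<longleftrightarrow>
      (\<forall>q\<in>P. le q p \<longrightarrow> le q c \<longrightarrow> (\<exists>r\<in>P. le r q \<and> D r))" for c D
    unfolding dense_below_def using le_refl le_trans by meson
  show ?thesis by (subst forces_eq.simps) (simp only: *)
qed

lemma Feq_left:
  assumes "Feq s t p" "(x, c) \<in> entries s" "q \<in> P" "le q p" "le q c"
  obtains r y d where "r \<in> P" "le r q" "(y, d) \<in> entries t" "le r d" "Feq x y r"
  using assms unfolding Feq_iff[of s t] by blast

lemma Feq_right:
  assumes "Feq s t p" "(y, d) \<in> entries t" "q \<in> P" "le q p" "le q d"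
  obtains r x c where "r \<in> P" "le r q" "(x, c) \<in> entries s" "le r c" "Feq x y r"
  using assms unfolding Feq_iff[of s t] by blast

lemma Feq_refl: "Feq s s p"
proof (induction s arbitrary: p rule: name_induct)
  case (1 s)
  show ?case unfolding Feq_iff[of s s] using 1 le_refl by fastforce
qed

lemma Feq_sym: "Feq s t p \<Longrightarrow> Feq t s p"
proof (induction s arbitrary: t p rule: name_induct)
  case (1 s)
  from 1(2) show ?case
    unfolding Feq_iff[of s t] Feq_iff[of t s] using 1(1) by fastforce
qed

lemma Feq_trans: "Feq s t p \<Longrightarrow> Feq t u p \<Longrightarrow> Feq s u p"
proof (induction s arbitrary: t u p rule: name_induct)
  case (1 s)
  note IH = 1(1) and st = 1(2) and tu = 1(3)
  have left: "\<exists>r\<in>P. le r q \<and> (\<exists>(z, e)\<in>entries u. le r e \<and> Feq x z r)"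
    if x: "(x, c) \<in> entries s" and q: "q \<in> P" "le q p" "le q c" for x c q
  proof -
    obtain r y d where r: "r \<in> P" "le r q" "(y, d) \<in> entries t" "le r d" "Feq x y r"
      using Feq_left[OF st x q] .
    have "le r p" using r q le_trans by blast
    then obtain r' z e where r': "r' \<in> P" "le r' r" "(z, e) \<in> entries u" "le r' e" "Feq y z r'"
      using Feq_left[OF tu r(3,1) _ r(4)] by blast
    have "Feq x z r'" using IH[OF x Feq_mono[OF r(5) r'(2)] r'(5)] .
    moreover have "le r' q" using r r' le_trans by blast
    ultimately show ?thesis using r' by blast
  qed
  have right: "\<exists>r\<in>P. le r q \<and> (\<exists>(x, c)\<in>entries s. le r c \<and> Feq x z r)"
    if z: "(z, e) \<in> entries u" and q: "q \<in> P" "le q p" "le q e" for z e q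
  proof -
    obtain r y d where r: "r \<in> P" "le r q" "(y, d) \<in> entries t" "le r d" "Feq y z r"
      using Feq_right[OF tu z q] .
    have "le r p" using r q le_trans by blast
    then obtain r' x c where r': "r' \<in> P" "le r' r" "(x, c) \<in> entries s" "le r' c" "Feq x y r'"
      using Feq_right[OF st r(3,1) _ r(4)] by blast
    have "Feq x z r'" using IH[OF r'(3,5) Feq_mono[OF r(5) r'(2)]] .
    moreover have "le r' q" using r r' le_trans by blast
    ultimately show ?thesis using r' by blast
  qed
  show ?case unfolding Feq_iff[of s u] using left right by blast
qed

lemma FmemI: "(y, d) \<in> entries t \<Longrightarrow> le p d \<Longrightarrow> Feq s y p \<Longrightarrow> Fmem s t p"
  unfolding forces_mem_def dense_below_def using le_refl le_trans Feq_mono by blast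

lemma FmemE:
  assumes "Fmem s t p" "q \<in> P" "le q p"
  obtains r y d where "r \<in> P" "le r q" "(y, d) \<in> entries t" "le r d" "Feq s y r"
  using assms unfolding forces_mem_def dense_below_def by blast

lemma Fmem_cong_left:
  assumes "Fmem s t p" "Feq s s' p" shows "Fmem s' t p"
  unfolding forces_mem_def
proof (rule dense_belowI)
  fix q assume q: "q \<in> P" "le q p"
  obtain r y d where r: "r \<in> P" "le r q" "(y, d) \<in> entries t" "le r d" "Feq s y r"
    using FmemE[OF assms(1) q] by blast
  have "Feq s' s r" using Feq_sym[OF Feq_mono[OF assms(2)]] q r le_trans by blast
  then have "Feq s' y r" using Feq_trans r by blast
  then show "\<exists>r\<in>P. le r q \<and> (\<exists>(y, d)\<in>entries t. le r d \<and> Feq s' y r)" using r by blast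
qed

lemma Fmem_cong_right:
  assumes "Fmem s t p" "Feq t t' p" shows "Fmem s t' p"
  unfolding forces_mem_def
proof (rule dense_belowI)
  fix q assume q: "q \<in> P" "le q p"
  obtain r y d where r: "r \<in> P" "le r q" "(y, d) \<in> entries t" "le r d" "Feq s y r"
    using FmemE[OF assms(1) q] by blast
  have "le r p" using r q le_trans by blast
  then obtain r' z e where r': "r' \<in> P" "le r' r" "(z, e) \<in> entries t'" "le r' e" "Feq y z r'"
    using Feq_left[OF assms(2) r(3,1) _ r(4)] by blast
  have "Feq s z r'" using Feq_trans Feq_mono r r' by blast
  then show "\<exists>r\<in>P. le r q \<and> (\<exists>(y, d)\<in>entries t'. le r d \<and> Feq s y r)" using r' r le_trans by blast
qed

text \<open>
  Forced equality of check names is true equality: \<open>\<in>\<close>-induction, using extensionality.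
\<close>

lemma Feq_check: "Feq (check P x) (check P y) p \<Longrightarrow> p \<in> P \<Longrightarrow> x = y"
proof (induction x arbitrary: y p rule: mem_induct)
  case (1 x)
  note IH = 1(1) and eq = 1(2) and p = 1(3)
  show ?case
  proof (intro elts_eqI equalityI subsetI)
    fix a assume a: "a \<in> elts x"
    then have "(check P a, p) \<in> entries (check P x)" using p by (auto simp: entries_check)
    from Feq_left[OF eq this p le_refl[OF p] le_refl[OF p]]
    obtain r b where "r \<in> P" "b \<in> elts y" "Feq (check P a) (check P b) r"
      unfolding entries_check[of P y] by blast
    then show "a \<in> elts y" using IH[OF a] by blast
  next
    fix b assume b: "b \<in> elts y"
    then have "(check P b, p) \<in> entries (check P y)" using p by (auto simp: entries_check)
    from Feq_right[OF eq this p le_refl[OF p] le_refl[OF p]]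
    obtain r a where "r \<in> P" "a \<in> elts x" "Feq (check P a) (check P b) r"
      unfolding entries_check[of P x] by blast
    then show "b \<in> elts x" using IH by blast
  qed
qed

lemma Fmem_checkI: "x \<in> elts y \<Longrightarrow> p \<in> P \<Longrightarrow> Fmem (check P x) (check P y) p"
  by (rule FmemI[of "check P x" p]) (auto simp: entries_check le_refl Feq_refl)

lemma Fmem_check_setI: "x \<in> A \<Longrightarrow> p \<in> P \<Longrightarrow> Fmem (check P x) (check_set P A) p"
  by (rule FmemI[of "check P x" p]) (auto simp: entries_check_set le_refl Feq_refl)

lemma Fmem_checkE:
  assumes "Fmem s (check P y) p" "p \<in> P"
  obtains r x where "r \<in> P" "le r p" "x \<in> elts y" "Feq s (check P x) r"
  using FmemE[OF assms(1,2) le_refl[OF assms(2)]] unfolding entries_check by blast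

lemma Fmem_check_setE:
  assumes "Fmem s (check_set P A) p" "p \<in> P"
  obtains r x where "r \<in> P" "le r p" "x \<in> A" "Feq s (check P x) r"
  using FmemE[OF assms(1,2) le_refl[OF assms(2)]] unfolding entries_check_set by blast

lemma Fmem_check: "Fmem (check P x) (check P y) p \<Longrightarrow> p \<in> P \<Longrightarrow> x \<in> elts y"
  using Fmem_checkE Feq_check by metis

lemma Fmem_check_set_mono: "A \<subseteq> B \<Longrightarrow> Fmem s (check_set P A) p \<Longrightarrow> Fmem s (check_set P B) p"
  unfolding forces_mem_def dense_below_def entries_check_set by fast

lemma is_name_check: "is_name P (check P x)"
  by (induction x rule: mem_induct, rule is_name.intros) (auto simp: entries_check)

lemma fImp_iff: "fImp P le \<phi> \<psi> p \<longleftrightarrow>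
    (\<forall>q\<in>P. le q p \<longrightarrow> \<phi> q \<longrightarrow> (\<exists>r\<in>P. le r q \<and> \<psi> r))"
  by (auto simp: fImp_def fNot_def fAnd_def)

lemma fImpD: "fImp P le \<phi> \<psi> p \<Longrightarrow> q \<in> P \<Longrightarrow> le q p \<Longrightarrow> \<phi> q \<Longrightarrow> \<exists>r\<in>P. le r q \<and> \<psi> r"
  by (simp add: fImp_iff)

lemma fEx_iff: "fEx P le \<phi> p \<longleftrightarrow> dense_below P le (\<lambda>q. \<exists>x. is_name P x \<and> \<phi> x q) p"
  unfolding fEx_def fNot_def fAll_def dense_below_def by blast

lemma fBall_iff: "fBall P le A \<phi> p \<longleftrightarrow> (\<forall>x. is_name P x \<longrightarrow>
    (\<forall>q\<in>P. le q p \<longrightarrow> Fmem x A q \<longrightarrow> (\<exists>r\<in>P. le r q \<and> \<phi> x r)))"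
  by (simp add: fBall_def fAll_def fImp_iff)

lemma fBex_iff: "fBex P le A \<phi> p \<longleftrightarrow>
    dense_below P le (\<lambda>q. \<exists>x. is_name P x \<and> Fmem x A q \<and> \<phi> x q) p"
  by (simp add: fBex_def fEx_iff fAnd_def)

lemma fBallD:
  "fBall P le A \<phi> p \<Longrightarrow> is_name P x \<Longrightarrow> q \<in> P \<Longrightarrow> le q p \<Longrightarrow> Fmem x A q \<Longrightarrow> \<exists>r\<in>P. le r q \<and> \<phi> x r"
  by (simp add: fBall_iff)

lemma fBall_mono: "fBall P le A \<phi> p \<Longrightarrow> le q p \<Longrightarrow> fBall P le A \<phi> q"
  using le_trans unfolding fBall_iff by blast

lemma forces_club_mono: "forces_club_in P le W C p \<Longrightarrow> le q p \<Longrightarrow> forces_club_in P le W C q"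
  unfolding forces_club_in_def fAnd_def using fBall_mono by blast

text \<open>
  This lemma and the next one translate a forced club into the ground model: elements of \<open>C\<close> above any
  ordinal can be decided, and a limit of decided elements can be forced into \<open>C\<close>.
\<close>

lemma forces_club_unbounded:
  assumes "forces_club_in P le (check_set P W) C p" "q \<in> P" "le q p" "\<alpha> \<in> W"
  shows "\<exists>r\<in>P. le r q \<and> (\<exists>\<gamma>\<in>W. \<alpha> \<in> elts \<gamma> \<and> Fmem (check P \<gamma>) C r)"
proof -
  have sub: "fBall P le C (\<lambda>\<alpha>. Fmem \<alpha> (check_set P W)) p"
    and unb: "fBall P le (check_set P W) (\<lambda>\<alpha>. fBex P le C (\<lambda>\<beta>. Fmem \<alpha> \<beta>)) p"
    using assms(1) by (auto simp: forces_club_in_def fAnd_def)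
  obtain r1 where r1: "r1 \<in> P" "le r1 q" "fBex P le C (\<lambda>\<beta>. Fmem (check P \<alpha>) \<beta>) r1"
    using fBallD[OF unb is_name_check assms(2,3) Fmem_check_setI] assms(2,4) by blast
  then obtain r2 x where r2: "r2 \<in> P" "le r2 r1" "is_name P x" "Fmem x C r2" "Fmem (check P \<alpha>) x r2"
    unfolding fBex_iff using dense_belowD le_refl by blast
  have "le r2 p" using r1 r2 assms le_trans by blast
  then obtain r3 where r3: "r3 \<in> P" "le r3 r2" "Fmem x (check_set P W) r3"
    using fBallD[OF sub] r2 by blast
  then obtain r4 \<gamma> where r4: "r4 \<in> P" "le r4 r3" "\<gamma> \<in> W" "Feq x (check P \<gamma>) r4"
    using Fmem_check_setE by metis
  have le: "le r4 r2" using r4 r3 le_trans by blast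
  have "Fmem (check P \<gamma>) C r4" using Fmem_cong_left[OF Fmem_mono[OF r2(4) le] r4(4)] .
  moreover have "\<alpha> \<in> elts \<gamma>"
    using Fmem_check[OF Fmem_cong_right[OF Fmem_mono[OF r2(5) le] r4(4)] r4(1)] .
  ultimately show ?thesis using r4 le r2 r1 le_trans by blast
qed

lemma forces_club_closed:
  assumes "forces_club_in P le (check_set P W) C p" "q \<in> P" "le q p" "\<delta> \<in> W" "elts \<delta> \<noteq> {}"
    and lim: "\<And>\<beta>. \<beta> \<in> elts \<delta> \<Longrightarrow> \<exists>\<gamma>\<in>elts \<delta>. \<beta> \<in> elts \<gamma> \<and> Fmem (check P \<gamma>) C q"
  shows "\<exists>r\<in>P. le r q \<and> Fmem (check P \<delta>) C r"
proof -
  have cl: "fBall P le (check_set P W) (\<lambda>\<alpha>. fImp P le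
       (fAnd (fEx P le (\<lambda>\<beta>. Fmem \<beta> \<alpha>))
         (fBall P le \<alpha> (\<lambda>\<beta>. fBex P le C (\<lambda>\<gamma>. fAnd (Fmem \<gamma> \<alpha>) (Fmem \<beta> \<gamma>)))))
       (Fmem \<alpha> C)) p"
    using assms(1) by (auto simp: forces_club_in_def fAnd_def)
  obtain r where r: "r \<in> P" "le r q" and imp: "fImp P le
       (fAnd (fEx P le (\<lambda>\<beta>. Fmem \<beta> (check P \<delta>)))
         (fBall P le (check P \<delta>) (\<lambda>\<beta>. fBex P le C (\<lambda>\<gamma>. fAnd (Fmem \<gamma> (check P \<delta>)) (Fmem \<beta> \<gamma>)))))
       (Fmem (check P \<delta>) C) r"
    using fBallD[OF cl is_name_check assms(2,3) Fmem_check_setI[OF assms(4,2)]] by blast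
  have "fEx P le (\<lambda>\<beta>. Fmem \<beta> (check P \<delta>)) r"
    unfolding fEx_iff
  proof (rule dense_belowI)
    fix s assume "s \<in> P" "le s r"
    moreover obtain \<beta> where "\<beta> \<in> elts \<delta>" using assms(5) by blast
    ultimately show "\<exists>t\<in>P. le t s \<and> (\<exists>x. is_name P x \<and> Fmem x (check P \<delta>) t)"
      using le_refl is_name_check Fmem_checkI by blast
  qed
  moreover have "fBall P le (check P \<delta>) (\<lambda>\<beta>. fBex P le C (\<lambda>\<gamma>. fAnd (Fmem \<gamma> (check P \<delta>)) (Fmem \<beta> \<gamma>))) r"
    unfolding fBall_iff
  proof (intro allI impI ballI)
    fix x s assume s: "s \<in> P" "le s r" "Fmem x (check P \<delta>) s"
    then obtain t \<beta> where t: "t \<in> P" "le t s" "\<beta> \<in> elts \<delta>" "Feq x (check P \<beta>) t"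
      using Fmem_checkE by metis
    obtain \<gamma> where g: "\<gamma> \<in> elts \<delta>" "\<beta> \<in> elts \<gamma>" "Fmem (check P \<gamma>) C q" using lim t by blast
    have "fBex P le C (\<lambda>\<gamma>. fAnd (Fmem \<gamma> (check P \<delta>)) (Fmem x \<gamma>)) t"
      unfolding fBex_iff
    proof (rule dense_belowI)
      fix u assume u: "u \<in> P" "le u t"
      then have "Fmem (check P \<gamma>) C u" using g s t r le_trans Fmem_mono by meson
      moreover have "Fmem (check P \<gamma>) (check P \<delta>) u" using Fmem_checkI g u by blast
      moreover have "Fmem x (check P \<gamma>) u"
        using Fmem_cong_left[OF Fmem_checkI Feq_sym[OF Feq_mono]] g u t by blast
      ultimately show "\<exists>w\<in>P. le w u \<and> (\<exists>y. is_name P y \<and> Fmem y C w \<and>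
          fAnd (Fmem y (check P \<delta>)) (Fmem x y) w)"
        unfolding fAnd_def using u le_refl is_name_check by blast
    qed
    then show "\<exists>t\<in>P. le t s \<and> fBex P le C (\<lambda>\<gamma>. fAnd (Fmem \<gamma> (check P \<delta>)) (Fmem x \<gamma>)) t"
      using t by blast
  qed
  ultimately obtain r' where "r' \<in> P" "le r' r" "Fmem (check P \<delta>) C r'"
    using fImpD[OF imp r(1) le_refl[OF r(1)]] unfolding fAnd_def by blast
  then show ?thesis using r le_trans by blast
qed

lemma forces_stationaryI:
  fixes B W :: "'k V set"
  assumes "B \<subseteq> W"
    and "\<And>C q. is_name P C \<Longrightarrow> q \<in> P \<Longrightarrow> le q p \<Longrightarrow>
      forces_club_in P le (check_set P W) (C :: ('k, 'p) vname) q \<Longrightarrow>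
      \<exists>r\<in>P. le r q \<and> (\<exists>\<gamma>\<in>B. Fmem (check P \<gamma>) C r)"
  shows "forces_stationary_in P le (check_set P W) (check_set P B) p"
  unfolding forces_stationary_in_def fAnd_def
proof
  show "fBall P le (check_set P B) (\<lambda>\<alpha>. Fmem \<alpha> (check_set P W)) p"
    unfolding fBall_iff using le_refl Fmem_check_set_mono[OF assms(1)] by blast
  have "\<exists>r\<in>P. le r q \<and> fBex P le C (\<lambda>\<alpha>. Fmem \<alpha> (check_set P B)) r"
    if C: "is_name P C" and q: "q \<in> P" "le q p" "forces_club_in P le (check_set P W) C q"
    for C :: "('k, 'p) vname" and q
  proof -
    have "fBex P le C (\<lambda>\<alpha>. Fmem \<alpha> (check_set P B)) q"
      unfolding fBex_iff
    proof (rule dense_belowI)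
      fix s assume s: "s \<in> P" "le s q"
      then have "le s p" "forces_club_in P le (check_set P W) C s"
        using q le_trans forces_club_mono by blast+
      then obtain t \<gamma> where "t \<in> P" "le t s" "\<gamma> \<in> B" "Fmem (check P \<gamma>) C t"
        using assms(2)[OF C s(1)] by blast
      then show "\<exists>t\<in>P. le t s \<and> (\<exists>x. is_name P x \<and> Fmem x C t \<and> Fmem x (check_set P B) t)"
        using is_name_check Fmem_check_setI by blast
    qed
    then show ?thesis using q le_refl by blast
  qed
  then show "fAll P (\<lambda>C :: ('k, 'p) vname. fImp P le (forces_club_in P le (check_set P W) C)
      (fBex P le C (\<lambda>\<alpha>. Fmem \<alpha> (check_set P B)))) p"
    unfolding fAll_def fImp_iff by blast
qed

text \<open>
  A relation \<open>e \<alpha> q\<close> that is preserved by passing to stronger conditions is the same as a name for a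
  set of ordinals. If it is unbounded and closed as seen from the ground model, its name is forced to be club, and a stationary
  set in the extension must meet it. The closure hypothesis assumes of \<open>q\<close> only that it forces \<open>\<alpha>\<close> to be a
  limit point.
\<close>

lemma forces_stationaryD:
  fixes B W :: "'k V set" and e :: "'k V \<Rightarrow> 'p \<Rightarrow> bool"
  assumes p: "p \<in> P"
    and stat: "forces_stationary_in P le (check_set P W) (check_set P B) p"
    and mono: "\<And>\<alpha> q r. e \<alpha> q \<Longrightarrow> q \<in> P \<Longrightarrow> r \<in> P \<Longrightarrow> le r q \<Longrightarrow> e \<alpha> r"
    and e_W: "\<And>\<alpha> q. e \<alpha> q \<Longrightarrow> q \<in> P \<Longrightarrow> \<alpha> \<in> W"
    and unb: "\<And>q \<alpha>. q \<in> P \<Longrightarrow> le q p \<Longrightarrow> \<alpha> \<in> W \<Longrightarrow> \<exists>r\<in>P. le r q \<and> (\<exists>\<gamma>. \<alpha> \<in> elts \<gamma> \<and> e \<gamma> r)"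
    and cl: "\<And>q \<alpha>. q \<in> P \<Longrightarrow> le q p \<Longrightarrow> \<alpha> \<in> W \<Longrightarrow> elts \<alpha> \<noteq> {} \<Longrightarrow>
      (\<And>\<beta> q'. \<beta> \<in> elts \<alpha> \<Longrightarrow> q' \<in> P \<Longrightarrow> le q' q \<Longrightarrow>
         \<exists>r\<in>P. le r q' \<and> (\<exists>\<gamma>\<in>elts \<alpha>. \<beta> \<in> elts \<gamma> \<and> e \<gamma> r)) \<Longrightarrow>
      \<exists>r\<in>P. le r q \<and> e \<alpha> r"
  shows "\<exists>q\<in>P. le q p \<and> (\<exists>\<alpha>\<in>B. e \<alpha> q)"
proof -
  define E :: "('k, 'p) vname" where
    "E = Name (\<lambda>(\<alpha>, q). if q \<in> P \<and> e \<alpha> q then Some (check P \<alpha>, q) else None)"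
  have entries_E: "entries E = {(check P \<alpha>, q) | \<alpha> q. q \<in> P \<and> e \<alpha> q}"
    by (auto simp: E_def ran_def)
  have E_name: "is_name P E" by (rule is_name.intros) (auto simp: entries_E is_name_check)
  have E_I: "Fmem (check P \<alpha>) E q" if "q \<in> P" "e \<alpha> q" for \<alpha> q
    by (rule FmemI[of "check P \<alpha>" q]) (use that in \<open>auto simp: entries_E le_refl Feq_refl\<close>)
  have E_E: "\<exists>r\<in>P. le r q \<and> (\<exists>\<alpha>. e \<alpha> r \<and> Feq x (check P \<alpha>) r)" if x: "Fmem x E q" "q \<in> P" for x q
  proof -
    obtain r y d where "r \<in> P" "le r q" "(y, d) \<in> entries E" "le r d" "Feq x y r"
      using FmemE[OF x le_refl[OF x(2)]] .
    then show ?thesis unfolding entries_E using mono by blast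
  qed
  have "fBall P le E (\<lambda>\<alpha>. Fmem \<alpha> (check_set P W)) p"
    unfolding fBall_iff
  proof (intro allI impI ballI)
    fix x q assume "q \<in> P" "Fmem x E q"
    then obtain r \<alpha> where r: "r \<in> P" "le r q" "e \<alpha> r" "Feq x (check P \<alpha>) r" using E_E by blast
    then have "Fmem x (check_set P W) r"
      using Fmem_cong_left[OF Fmem_check_setI Feq_sym] e_W by blast
    then show "\<exists>r\<in>P. le r q \<and> Fmem x (check_set P W) r" using r by blast
  qed
  moreover have "fBall P le (check_set P W) (\<lambda>\<alpha>. fBex P le E (\<lambda>\<beta>. Fmem \<alpha> \<beta>)) p"
    unfolding fBall_iff
  proof (intro allI impI ballI)
    fix x q assume q: "q \<in> P" "le q p" "Fmem x (check_set P W) q"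
    then obtain r \<alpha> where r: "r \<in> P" "le r q" "\<alpha> \<in> W" "Feq x (check P \<alpha>) r"
      using Fmem_check_setE by metis
    have "fBex P le E (\<lambda>\<beta>. Fmem x \<beta>) r"
      unfolding fBex_iff
    proof (rule dense_belowI)
      fix s assume s: "s \<in> P" "le s r"
      then have "le s p" using r q le_trans by blast
      then obtain t \<gamma> where t: "t \<in> P" "le t s" "\<alpha> \<in> elts \<gamma>" "e \<gamma> t" using unb s r by blast
      have "Feq (check P \<alpha>) x t" using Feq_sym Feq_mono r s t le_trans by blast
      then have "Fmem x (check P \<gamma>) t" using Fmem_cong_left[OF Fmem_checkI] t by blast
      then show "\<exists>t\<in>P. le t s \<and> (\<exists>y. is_name P y \<and> Fmem y E t \<and> Fmem x y t)"
        using t E_I is_name_check by blast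
    qed
    then show "\<exists>r\<in>P. le r q \<and> fBex P le E (\<lambda>\<beta>. Fmem x \<beta>) r" using r by blast
  qed
  moreover have "fBall P le (check_set P W) (\<lambda>\<alpha>. fImp P le
       (fAnd (fEx P le (\<lambda>\<beta>. Fmem \<beta> \<alpha>))
         (fBall P le \<alpha> (\<lambda>\<beta>. fBex P le E (\<lambda>\<gamma>. fAnd (Fmem \<gamma> \<alpha>) (Fmem \<beta> \<gamma>)))))
       (Fmem \<alpha> E)) p"
    unfolding fBall_iff[of "check_set P W"]
  proof (intro allI impI ballI)
    fix x q assume q: "q \<in> P" "le q p" "Fmem x (check_set P W) q"
    then obtain r \<alpha> where r: "r \<in> P" "le r q" "\<alpha> \<in> W" "Feq x (check P \<alpha>) r"
      using Fmem_check_setE by metis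
    have "\<exists>t\<in>P. le t s \<and> Fmem x E t"
      if s: "s \<in> P" "le s r" and ne: "fEx P le (\<lambda>\<beta>. Fmem \<beta> x) s"
        and lim: "fBall P le x (\<lambda>\<beta>. fBex P le E (\<lambda>\<gamma>. fAnd (Fmem \<gamma> x) (Fmem \<beta> \<gamma>))) s" for s
    proof -
      have eq: "Feq x (check P \<alpha>) t" if "le t s" for t
        using that s r Feq_mono le_trans by blast
      have "le s p" using s r q le_trans by blast
      obtain u y where "u \<in> P" "le u s" "Fmem y x u"
        using dense_belowD[OF ne[unfolded fEx_iff] s(1) le_refl[OF s(1)]] by blast
      then have "elts \<alpha> \<noteq> {}" using Fmem_checkE[OF Fmem_cong_right] eq by blast
      moreover have "\<exists>r\<in>P. le r q' \<and> (\<exists>\<gamma>\<in>elts \<alpha>. \<beta> \<in> elts \<gamma> \<and> e \<gamma> r)"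
        if b: "\<beta> \<in> elts \<alpha>" and q': "q' \<in> P" "le q' s" for \<beta> q'
      proof -
        have "Fmem (check P \<beta>) x q'"
          using Fmem_cong_right[OF Fmem_checkI Feq_sym] b q' eq by blast
        then obtain u where u: "u \<in> P" "le u q'"
          "fBex P le E (\<lambda>\<gamma>. fAnd (Fmem \<gamma> x) (Fmem (check P \<beta>) \<gamma>)) u"
          using fBallD[OF lim is_name_check] q' by blast
        then obtain v y where v: "v \<in> P" "le v u" "Fmem y E v" "Fmem y x v" "Fmem (check P \<beta>) y v"
          unfolding fBex_iff fAnd_def using dense_belowD le_refl by blast
        then obtain w \<gamma> where w: "w \<in> P" "le w v" "e \<gamma> w" "Feq y (check P \<gamma>) w" using E_E by blast
        have les: "le w s" using w v u q' le_trans by blast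
        have "Fmem (check P \<gamma>) (check P \<alpha>) w"
          using Fmem_cong_right[OF Fmem_cong_left[OF Fmem_mono[OF v(4) w(2)] w(4)] eq[OF les]] .
        then have "\<gamma> \<in> elts \<alpha>" using Fmem_check w by blast
        moreover have "\<beta> \<in> elts \<gamma>"
          using Fmem_check[OF Fmem_cong_right[OF Fmem_mono[OF v(5) w(2)] w(4)] w(1)] .
        ultimately show ?thesis using w v u le_trans by blast
      qed
      ultimately obtain t where t: "t \<in> P" "le t s" "e \<alpha> t"
        using cl[OF s(1) \<open>le s p\<close> r(3)] by blast
      then have "Fmem x E t" using Fmem_cong_left[OF E_I Feq_sym] eq by blast
      then show ?thesis using t by blast
    qed
    then show "\<exists>r\<in>P. le r q \<and> fImp P le
       (fAnd (fEx P le (\<lambda>\<beta>. Fmem \<beta> x))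
         (fBall P le x (\<lambda>\<beta>. fBex P le E (\<lambda>\<gamma>. fAnd (Fmem \<gamma> x) (Fmem \<beta> \<gamma>)))))
       (Fmem x E) r"
      using r unfolding fImp_iff fAnd_def by blast
  qed
  ultimately have "forces_club_in P le (check_set P W) E p"
    by (simp add: forces_club_in_def fAnd_def)
  then obtain r where r: "r \<in> P" "le r p" "fBex P le E (\<lambda>\<alpha>. Fmem \<alpha> (check_set P B)) r"
    using stat E_name fImpD[OF _ p le_refl[OF p]]
    unfolding forces_stationary_in_def fAnd_def fAll_def by blast
  then obtain s x where s: "s \<in> P" "le s r" "Fmem x E s" "Fmem x (check_set P B) s"
    unfolding fBex_iff using dense_belowD le_refl by blast
  then obtain t \<alpha> where t: "t \<in> P" "le t s" "e \<alpha> t" "Feq x (check P \<alpha>) t" using E_E by blast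
  then obtain u \<beta> where u: "u \<in> P" "le u t" "\<beta> \<in> B" "Feq x (check P \<beta>) u"
    using Fmem_check_setE[OF Fmem_mono[OF s(4) t(2)] t(1)] by blast
  have "Feq (check P \<alpha>) (check P \<beta>) u" using Feq_trans[OF Feq_sym[OF Feq_mono[OF t(4) u(2)]] u(4)] .
  then have "\<alpha> = \<beta>" using Feq_check u by blast
  then show ?thesis using u t s r le_trans by blast
qed

end

section \<open>Conditions\<close>

lemma map_chain_union:
  fixes g :: "nat \<Rightarrow> 'a \<rightharpoonup> 'b"
  assumes "\<And>n. g n \<subseteq>\<^sub>m g (Suc n)"
  obtains u where "dom u = (\<Union>n. dom (g n))" "\<And>n. g n \<subseteq>\<^sub>m u"
proof -
  have mono: "g m \<subseteq>\<^sub>m g n" if "m \<le> n" for m n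
    using that by (induction rule: dec_induct) (auto intro: map_le_trans assms)
  define u where "u x = (if \<exists>n. x \<in> dom (g n) then g (SOME n. x \<in> dom (g n)) x else None)" for x
  have u: "u x = g n x" if "x \<in> dom (g n)" for x n
  proof -
    define m where "m = (SOME n. x \<in> dom (g n))"
    have m: "x \<in> dom (g m)" unfolding m_def using that by (rule someI)
    have "g m x = g n x"
      using mono[of m n] mono[of n m] m that by (metis map_le_def nat_le_linear)
    then show ?thesis using that by (auto simp: u_def m_def[symmetric])
  qed
  have "dom u = (\<Union>n. dom (g n))"
  proof (intro equalityI subsetI)
    fix x assume x: "x \<in> dom u"
    have "u x = None" if "\<not> (\<exists>n. x \<in> dom (g n))"
      unfolding u_def using that by (rule if_not_P)
    then have "\<exists>n. x \<in> dom (g n)" using x unfolding domIff by argo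
    then show "x \<in> (\<Union>n. dom (g n))" by simp
  next
    fix x assume "x \<in> (\<Union>n. dom (g n))"
    then obtain n where n: "x \<in> dom (g n)" by blast
    then show "x \<in> dom u" using u[OF n] by (auto simp: dom_def)
  qed
  moreover have "g n \<subseteq>\<^sub>m u" for n using u by (simp add: map_le_def)
  ultimately show ?thesis using that by blast
qed

lemma mem_trancl_Ord: "(y, \<alpha>) \<in> mem\<^sup>+ \<Longrightarrow> Ord \<alpha> \<Longrightarrow> y \<in> elts \<alpha>"
proof (induction rule: trancl_induct)
  case (step z w)
  then have "z \<in> elts w" by (simp add: mem_def)
  then show ?case using step Ord_in_Ord Ord_mem_trans by blast
qed (simp add: mem_def)

lemma DSRP_le_refl: "DSRP_le p p"
  by (simp add: DSRP_le_def)

lemma DSRP_le_trans: "DSRP_le p q \<Longrightarrow> DSRP_le q r \<Longrightarrow> DSRP_le p r"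
  unfolding DSRP_le_def by (blast intro: map_le_trans)

locale dsrp =
  fixes \<kappa> :: "'k rel" and \<S> :: "'k V set set" and T :: "'k V \<Rightarrow> 'k V set"
  assumes card: "Card_order \<kappa>" and regular: "regularCard \<kappa>" and uncountable: "cardSuc natLeq <o \<kappa>"
    and nonempty: "\<S> \<noteq> {}" and stationary: "S \<in> \<S> \<Longrightarrow> stationary_ctble (H \<kappa>) S"
    and disjoint: "disjoint_family_on T \<omega>1"
begin

lemma natLeq_less: "natLeq <o \<kappa>"
  using uncountable cardSuc_greater[OF natLeq_Card_order] ordLess_transitive by blast

lemma Cinfinite: "Cinfinite \<kappa>"
  using natLeq_less card natLeq_Cinfinite ordLess_imp_ordLeq by (metis cinfinite_mono)

lemma infinite_UNIV: "infinite (UNIV :: 'k set)"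
  using Cinfinite finite_subset[of "Field \<kappa>" UNIV] by (auto simp: cinfinite_def)

sublocale infinite_branching "TYPE('k)"
  by unfold_locales (rule infinite_UNIV)

lemma countable_less: "countable A \<Longrightarrow> |A| <o \<kappa>"
proof -
  assume "countable A"
  then have "|A| \<le>o |UNIV :: nat set|" using card_of_ordLeq unfolding countable_def by blast
  then have "|A| \<le>o natLeq" using card_of_nat ordLeq_ordIso_trans by blast
  then show ?thesis using natLeq_less ordLeq_ordLess_trans by blast
qed

lemma \<omega>1_H: "\<omega>1 \<subseteq> H \<kappa>"
proof
  fix \<alpha> :: "'k V" assume "\<alpha> \<in> \<omega>1"
  then have "{y. (y, \<alpha>) \<in> mem\<^sup>+} \<subseteq> elts \<alpha>" "countable (elts \<alpha>)"
    using mem_trancl_Ord \<omega>1_Ord \<omega>1_countable by auto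
  then show "\<alpha> \<in> H \<kappa>" unfolding H_def using countable_less countable_subset by blast
qed

text \<open>
  Countable subsets of \<open>H\<^sub>\<kappa>\<close> can themselves be members of elements of \<open>[H\<^sub>\<kappa>]\<^sup>\<omega>\<close>. Here the
  regularity of \<open>\<kappa>\<close> enters.
\<close>

lemma ctble_subsets_H: "ctble_subsets (H \<kappa>) \<subseteq> H \<kappa>"
proof
  fix M assume "M \<in> ctble_subsets (H \<kappa>)"
  then have M: "elts M \<subseteq> H \<kappa>" "countable (elts M)" by (auto simp: ctble_subsets_def)
  let ?U = "elts M \<union> (\<Union>x\<in>elts M. {y. (y, x) \<in> mem\<^sup>+})"
  have "|\<Union>x\<in>elts M. {y. (y, x) \<in> mem\<^sup>+}| <o \<kappa>"
  proof (rule card_of_UNION_ordLess_infinite_Field_regularCard[OF regular Cinfinite countable_less[OF M(2)]])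
    show "\<forall>x\<in>elts M. |{y. (y, x) \<in> mem\<^sup>+}| <o \<kappa>" using M(1) by (auto simp: H_def)
  qed
  then have U: "|?U| <o \<kappa>" using Un_Cinfinite_bound_strict[OF countable_less[OF M(2)] _ Cinfinite] by blast
  have "{y. (y, M) \<in> mem\<^sup>+} \<subseteq> ?U"
  proof
    fix y assume "y \<in> {y. (y, M) \<in> mem\<^sup>+}"
    then have "(y, M) \<in> mem\<^sup>+" by simp
    then show "y \<in> ?U" by (cases rule: tranclE) (auto simp: mem_def)
  qed
  then show "M \<in> H \<kappa>" unfolding H_def using U card_of_mono1 ordLeq_ordLess_trans by blast
qed

lemma stationary_ctble_superset:
  assumes "stationary_ctble (H \<kappa>) S" "A \<subseteq> H \<kappa>" "countable A"
  obtains M where "M \<in> S" "A \<subseteq> elts M" "M \<in> ctble_subsets (H \<kappa>)"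
proof -
  have "countable_valued (H \<kappa>) (\<lambda>_. A)" using assms(2,3) by (simp add: countable_valued_def)
  then obtain M where "M \<in> S" "closed_under (\<lambda>_. A) (elts M)" "S \<subseteq> ctble_subsets (H \<kappa>)"
    using stationary_meets_closures[OF assms(1)] unfolding meets_closures_def by blast
  moreover from this(2) have "A \<subseteq> elts M" unfolding closed_under_def by (metis lists.Nil)
  ultimately show ?thesis using that by blast
qed

lemma T_unique: "i \<in> \<omega>1 \<Longrightarrow> j \<in> \<omega>1 \<Longrightarrow> \<alpha> \<in> T i \<Longrightarrow> \<alpha> \<in> T j \<Longrightarrow> i = j"
  using disjoint unfolding disjoint_family_on_def by blast

definition S_sequence :: "('k V \<rightharpoonup> 'k V set) \<Rightarrow> bool" where
  "S_sequence S \<longleftrightarrow> (\<exists>l\<in>\<omega>1. dom S = elts l) \<and> ran S \<subseteq> \<S>"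

lemma S_extend:
  assumes S: "S_sequence S" and i: "i \<in> \<omega>1" and S0: "S0 \<in> \<S>"
  obtains S' where "S_sequence S'" "S \<subseteq>\<^sub>m S'" "i \<in> dom S'" "\<And>j. j \<in> dom S' \<Longrightarrow> j \<notin> dom S \<Longrightarrow> S' j = Some S0"
proof (cases "i \<in> dom S")
  case True
  then show ?thesis using that[of S] S by auto
next
  case False
  obtain l where l: "l \<in> \<omega>1" "dom S = elts l" using S by (auto simp: S_sequence_def)
  define S' where "S' j = (if j \<in> dom S then S j else if j \<in> elts (osuc i) then Some S0 else None)" for j
  have "elts l \<subseteq> elts (osuc i)"
    using \<omega>1_linear[OF i l(1)] False l \<omega>1_trans[OF i] by (auto simp: elts_osuc)
  then have dom: "dom S' = elts (osuc i)" using l by (auto simp: S'_def dom_def)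
  have "y \<in> \<S>" if "S' j = Some y" for j y
    using that S S0 by (auto simp: S_sequence_def S'_def ran_def split: if_splits)
  then have "S_sequence S'" unfolding S_sequence_def using dom osuc_\<omega>1[OF i] by (auto simp: ran_def)
  moreover have "S \<subseteq>\<^sub>m S'" by (simp add: map_le_def S'_def)
  moreover have "i \<in> dom S'" using dom mem_osuc by blast
  moreover have "S' j = Some S0" if "j \<in> dom S'" "j \<notin> dom S" for j
    using that dom by (simp add: S'_def)
  ultimately show ?thesis using that by blast
qed

text \<open>
  At most one index \<open>i\<close> constrains the model at position \<open>\<alpha>\<close>, since the \<open>T i\<close> are disjoint.
  After deciding \<open>S\<^sub>i\<close> the constraint is membership in a single stationary set \<open>S1\<close>.
\<close>

lemma S_extend_stationary:
  assumes S: "S_sequence S"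
  obtains S' S1 where "S_sequence S'" "S \<subseteq>\<^sub>m S'" "S1 \<in> \<S>"
    "\<And>i. i \<in> \<omega>1 \<Longrightarrow> \<alpha> \<in> T i \<Longrightarrow> S' i = Some S1"
proof (cases "\<exists>j\<in>\<omega>1. \<alpha> \<in> T j")
  case True
  then obtain j where j: "j \<in> \<omega>1" "\<alpha> \<in> T j" by blast
  obtain S0 where S0: "S0 \<in> \<S>" using nonempty by blast
  obtain S' where S': "S_sequence S'" "S \<subseteq>\<^sub>m S'" "j \<in> dom S'"
    using S_extend[OF S j(1) S0] .
  then obtain S1 where S1: "S' j = Some S1" by blast
  then have "S1 \<in> \<S>" using S'(1) by (auto simp: S_sequence_def ran_def)
  moreover have "S' i = Some S1" if "i \<in> \<omega>1" "\<alpha> \<in> T i" for i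
    using T_unique[OF that(1) j(1) that(2) j(2)] S1 by simp
  ultimately show ?thesis using that S' by blast
next
  case False
  then show ?thesis using that[of S] S nonempty by auto
qed

text \<open>
  The clauses of a condition, for a chain indexed by all ordinals below \<open>\<xi>\<close> rather than up to and
  including some \<open>\<delta>\<close>. Conditions are the case \<open>\<xi> = \<delta> + 1\<close>, while for limit \<open>\<xi>\<close> this describes
  the union of a descending sequence of conditions before a top is added.
\<close>

definition pre_condition :: "'k V \<Rightarrow> 'k dsrp_cond \<Rightarrow> bool" where
  "pre_condition \<xi> p \<longleftrightarrow> \<xi> \<in> \<omega>1 \<and> dom (fst p) = elts \<xi> \<and> ran (fst p) \<subseteq> ctble_subsets (H \<kappa>) \<and>
     (\<forall>\<alpha>\<in>elts \<xi>. osuc \<alpha> \<in> elts \<xi> \<longrightarrow> the (fst p \<alpha>) \<in> elts (the (fst p (osuc \<alpha>)))) \<and>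
     (\<forall>\<alpha>\<in>elts \<xi>. limit \<alpha> \<longrightarrow> elts (the (fst p \<alpha>)) = (\<Union>\<beta>\<in>elts \<alpha>. elts (the (fst p \<beta>)))) \<and>
     S_sequence (snd p) \<and>
     (\<forall>\<alpha>\<in>elts \<xi>. \<forall>i\<in>\<omega>1. \<alpha> \<in> T i \<longrightarrow> i \<in> dom (snd p) \<and> the (fst p \<alpha>) \<in> the (snd p i))"

lemma DSRP_iff: "p \<in> DSRP \<kappa> \<S> T \<longleftrightarrow> (\<exists>\<delta>\<in>\<omega>1. pre_condition (osuc \<delta>) p)"
proof -
  obtain Q S where p: "p = (Q, S)" by fastforce
  have osuc_in: "osuc \<alpha> \<in> elts (osuc \<delta>) \<longleftrightarrow> \<alpha> \<in> elts \<delta>" if "\<delta> \<in> \<omega>1" for \<alpha> \<delta> :: "'k V"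
    using that osuc_le[of \<delta> \<alpha>] mem_osuc[of \<alpha>] \<omega>1_trans[of \<delta> "osuc \<alpha>" \<alpha>] by (auto simp: elts_osuc)
  have "pre_condition (osuc \<delta>) p \<longleftrightarrow> continuous_mem_chain \<kappa> \<delta> Q \<and> S_sequence S \<and>
      (\<forall>\<alpha>\<in>dom Q. \<forall>i\<in>\<omega>1. \<alpha> \<in> T i \<longrightarrow> i \<in> dom S \<and> the (Q \<alpha>) \<in> the (S i))"
    if d: "\<delta> \<in> \<omega>1" for \<delta>
  proof -
    have A: "(\<forall>\<alpha>\<in>elts (osuc \<delta>). osuc \<alpha> \<in> elts (osuc \<delta>) \<longrightarrow> the (Q \<alpha>) \<in> elts (the (Q (osuc \<alpha>)))) \<longleftrightarrow>
       (\<forall>\<alpha>\<in>elts \<delta>. the (Q \<alpha>) \<in> elts (the (Q (osuc \<alpha>))))"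
      unfolding osuc_in[OF d] by (auto simp: elts_osuc)
    show ?thesis
      unfolding pre_condition_def continuous_mem_chain_def p fst_conv snd_conv
        elts_osuc[symmetric] A
      by (simp cong: conj_cong add: osuc_\<omega>1[OF d])
  qed
  moreover have "(\<exists>l\<in>\<omega>1. dom S = elts l \<and> ran S \<subseteq> \<S> \<and> F (elts l)) \<longleftrightarrow>
      ((\<exists>l\<in>\<omega>1. dom S = elts l) \<and> ran S \<subseteq> \<S>) \<and> F (dom S)" for F
    by (simp cong: conj_cong) metis
  from this[of "\<lambda>A. \<forall>\<alpha>\<in>dom Q. \<forall>i\<in>\<omega>1. \<alpha> \<in> T i \<longrightarrow> i \<in> A \<and> the (Q \<alpha>) \<in> the (S i)"]
  have "p \<in> DSRP \<kappa> \<S> T \<longleftrightarrow> (\<exists>\<delta>\<in>\<omega>1. continuous_mem_chain \<kappa> \<delta> Q \<and> S_sequence S \<and>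
      (\<forall>\<alpha>\<in>dom Q. \<forall>i\<in>\<omega>1. \<alpha> \<in> T i \<longrightarrow> i \<in> dom S \<and> the (Q \<alpha>) \<in> the (S i)))"
    unfolding p DSRP_def S_sequence_def by simp
  ultimately show ?thesis by simp
qed

lemma DSRP_I: "pre_condition (osuc \<delta>) p \<Longrightarrow> p \<in> DSRP \<kappa> \<S> T"
  using DSRP_iff \<omega>1_mem mem_osuc by (metis pre_condition_def)

sublocale forcing_notion "DSRP \<kappa> \<S> T" DSRP_le
  by unfold_locales (auto intro: DSRP_le_refl DSRP_le_trans)

lemma pre_condition_ctble:
  assumes "pre_condition \<xi> p" "\<beta> \<in> elts \<xi>"
  shows "the (fst p \<beta>) \<in> ctble_subsets (H \<kappa>)"
proof -
  have "\<beta> \<in> dom (fst p)" using assms by (simp add: pre_condition_def)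
  then obtain M where M: "fst p \<beta> = Some M" by blast
  then have "M \<in> ran (fst p)" by (rule ranI)
  then show ?thesis using M assms(1) by (auto simp: pre_condition_def)
qed

lemma pre_condition_top:
  assumes p: "pre_condition \<xi> (Q, S)" and S': "S \<subseteq>\<^sub>m S'" "S_sequence S'" and M: "M \<in> ctble_subsets (H \<kappa>)"
    and suc: "\<And>\<alpha>. \<xi> = osuc \<alpha> \<Longrightarrow> the (Q \<alpha>) \<in> elts M"
    and lim: "limit \<xi> \<Longrightarrow> elts M = (\<Union>\<beta>\<in>elts \<xi>. elts (the (Q \<beta>)))"
    and T: "\<And>i. i \<in> \<omega>1 \<Longrightarrow> \<xi> \<in> T i \<Longrightarrow> i \<in> dom S' \<and> M \<in> the (S' i)"
  shows "pre_condition (osuc \<xi>) (Q(\<xi> \<mapsto> M), S')" "DSRP_le (Q(\<xi> \<mapsto> M), S') (Q, S)"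
proof -
  let ?Q = "Q(\<xi> \<mapsto> M)"
  have xi: "\<xi> \<in> \<omega>1" and dom: "dom Q = elts \<xi>" using p by (auto simp: pre_condition_def)
  have old: "?Q \<alpha> = Q \<alpha>" if "\<alpha> \<in> elts \<xi>" for \<alpha> using that mem_irrefl by auto
  have S'_eq: "S' i = S i" if "i \<in> dom S" for i using S'(1) that by (simp add: map_le_def)
  have 1: "the (?Q \<alpha>) \<in> elts (the (?Q (osuc \<alpha>)))" if a: "\<alpha> \<in> elts (osuc \<xi>)" "osuc \<alpha> \<in> elts (osuc \<xi>)" for \<alpha>
  proof -
    have "\<alpha> \<noteq> \<xi>" using a(2) mem_irrefl mem_asym mem_osuc[of \<alpha>] by (metis elts_osuc insertE)
    then have al: "\<alpha> \<in> elts \<xi>" using a(1) by (simp add: elts_osuc)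
    show ?thesis
    proof (cases "osuc \<alpha> = \<xi>")
      case True
      then show ?thesis using suc[of \<alpha>] old[OF al] by simp
    next
      case False
      then have "osuc \<alpha> \<in> elts \<xi>" using a(2) by (simp add: elts_osuc[of \<xi>])
      then have "the (Q \<alpha>) \<in> elts (the (Q (osuc \<alpha>)))" using p al unfolding pre_condition_def by simp
      then show ?thesis unfolding old[OF al] old[OF \<open>osuc \<alpha> \<in> elts \<xi>\<close>] .
    qed
  qed
  have 2: "elts (the (?Q \<alpha>)) = (\<Union>\<beta>\<in>elts \<alpha>. elts (the (?Q \<beta>)))" if a: "\<alpha> \<in> elts (osuc \<xi>)" "limit \<alpha>" for \<alpha>
  proof -
    have "elts \<alpha> \<subseteq> elts \<xi>" using a(1) \<omega>1_trans[OF xi] unfolding elts_osuc by blast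
    then have eq: "(\<Union>\<beta>\<in>elts \<alpha>. elts (the (?Q \<beta>))) = (\<Union>\<beta>\<in>elts \<alpha>. elts (the (Q \<beta>)))"
      using old by (intro SUP_cong) (auto simp del: fun_upd_apply)
    show ?thesis
    proof (cases "\<alpha> = \<xi>")
      case True
      then show ?thesis unfolding eq using lim a(2) by simp
    next
      case False
      then have al: "\<alpha> \<in> elts \<xi>" using a(1) by (simp add: elts_osuc)
      then have "elts (the (Q \<alpha>)) = (\<Union>\<beta>\<in>elts \<alpha>. elts (the (Q \<beta>)))"
        using p a(2) unfolding pre_condition_def fst_conv by blast
      then show ?thesis unfolding eq old[OF al] .
    qed
  qed
  have 3: "i \<in> dom S' \<and> the (?Q \<alpha>) \<in> the (S' i)" if a: "\<alpha> \<in> elts (osuc \<xi>)" "i \<in> \<omega>1" "\<alpha> \<in> T i" for \<alpha> i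
  proof (cases "\<alpha> = \<xi>")
    case True
    then show ?thesis using T a by simp
  next
    case False
    then have "\<alpha> \<in> elts \<xi>" using a by (simp add: elts_osuc)
    then have "i \<in> dom S" "the (Q \<alpha>) \<in> the (S i)" using p a by (auto simp: pre_condition_def)
    then show ?thesis unfolding old[OF \<open>\<alpha> \<in> elts \<xi>\<close>] using S'_eq[of i] by (simp add: domIff)
  qed
  have 4: "ran ?Q \<subseteq> ctble_subsets (H \<kappa>)"
  proof
    fix y assume "y \<in> ran ?Q"
    then show "y \<in> ctble_subsets (H \<kappa>)" using p M
      by (auto simp: ran_def pre_condition_def split: if_splits)
  qed
  show "pre_condition (osuc \<xi>) (?Q, S')"
    unfolding pre_condition_def fst_conv snd_conv
  proof (intro conjI ballI impI)
    show "dom ?Q = elts (osuc \<xi>)" using dom by (simp add: elts_osuc)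
  qed (fact osuc_\<omega>1[OF xi] 4 S'(2) | rule 1 2; assumption | use 3 in blast)+
  show "DSRP_le (?Q, S') (Q, S)"
    using S'(1) old dom by (auto simp: DSRP_le_def map_le_def)
qed

lemma pre_condition_union:
  assumes f: "\<And>n. f n \<in> DSRP \<kappa> \<S> T" "\<And>n. DSRP_le (f (Suc n)) (f n)"
    and dom: "(\<Union>n. dom (fst (f n))) = elts \<xi>" and xi: "\<xi> \<in> \<omega>1"
  obtains p where "pre_condition \<xi> p" "\<And>n. DSRP_le p (f n)" "dom (snd p) = (\<Union>n. dom (snd (f n)))"
proof -
  have le: "fst (f n) \<subseteq>\<^sub>m fst (f (Suc n))" "snd (f n) \<subseteq>\<^sub>m snd (f (Suc n))" for n
    using f(2) by (auto simp: DSRP_le_def)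
  obtain Q where Q: "dom Q = elts \<xi>" "\<And>n. fst (f n) \<subseteq>\<^sub>m Q"
    using map_chain_union[of "\<lambda>n. fst (f n)", OF le(1)] dom by metis
  obtain S where S: "dom S = (\<Union>n. dom (snd (f n)))" "\<And>n. snd (f n) \<subseteq>\<^sub>m S"
    using map_chain_union[of "\<lambda>n. snd (f n)", OF le(2)] by metis
  have "\<forall>n. \<exists>\<delta>. pre_condition (osuc \<delta>) (f n)" using f(1) DSRP_iff by blast
  then obtain d where d: "\<And>n. pre_condition (osuc (d n)) (f n)" by metis
  have domn: "dom (fst (f n)) = elts (osuc (d n))" for n using d by (simp add: pre_condition_def)
  have below: "elts \<alpha> \<subseteq> dom (fst (f n))" if "\<alpha> \<in> dom (fst (f n))" for \<alpha> n
    using that \<omega>1_trans[of "osuc (d n)" \<alpha>] d[of n] by (auto simp: domn pre_condition_def)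
  have Qeq: "Q \<alpha> = fst (f n) \<alpha>" if "\<alpha> \<in> dom (fst (f n))" for \<alpha> n
    using Q(2)[of n] that by (simp add: map_le_def)
  have Seq: "S i = snd (f n) i" if "i \<in> dom (snd (f n))" for i n
    using S(2)[of n] that by (simp add: map_le_def)
  have ex: "\<exists>n. \<alpha> \<in> dom (fst (f n))" if "\<alpha> \<in> elts \<xi>" for \<alpha> using that dom by blast
  have 1: "the (Q \<alpha>) \<in> elts (the (Q (osuc \<alpha>)))" if a: "osuc \<alpha> \<in> elts \<xi>" for \<alpha>
  proof -
    obtain n where n: "osuc \<alpha> \<in> dom (fst (f n))" using ex[OF a] by blast
    then have "\<alpha> \<in> dom (fst (f n))" using below mem_osuc by blast
    then show ?thesis using n d[of n] Qeq domn unfolding pre_condition_def by metis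
  qed
  have 2: "elts (the (Q \<alpha>)) = (\<Union>\<beta>\<in>elts \<alpha>. elts (the (Q \<beta>)))" if a: "\<alpha> \<in> elts \<xi>" "limit \<alpha>" for \<alpha>
  proof -
    obtain n where n: "\<alpha> \<in> dom (fst (f n))" using ex[OF a(1)] by blast
    have "elts (the (fst (f n) \<alpha>)) = (\<Union>\<beta>\<in>elts \<alpha>. elts (the (fst (f n) \<beta>)))"
      using d[of n] n a(2) unfolding pre_condition_def by blast
    moreover have "(\<Union>\<beta>\<in>elts \<alpha>. elts (the (fst (f n) \<beta>))) = (\<Union>\<beta>\<in>elts \<alpha>. elts (the (Q \<beta>)))"
    proof (intro SUP_cong refl)
      fix \<beta> assume "\<beta> \<in> elts \<alpha>"
      then show "elts (the (fst (f n) \<beta>)) = elts (the (Q \<beta>))" using Qeq[of \<beta> n] below[OF n] by (simp add: subsetD)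
    qed
    ultimately show ?thesis using Qeq[OF n] by simp
  qed
  have 3: "i \<in> dom S \<and> the (Q \<alpha>) \<in> the (S i)" if a: "\<alpha> \<in> elts \<xi>" "i \<in> \<omega>1" "\<alpha> \<in> T i" for \<alpha> i
  proof -
    obtain n where n: "\<alpha> \<in> dom (fst (f n))" using ex[OF a(1)] by blast
    then have "i \<in> dom (snd (f n))" "the (fst (f n) \<alpha>) \<in> the (snd (f n) i)"
      using d[of n] a(2,3) unfolding pre_condition_def by blast+
    then show ?thesis using Qeq[OF n] Seq S(1) by auto
  qed
  have 4: "ran Q \<subseteq> ctble_subsets (H \<kappa>)"
  proof
    fix y assume "y \<in> ran Q"
    then obtain \<alpha> where a: "Q \<alpha> = Some y" by (auto simp: ran_def)
    then obtain n where n: "\<alpha> \<in> dom (fst (f n))" using ex Q(1) by blast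
    then have "fst (f n) \<alpha> = Some y" using Qeq a by metis
    then show "y \<in> ctble_subsets (H \<kappa>)" using d[of n] unfolding pre_condition_def by (meson ranI subsetD)
  qed
  have "S_sequence S"
    unfolding S_sequence_def
  proof
    have "\<forall>n. \<exists>l\<in>\<omega>1. dom (snd (f n)) = elts l" using d unfolding pre_condition_def S_sequence_def by blast
    then obtain l where l: "\<And>n. l n \<in> \<omega>1" "\<And>n. dom (snd (f n)) = elts (l n)" by metis
    have c: "countable (dom S)" unfolding S(1) using l(2) \<omega>1_countable[OF l(1)] by (auto intro!: countable_UN)
    have "vset (dom S) \<in> \<omega>1"
    proof (rule vset_\<omega>1I[OF c])
      show "dom S \<subseteq> \<omega>1" unfolding S(1) l(2) using \<omega>1_mem[OF l(1)] by blast
      fix \<beta> assume "\<beta> \<in> dom S"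
      then obtain n where "\<beta> \<in> elts (l n)" unfolding S(1) l(2) by blast
      then have "elts \<beta> \<subseteq> elts (l n)" using \<omega>1_trans[OF l(1)] by blast
      then show "elts \<beta> \<subseteq> dom S" unfolding S(1) l(2) by blast
    qed
    then show "\<exists>l\<in>\<omega>1. dom S = elts l" using elts_vset_countable[OF c] by metis
    show "ran S \<subseteq> \<S>"
    proof
      fix y assume "y \<in> ran S"
      then obtain i where i: "S i = Some y" by (auto simp: ran_def)
      then obtain n where "i \<in> dom (snd (f n))" using S(1) by blast
      then have "snd (f n) i = Some y" using Seq i by metis
      then show "y \<in> \<S>" using d[of n] unfolding pre_condition_def S_sequence_def by (meson ranI subsetD)
    qed
  qed
  then have "pre_condition \<xi> (Q, S)"
    unfolding pre_condition_def fst_conv snd_conv using xi Q(1) 1 2 3 4 by blast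
  then show ?thesis using that[of "(Q, S)"] Q S by (simp add: DSRP_le_def)
qed

definition covered :: "'k dsrp_cond \<Rightarrow> 'k V set" where
  "covered p = (\<Union>\<beta>\<in>dom (fst p). elts (the (fst p \<beta>)))"

text \<open>
  All sets that a condition mentions at the level of \<open>H\<^sub>\<kappa>\<close>. If the support is contained in \<open>M\<close>, both lengths of the
  condition are at most \<open>M \<inter> \<omega>1\<close>, provided that this is an ordinal.
\<close>

definition support :: "'k dsrp_cond \<Rightarrow> 'k V set" where
  "support p = covered p \<union> dom (fst p) \<union> dom (snd p)"

lemma support_ctble:
  assumes "p \<in> DSRP \<kappa> \<S> T"
  shows "countable (support p)" "support p \<subseteq> H \<kappa>" "support p \<noteq> {}"
proof -
  obtain \<delta> where d: "\<delta> \<in> \<omega>1" "pre_condition (osuc \<delta>) p" using assms DSRP_iff by blast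
  have dom: "dom (fst p) = elts (osuc \<delta>)" using d by (simp add: pre_condition_def)
  have Q: "countable (elts (the (fst p \<beta>)))" "elts (the (fst p \<beta>)) \<subseteq> H \<kappa>" if "\<beta> \<in> dom (fst p)" for \<beta>
    using pre_condition_ctble[OF d(2)] that dom by (auto simp: ctble_subsets_def)
  obtain l where l: "l \<in> \<omega>1" "dom (snd p) = elts l"
    using d by (auto simp: pre_condition_def S_sequence_def)
  have c: "countable (dom (fst p))" "countable (dom (snd p))"
    using dom l \<omega>1_countable[OF osuc_\<omega>1[OF d(1)]] \<omega>1_countable[OF l(1)] by auto
  have s: "dom (fst p) \<subseteq> H \<kappa>" "dom (snd p) \<subseteq> H \<kappa>"
    using dom l \<omega>1_H \<omega>1_mem[OF l(1)] \<omega>1_mem[OF osuc_\<omega>1[OF d(1)]] by auto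
  show "countable (support p)" using c Q(1) by (auto simp: support_def covered_def)
  show "support p \<subseteq> H \<kappa>" unfolding support_def covered_def using s Q(2) by blast
  show "support p \<noteq> {}" using dom mem_osuc by (auto simp: support_def)
qed

text \<open>
  Adding the union \<open>M\<close> of a descending sequence as its top is allowed if \<open>M\<close> lies in the set
  \<open>S\<^sub>i\<close> that the sequence has chosen for \<open>\<delta> \<in> T\<^sub>i\<close>, or if the sequence has made no choice for \<open>i\<close>
  and some member of \<open>\<S>\<close> contains \<open>M\<close>. In the second case the entries up to \<open>i\<close> are all set to that
  member, which is harmless: no position below \<open>\<delta>\<close> lies in a \<open>T\<^sub>j\<close> with \<open>j\<close> undecided.
\<close>

lemma limit_condition:
  assumes f: "\<And>n. f n \<in> DSRP \<kappa> \<S> T" "\<And>n. DSRP_le (f (Suc n)) (f n)"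
    and dom: "(\<Union>n. dom (fst (f n))) = elts \<delta>" and delta: "\<delta> \<in> \<omega>1" "limit \<delta>"
    and M: "elts M = (\<Union>n. covered (f n))"
    and T: "\<And>i. i \<in> \<omega>1 \<Longrightarrow> \<delta> \<in> T i \<Longrightarrow>
      (\<exists>n. i \<in> dom (snd (f n)) \<and> M \<in> the (snd (f n) i)) \<or>
      ((\<forall>n. i \<notin> dom (snd (f n))) \<and> M \<in> \<Union>\<S>)"
  obtains q where "pre_condition (osuc \<delta>) q" "\<And>n. DSRP_le q (f n)" "fst q \<delta> = Some M"
proof -
  obtain p where p: "pre_condition \<delta> p" "\<And>n. DSRP_le p (f n)" "dom (snd p) = (\<Union>n. dom (snd (f n)))"
    using pre_condition_union[OF f dom delta(1)] by blast
  obtain Q S where QS: "p = (Q, S)" by fastforce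
  have S: "S_sequence S" using p(1) by (simp add: QS pre_condition_def)
  have Qf: "Q \<beta> = fst (f n) \<beta>" if "\<beta> \<in> dom (fst (f n))" for n \<beta>
    using p(2)[of n] that by (simp add: DSRP_le_def QS map_le_def)
  have Sf: "S i = snd (f n) i" if "i \<in> dom (snd (f n))" for n i
    using p(2)[of n] that by (simp add: DSRP_le_def QS map_le_def)
  have sub: "covered (f n) \<subseteq> support (f n)" for n by (auto simp: support_def)
  have "countable (covered (f n))" "covered (f n) \<subseteq> H \<kappa>" for n
    using countable_subset[OF sub support_ctble(1)[OF f(1)]] subset_trans[OF sub support_ctble(2)[OF f(1)]]
    by this+
  then have "countable (elts M)" "elts M \<subseteq> H \<kappa>" unfolding M by (simp_all add: UN_least)
  then have Mc: "M \<in> ctble_subsets (H \<kappa>)" by (simp add: ctble_subsets_def)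
  have M': "elts M = (\<Union>\<beta>\<in>elts \<delta>. elts (the (Q \<beta>)))"
  proof -
    have "elts M = (\<Union>n. \<Union>\<beta>\<in>dom (fst (f n)). elts (the (Q \<beta>)))"
      unfolding M covered_def by (intro SUP_cong refl) (simp add: Qf)
    then show ?thesis unfolding dom[symmetric] by simp
  qed
  have "\<exists>S'. S_sequence S' \<and> S \<subseteq>\<^sub>m S' \<and> (\<forall>i\<in>\<omega>1. \<delta> \<in> T i \<longrightarrow> i \<in> dom S' \<and> M \<in> the (S' i))"
  proof (cases "\<exists>i\<in>\<omega>1. \<delta> \<in> T i \<and> i \<notin> dom S")
    case True
    then obtain i where i: "i \<in> \<omega>1" "\<delta> \<in> T i" "i \<notin> dom S" by blast
    then have "M \<in> \<Union>\<S>" using T[OF i(1,2)] p(3) QS by auto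
    then obtain S0 where S0: "S0 \<in> \<S>" "M \<in> S0" by blast
    obtain S' where S': "S_sequence S'" "S \<subseteq>\<^sub>m S'" "i \<in> dom S'"
      "\<And>j. j \<in> dom S' \<Longrightarrow> j \<notin> dom S \<Longrightarrow> S' j = Some S0"
      using S_extend[OF S i(1) S0(1)] by blast
    then have "j \<in> dom S' \<and> M \<in> the (S' j)" if "j \<in> \<omega>1" "\<delta> \<in> T j" for j
      using T_unique[OF that(1) i(1) that(2) i(2)] i(3) S0(2) by simp
    then show ?thesis using S' by blast
  next
    case False
    have "M \<in> the (S i)" if i: "i \<in> \<omega>1" "\<delta> \<in> T i" for i
    proof -
      have "i \<in> dom S" using False i by blast
      then have "\<not> (\<forall>n. i \<notin> dom (snd (f n)))" using p(3) QS by auto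
      then obtain n where "i \<in> dom (snd (f n))" "M \<in> the (snd (f n) i)" using T[OF i] by blast
      then show ?thesis using Sf by simp
    qed
    then show ?thesis using False S by (intro exI[of _ S]) auto
  qed
  then obtain S' where S': "S_sequence S'" "S \<subseteq>\<^sub>m S'"
    "\<And>i. i \<in> \<omega>1 \<Longrightarrow> \<delta> \<in> T i \<Longrightarrow> i \<in> dom S' \<and> M \<in> the (S' i)" by blast
  have nsuc: "\<delta> \<noteq> osuc \<alpha>" for \<alpha> using delta(2) not_limit_osuc by blast
  note top = pre_condition_top[OF p(1)[unfolded QS] S'(2,1) Mc _ M' S'(3)]
  show ?thesis
  proof
    show "pre_condition (osuc \<delta>) (Q(\<delta> \<mapsto> M), S')" using top(1) nsuc by blast
    show "DSRP_le (Q(\<delta> \<mapsto> M), S') (f n)" for n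
      using DSRP_le_trans[OF top(2) p(2)[of n, unfolded QS]] nsuc by blast
  qed simp
qed

lemma extend_successor:
  assumes p: "pre_condition (osuc \<delta>) p" and A: "countable A" "A \<subseteq> H \<kappa>"
  obtains q where "pre_condition (osuc (osuc \<delta>)) q" "DSRP_le q p" "A \<subseteq> elts (the (fst q (osuc \<delta>)))"
proof -
  let ?\<xi> = "osuc \<delta>"
  obtain Q S where QS: "p = (Q, S)" by fastforce
  have xi: "?\<xi> \<in> \<omega>1" and S: "S_sequence S" using p by (simp_all add: QS pre_condition_def)
  obtain S' S1 where S': "S_sequence S'" "S \<subseteq>\<^sub>m S'" "S1 \<in> \<S>"
    "\<And>i. i \<in> \<omega>1 \<Longrightarrow> ?\<xi> \<in> T i \<Longrightarrow> S' i = Some S1"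
    using S_extend_stationary[OF S] by metis
  have Qd: "the (Q \<delta>) \<in> H \<kappa>"
    using pre_condition_ctble[OF p mem_osuc] ctble_subsets_H by (auto simp: QS)
  obtain M where M: "M \<in> S1" "insert (the (Q \<delta>)) A \<subseteq> elts M" "M \<in> ctble_subsets (H \<kappa>)"
  proof (rule stationary_ctble_superset[OF stationary[OF S'(3)]])
    show "insert (the (Q \<delta>)) A \<subseteq> H \<kappa>" "countable (insert (the (Q \<delta>)) A)" using A Qd by simp_all
  qed
  have suc: "the (Q \<alpha>) \<in> elts M" if "?\<xi> = osuc \<alpha>" for \<alpha>
  proof -
    have "\<alpha> = \<delta>" using osuc_inject[OF that] by simp
    then show ?thesis using M(2) by blast
  qed
  have T: "i \<in> dom S' \<and> M \<in> the (S' i)" if "i \<in> \<omega>1" "?\<xi> \<in> T i" for i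
    using S'(4)[OF that] M(1) by auto
  note top = pre_condition_top[OF p[unfolded QS] S'(2,1) M(3) suc _ T]
  show ?thesis
  proof
    show "pre_condition (osuc ?\<xi>) (Q(?\<xi> \<mapsto> M), S')" using top(1) not_limit_osuc by blast
    show "DSRP_le (Q(?\<xi> \<mapsto> M), S') p" unfolding QS using top(2) not_limit_osuc by blast
    show "A \<subseteq> elts (the (fst (Q(?\<xi> \<mapsto> M), S') ?\<xi>))" using M(2) by simp
  qed
qed

lemma extend_snd:
  assumes "pre_condition \<xi> (Q, S)" "S \<subseteq>\<^sub>m S'" "S_sequence S'"
  shows "pre_condition \<xi> (Q, S')"
proof -
  have eq: "S' i = S i" if "i \<in> dom S" for i using assms(2) that by (simp add: map_le_def)
  have "i \<in> dom S' \<and> the (Q \<alpha>) \<in> the (S' i)" if "\<alpha> \<in> elts \<xi>" "i \<in> \<omega>1" "\<alpha> \<in> T i" for \<alpha> i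
  proof -
    have "i \<in> dom S" "the (Q \<alpha>) \<in> the (S i)" using assms(1) that by (auto simp: pre_condition_def)
    then show ?thesis using eq[of i] by (metis domIff)
  qed
  then show ?thesis using assms(1,3) by (auto simp: pre_condition_def)
qed

text \<open>
  Induction on the target \<open>\<alpha>\<close>. For limit \<open>\<alpha>\<close> decide first which \<open>S1 \<in> \<S>\<close> must contain the
  new top, then run a generic sequence of conditions of length less than \<open>\<alpha>\<close> through some \<open>M \<in> S1\<close>
  that contains all ordinals below \<open>\<alpha>\<close>. Here \<open>M \<inter> \<omega>1\<close> may be larger than \<open>\<alpha>\<close>, so the
  stationarity of \<open>S1\<close> suffices.
\<close>

lemma extend_length:
  assumes "pre_condition (osuc \<delta>) p" "\<alpha> \<in> \<omega>1" "\<delta> \<in> elts (osuc \<alpha>)"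
  shows "\<exists>q. pre_condition (osuc \<alpha>) q \<and> DSRP_le q p"
  using assms
proof (induction \<alpha> arbitrary: \<delta> p rule: mem_induct)
  case (1 \<alpha>)
  note IH = 1(1) and p = 1(2) and alpha = 1(3)
  show ?case
  proof (cases "\<delta> = \<alpha>")
    case True
    then show ?thesis using p DSRP_le_refl by blast
  next
    case False
    then have da: "\<delta> \<in> elts \<alpha>" using 1(4) by (simp add: elts_osuc)
    from alpha show ?thesis
    proof (cases rule: \<omega>1_cases)
      case 1
      then show ?thesis using da by simp
    next
      case (2 \<beta>)
      then obtain q where q: "pre_condition (osuc \<beta>) q" "DSRP_le q p"
        using IH[of \<beta> \<delta> p] p da mem_osuc by blast
      obtain r where "pre_condition (osuc (osuc \<beta>)) r" "DSRP_le r q"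
        using extend_successor[OF q(1), of "{}"] by auto
      then show ?thesis using 2 q DSRP_le_trans by blast
    next
      case 3
      obtain Q S where QS: "p = (Q, S)" by fastforce
      have S: "S_sequence S" using p by (simp add: QS pre_condition_def)
      obtain S' S1 where S': "S_sequence S'" "S \<subseteq>\<^sub>m S'" "S1 \<in> \<S>"
        "\<And>i. i \<in> \<omega>1 \<Longrightarrow> \<alpha> \<in> T i \<Longrightarrow> S' i = Some S1"
        using S_extend_stationary[OF S] by metis
      define p' where "p' = (Q, S')"
      have p': "pre_condition (osuc \<delta>) p'" "DSRP_le p' p"
        using extend_snd[OF p[unfolded QS] S'(2,1)] S'(2) by (auto simp: p'_def QS DSRP_le_def)
      define D where "D = {q. \<exists>\<beta>\<in>elts \<alpha>. pre_condition (osuc \<beta>) q \<and> DSRP_le q p'}"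
      define R where "R q x q' \<longleftrightarrow> DSRP_le q' q \<and> (x \<in> elts \<alpha> \<longrightarrow> x \<in> dom (fst q')) \<and> x \<in> covered q'" for q q' x
      have D_DSRP: "q \<in> DSRP \<kappa> \<S> T" if "q \<in> D" for q using that DSRP_I unfolding D_def by blast
      have step: "\<exists>q'\<in>D. R q x q'" if q: "q \<in> D" and x: "x \<in> H \<kappa>" for q x
      proof -
        obtain \<beta> where b: "\<beta> \<in> elts \<alpha>" "pre_condition (osuc \<beta>) q" "DSRP_le q p'" using q by (auto simp: D_def)
        \<comment> \<open>Reach the requested length, then use one more step to cover \<open>x\<close>.\<close>
        have "\<exists>\<gamma>\<in>elts \<alpha>. \<beta> \<in> elts (osuc \<gamma>) \<and> (x \<in> elts \<alpha> \<longrightarrow> x \<in> elts (osuc \<gamma>))"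
        proof (cases "x \<in> elts \<alpha>")
          case True
          then obtain \<gamma> where "\<gamma> \<in> elts \<alpha>" "{\<beta>, x} \<subseteq> elts \<gamma>"
            using limit_common_bound[OF 3, of "{\<beta>, x}"] b by auto
          then show ?thesis by (auto simp: elts_osuc)
        next
          case False
          then show ?thesis using b mem_osuc by blast
        qed
        then obtain \<gamma> where g: "\<gamma> \<in> elts \<alpha>" "\<beta> \<in> elts (osuc \<gamma>)" "x \<in> elts \<alpha> \<Longrightarrow> x \<in> elts (osuc \<gamma>)" by blast
        obtain r where r: "pre_condition (osuc \<gamma>) r" "DSRP_le r q"
          using IH[OF g(1) b(2) \<omega>1_mem[OF alpha g(1)] g(2)] by blast
        obtain q' where q': "pre_condition (osuc (osuc \<gamma>)) q'" "DSRP_le q' r"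
          "{x} \<subseteq> elts (the (fst q' (osuc \<gamma>)))"
          using extend_successor[OF r(1), of "{x}"] x by auto
        have dom: "dom (fst q') = elts (osuc (osuc \<gamma>))" using q' by (simp add: pre_condition_def)
        have "x \<in> covered q'" using q'(3) dom mem_osuc by (auto simp: covered_def)
        moreover have "x \<in> elts \<alpha> \<longrightarrow> x \<in> dom (fst q')" using g(3) dom by (simp add: elts_osuc)
        moreover have "osuc \<gamma> \<in> elts \<alpha>" using 3 g limit_osuc by blast
        moreover have "DSRP_le q' q" using q' r DSRP_le_trans by blast
        ultimately show ?thesis using q'(1) b(3) DSRP_le_trans unfolding D_def R_def by blast
      qed
      have p'D: "p' \<in> D" using p' da DSRP_le_refl unfolding D_def by blast
      have "meets_closures (H \<kappa>) S1" using stationary_meets_closures stationary S'(3) by blast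
      moreover have supp: "countable (support q \<union> elts \<alpha>) \<and> support q \<union> elts \<alpha> \<subseteq> H \<kappa>" if "q \<in> D" for q
        using support_ctble(1,2)[OF D_DSRP[OF that]] \<omega>1_countable[OF alpha] \<omega>1_mem[OF alpha] \<omega>1_H by auto
      moreover have "support p' \<union> elts \<alpha> \<noteq> {}" using da by blast
      ultimately obtain M f where M: "M \<in> S1" and f: "f (0::nat) = p'" "\<And>n. f n \<in> D"
          "\<And>n. support (f n) \<union> elts \<alpha> \<subseteq> elts M" "\<And>n. \<exists>x\<in>elts M. R (f n) x (f (Suc n))"
          "\<And>x. x \<in> elts M \<Longrightarrow> \<exists>n. R (f n) x (f (Suc n))"
        using generic_sequence[of "H \<kappa>" S1 p' D "\<lambda>q. support q \<union> elts \<alpha>" R] p'D step by blast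
      have fle: "DSRP_le (f (Suc n)) (f n)" for n using f(4)[of n] by (auto simp: R_def)
      have dom: "(\<Union>n. dom (fst (f n))) = elts \<alpha>"
      proof (intro equalityI subsetI)
        fix x assume "x \<in> (\<Union>n. dom (fst (f n)))"
        then obtain n where n: "x \<in> dom (fst (f n))" by blast
        obtain \<beta> where b: "\<beta> \<in> elts \<alpha>" "pre_condition (osuc \<beta>) (f n)" using f(2)[of n] by (auto simp: D_def)
        then have "dom (fst (f n)) = elts (osuc \<beta>)" by (simp add: pre_condition_def)
        then have "x \<in> elts (osuc \<beta>)" using n by simp
        then show "x \<in> elts \<alpha>" using b(1) \<omega>1_trans[OF alpha] by (auto simp: elts_osuc)
      next
        fix x assume x: "x \<in> elts \<alpha>"
        then obtain n where "R (f n) x (f (Suc n))" using f(3,5) by blast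
        then show "x \<in> (\<Union>n. dom (fst (f n)))" using x unfolding R_def by blast
      qed
      have Mcov: "elts M = (\<Union>n. covered (f n))"
      proof (intro equalityI subsetI)
        fix x assume "x \<in> elts M"
        then obtain n where "R (f n) x (f (Suc n))" using f(5) by blast
        then show "x \<in> (\<Union>n. covered (f n))" unfolding R_def by blast
      next
        fix x assume "x \<in> (\<Union>n. covered (f n))"
        then show "x \<in> elts M" using f(3) unfolding support_def by blast
      qed
      have T: "(\<exists>n. i \<in> dom (snd (f n)) \<and> M \<in> the (snd (f n) i)) \<or>
          ((\<forall>n. i \<notin> dom (snd (f n))) \<and> M \<in> \<Union>\<S>)" if "i \<in> \<omega>1" "\<alpha> \<in> T i" for i
      proof -
        have "snd (f 0) i = Some S1" using S'(4)[OF that] f(1) by (simp add: p'_def)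
        then show ?thesis using M by (intro disjI1 exI[of _ 0]) auto
      qed
      obtain q where "pre_condition (osuc \<alpha>) q" "\<And>n. DSRP_le q (f n)"
        using limit_condition[OF D_DSRP[OF f(2)] fle dom alpha 3 Mcov T] by blast
      then show ?thesis using f(1) p'(2) DSRP_le_trans by metis
    qed
  qed
qed

end

context dsrp
begin

section \<open>Projective stationarity implies preservation\<close>

lemma pre_condition_dom: "pre_condition \<xi> p \<Longrightarrow> dom (fst p) = elts \<xi>"
  by (simp add: pre_condition_def)

lemma DSRP_dom_\<omega>1:
  assumes "p \<in> DSRP \<kappa> \<S> T"
  shows "dom (fst p) \<subseteq> \<omega>1" "dom (snd p) \<subseteq> \<omega>1"
proof -
  obtain \<delta> where d: "pre_condition (osuc \<delta>) p" using assms DSRP_iff by blast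
  then have "osuc \<delta> \<in> \<omega>1" by (simp add: pre_condition_def)
  then show "dom (fst p) \<subseteq> \<omega>1" using \<omega>1_mem pre_condition_dom[OF d] by auto
  obtain l where "l \<in> \<omega>1" "dom (snd p) = elts l" using d by (auto simp: pre_condition_def S_sequence_def)
  then show "dom (snd p) \<subseteq> \<omega>1" using \<omega>1_mem by auto
qed

lemma DSRP_dom_trans:
  assumes "p \<in> DSRP \<kappa> \<S> T" "\<alpha> \<in> dom (fst p)"
  shows "elts \<alpha> \<subseteq> dom (fst p)"
proof -
  obtain \<delta> where d: "pre_condition (osuc \<delta>) p" using assms DSRP_iff by blast
  then have "osuc \<delta> \<in> \<omega>1" by (simp add: pre_condition_def)
  then show ?thesis using assms(2) \<omega>1_trans[of "osuc \<delta>" \<alpha>] pre_condition_dom[OF d] by auto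
qed

lemma extend_beyond:
  assumes p: "p \<in> DSRP \<kappa> \<S> T" and A: "countable A" "A \<subseteq> \<omega>1"
  obtains \<zeta> q where "pre_condition (osuc \<zeta>) q" "DSRP_le q p" "A \<subseteq> elts \<zeta>" "dom (fst p) \<subseteq> elts \<zeta>"
proof -
  obtain \<delta> where d: "\<delta> \<in> \<omega>1" "pre_condition (osuc \<delta>) p" using p DSRP_iff by blast
  have "countable (A \<union> elts (osuc \<delta>))" "A \<union> elts (osuc \<delta>) \<subseteq> \<omega>1"
    using A \<omega>1_countable[OF osuc_\<omega>1[OF d(1)]] \<omega>1_mem[OF osuc_\<omega>1[OF d(1)]] by auto
  then obtain \<zeta> where z: "\<zeta> \<in> \<omega>1" "A \<union> elts (osuc \<delta>) \<subseteq> elts \<zeta>" using countable_bounded by metis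
  then have "\<delta> \<in> elts (osuc \<zeta>)" using mem_osuc[of \<delta>] by (auto simp: elts_osuc)
  then obtain q where "pre_condition (osuc \<zeta>) q" "DSRP_le q p" using extend_length[OF d(2) z(1)] by blast
  then show ?thesis using that z pre_condition_dom[OF d(2)] by simp
qed

lemma extend_beyond_ordinal:
  assumes p: "p \<in> DSRP \<kappa> \<S> T" and \<alpha>: "\<alpha> \<in> \<omega>1"
  obtains \<zeta> q where "pre_condition (osuc \<zeta>) q" "DSRP_le q p" "\<alpha> \<in> elts \<zeta>"
proof -
  have "countable {\<alpha>}" "{\<alpha>} \<subseteq> \<omega>1" using \<alpha> by auto
  then show thesis by (rule extend_beyond[OF p], intro that) (assumption | blast)+
qed

lemma projective_stationary_onD:
  "projective_stationary_on \<kappa> S A \<Longrightarrow> B \<subseteq> A \<Longrightarrow> stationary_in \<omega>1 B \<Longrightarrow>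
    stationary_ctble (H \<kappa>) {M\<in>S. vset (elts M \<inter> \<omega>1) \<in> B}"
  by (simp add: projective_stationary_on_def)

text \<open>
  The sets \<open>M \<in> \<T>\<close> are those that may serve as top at position \<open>\<delta> = M \<inter> \<omega>1 \<in> B\<close> of a
  condition below \<open>p'\<close>. The two alternatives at the end match those of \<open>limit_condition\<close>: the set \<open>S\<^sub>i\<close>
  has been decided by \<open>p'\<close> already, or \<open>i \<ge> \<delta>\<close> and \<open>S\<^sub>i\<close> will not be decided below \<open>\<delta>\<close>.
\<close>

lemma projective_targets:
  assumes proj: "projective_stationary_on_seq \<kappa> \<S> T" and B: "stationary_in \<omega>1 B" and p: "p \<in> DSRP \<kappa> \<S> T"
  obtains p' \<T> where "p' \<in> DSRP \<kappa> \<S> T" "DSRP_le p' p" "meets_closures (H \<kappa>) \<T>"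
    "\<And>M. M \<in> \<T> \<Longrightarrow> vset (elts M \<inter> \<omega>1) \<in> B"
    "\<And>M i. M \<in> \<T> \<Longrightarrow> i \<in> \<omega>1 \<Longrightarrow> vset (elts M \<inter> \<omega>1) \<in> T i \<Longrightarrow>
      (i \<in> dom (snd p') \<and> M \<in> the (snd p' i)) \<or> (i \<notin> elts (vset (elts M \<inter> \<omega>1)) \<and> M \<in> \<Union>\<S>)"
proof -
  let ?U = "{\<alpha> \<in> (\<Union>i\<in>\<omega>1. T i). \<forall>\<beta>\<in>elts \<alpha>. \<alpha> \<notin> T \<beta>}"
  consider (outside) "stationary_in \<omega>1 (B - (\<Union>i\<in>\<omega>1. T i))" | (late) "stationary_in \<omega>1 (B \<inter> ?U)"
    | (early) \<beta> where "\<beta> \<in> \<omega>1" "stationary_in \<omega>1 (B \<inter> T \<beta>)"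
    using stationary_split[OF B, of T] by blast
  then show ?thesis
  proof cases
    case outside
    show ?thesis
    proof (rule that[OF p DSRP_le_refl stationary_lift[OF outside \<omega>1_H]])
      fix M i assume "M \<in> {M \<in> ctble_subsets (H \<kappa>). vset (elts M \<inter> \<omega>1) \<in> B - (\<Union>i\<in>\<omega>1. T i)}"
        "i \<in> \<omega>1" "vset (elts M \<inter> \<omega>1) \<in> T i"
      then have False by blast
      then show "(i \<in> dom (snd p) \<and> M \<in> the (snd p i)) \<or> (i \<notin> elts (vset (elts M \<inter> \<omega>1)) \<and> M \<in> \<Union>\<S>)" ..
    qed simp
  next
    case late
    have "projective_stationary_on \<kappa> (\<Union>\<S>) ?U"
      using proj unfolding projective_stationary_on_seq_def by blast
    note m = stationary_meets_closures[OF projective_stationary_onD[OF this Int_lower2 late]]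
    show ?thesis by (rule that[OF p DSRP_le_refl m]) auto
  next
    case (early \<beta>)
    obtain \<delta> where d: "\<delta> \<in> \<omega>1" "pre_condition (osuc \<delta>) p" using p DSRP_iff by blast
    obtain Q S where QS: "p = (Q, S)" by fastforce
    have S: "S_sequence S" using d(2) by (simp add: QS pre_condition_def)
    obtain S0 where S0: "S0 \<in> \<S>" using nonempty by blast
    obtain S' where S': "S_sequence S'" "S \<subseteq>\<^sub>m S'" "\<beta> \<in> dom S'"
      "\<And>j. j \<in> dom S' \<Longrightarrow> j \<notin> dom S \<Longrightarrow> S' j = Some S0"
      using S_extend[OF S early(1) S0] by blast
    then obtain S1 where S1: "S' \<beta> = Some S1" by blast
    then have "S1 \<in> \<S>" using S'(1) ranI[where m = S', OF S1] unfolding S_sequence_def by blast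
    then have "projective_stationary_on \<kappa> S1 (T \<beta>)"
      using proj early(1) unfolding projective_stationary_on_seq_def by blast
    note st = projective_stationary_onD[OF this Int_lower2 early(2)]
    show ?thesis
    proof (rule that[OF _ _ stationary_meets_closures[OF st]])
      show "(Q, S') \<in> DSRP \<kappa> \<S> T" using DSRP_I[OF extend_snd[OF d(2)[unfolded QS] S'(2,1)]] .
      show "DSRP_le (Q, S') p" using S'(2) by (simp add: DSRP_le_def QS)
      fix M i assume M: "M \<in> {M\<in>S1. vset (elts M \<inter> \<omega>1) \<in> B \<inter> T \<beta>}"
      assume i: "i \<in> \<omega>1" "vset (elts M \<inter> \<omega>1) \<in> T i"
      have "i = \<beta>" using T_unique[OF i(1) early(1) i(2)] M by blast
      then show "(i \<in> dom (snd (Q, S')) \<and> M \<in> the (snd (Q, S') i)) \<or>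
          (i \<notin> elts (vset (elts M \<inter> \<omega>1)) \<and> M \<in> \<Union>\<S>)"
        using M S1 by auto
    qed auto
  qed
qed

text \<open>
  Each requirement \<open>x \<in> M\<close> makes the chain cover \<open>x\<close>, and if \<open>x\<close> is a countable ordinal it also decides
  an element of \<open>C\<close> above \<open>x\<close>. Hence the union of the chain is \<open>M\<close>, its length is
  \<open>\<delta> = M \<inter> \<omega>1\<close>, and \<open>\<delta>\<close> is a limit of elements of \<open>C\<close>.
\<close>

lemma projective_forces_meeting:
  fixes C :: "('k, 'k dsrp_cond) vname"
  assumes proj: "projective_stationary_on_seq \<kappa> \<S> T" and B: "stationary_in \<omega>1 B" and q: "q \<in> DSRP \<kappa> \<S> T"
    and C: "forces_club_in (DSRP \<kappa> \<S> T) DSRP_le (check_set (DSRP \<kappa> \<S> T) \<omega>1) C q"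
  shows "\<exists>r\<in>DSRP \<kappa> \<S> T. DSRP_le r q \<and> (\<exists>\<gamma>\<in>B. Fmem (check (DSRP \<kappa> \<S> T) \<gamma>) C r)"
proof -
  let ?P = "DSRP \<kappa> \<S> T"
  obtain p' \<T> where p': "p' \<in> ?P" "DSRP_le p' q" and \<T>: "meets_closures (H \<kappa>) \<T>"
    "\<And>M. M \<in> \<T> \<Longrightarrow> vset (elts M \<inter> \<omega>1) \<in> B"
    "\<And>M i. M \<in> \<T> \<Longrightarrow> i \<in> \<omega>1 \<Longrightarrow> vset (elts M \<inter> \<omega>1) \<in> T i \<Longrightarrow>
      (i \<in> dom (snd p') \<and> M \<in> the (snd p' i)) \<or> (i \<notin> elts (vset (elts M \<inter> \<omega>1)) \<and> M \<in> \<Union>\<S>)"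
    using projective_targets[OF proj B q] by blast
  define D where "D = {r \<in> ?P. DSRP_le r p'}"
  define R where "R r x r' \<longleftrightarrow> DSRP_le r' r \<and> x \<in> covered r' \<and> (x \<in> \<omega>1 \<longrightarrow> x \<in> dom (fst r') \<and>
    (\<exists>\<gamma>\<in>dom (fst r'). x \<in> elts \<gamma> \<and> Fmem (check ?P \<gamma>) C r'))" for r x r'
  have step: "\<exists>r'\<in>D. R r x r'" if r: "r \<in> D" and x: "x \<in> H \<kappa>" for r x
  proof -
    have rP: "r \<in> ?P" "DSRP_le r p'" using r by (auto simp: D_def)
    \<comment> \<open>A countable ordinal \<open>x\<close> also demands that some element of \<open>C\<close> above \<open>x\<close> be decided; the length
      is then made larger than that element, so that it belongs to the support.\<close>
    have "\<exists>r1\<in>?P. DSRP_le r1 r \<and> (x \<in> \<omega>1 \<longrightarrow> (\<exists>\<gamma>\<in>\<omega>1. x \<in> elts \<gamma> \<and> Fmem (check ?P \<gamma>) C r1))"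
    proof (cases "x \<in> \<omega>1")
      case True
      then show ?thesis
        using forces_club_unbounded[OF C rP(1) DSRP_le_trans[OF rP(2) p'(2)] True] by blast
    next
      case False
      then show ?thesis using rP(1) DSRP_le_refl by blast
    qed
    then obtain r1 where r1: "r1 \<in> ?P" "DSRP_le r1 r" and
      g0: "x \<in> \<omega>1 \<longrightarrow> (\<exists>\<gamma>\<in>\<omega>1. x \<in> elts \<gamma> \<and> Fmem (check ?P \<gamma>) C r1)" by blast
    obtain \<gamma> where g: "\<gamma> \<in> \<omega>1" "x \<in> \<omega>1 \<Longrightarrow> x \<in> elts \<gamma> \<and> Fmem (check ?P \<gamma>) C r1"
    proof (cases "x \<in> \<omega>1")
      case True
      then show ?thesis using g0 that by blast
    next
      case False
      obtain \<delta> :: "'k V" where "\<delta> \<in> \<omega>1" using r1(1) unfolding DSRP_iff by blast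
      then show ?thesis using that False by blast
    qed
    obtain \<zeta> r2 where r2: "pre_condition (osuc \<zeta>) r2" "DSRP_le r2 r1" "\<gamma> \<in> elts \<zeta>"
      using extend_beyond_ordinal[OF r1(1) g(1)] .
    obtain r3 where r3: "pre_condition (osuc (osuc \<zeta>)) r3" "DSRP_le r3 r2" "{x} \<subseteq> elts (the (fst r3 (osuc \<zeta>)))"
      using extend_successor[OF r2(1), of "{x}"] x by auto
    have P3: "r3 \<in> ?P" using DSRP_I[OF r3(1)] .
    have le31: "DSRP_le r3 r1" using DSRP_le_trans[OF r3(2) r2(2)] .
    have le3: "DSRP_le r3 r" using DSRP_le_trans[OF le31 r1(2)] .
    have dom: "dom (fst r3) = elts (osuc (osuc \<zeta>))" using pre_condition_dom[OF r3(1)] .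
    then have gd: "\<gamma> \<in> dom (fst r3)" using r2(3) by (simp add: elts_osuc)
    have "x \<in> covered r3" using r3(3) mem_osuc[of "osuc \<zeta>"] unfolding covered_def dom by blast
    moreover have "x \<in> dom (fst r3) \<and> (\<exists>\<gamma>\<in>dom (fst r3). x \<in> elts \<gamma> \<and> Fmem (check ?P \<gamma>) C r3)"
      if "x \<in> \<omega>1"
      using g(2)[OF that] gd DSRP_dom_trans[OF P3 gd] Fmem_mono[OF _ le31] by blast
    ultimately have "R r x r3" using le3 by (simp add: R_def)
    moreover have "r3 \<in> D" using P3 DSRP_le_trans[OF le3 rP(2)] by (simp add: D_def)
    ultimately show ?thesis by blast
  qed
  have DP: "r \<in> ?P" if "r \<in> D" for r using that by (simp add: D_def)
  have p'D: "p' \<in> D" using p' DSRP_le_refl by (simp add: D_def)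
  have supp: "countable (support r) \<and> support r \<subseteq> H \<kappa>" if "r \<in> D" for r
    using support_ctble(1,2)[OF DP[OF that]] by blast
  obtain M f where M: "M \<in> \<T>" and f: "f (0::nat) = p'" "\<And>n. f n \<in> D"
      "\<And>n. support (f n) \<subseteq> elts M" "\<And>n. \<exists>x\<in>elts M. R (f n) x (f (Suc n))"
      "\<And>x. x \<in> elts M \<Longrightarrow> \<exists>n. R (f n) x (f (Suc n))"
    using generic_sequence[where supp = support and R = R, OF \<T>(1) p'D supp support_ctble(3)[OF p'(1)] step]
    by blast
  define \<delta> where "\<delta> = vset (elts M \<inter> \<omega>1)"
  have dB: "\<delta> \<in> B" unfolding \<delta>_def using \<T>(2)[OF M] .
  then have d1: "\<delta> \<in> \<omega>1" using stationary_subset[OF B] by blast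
  have "M \<in> ctble_subsets (H \<kappa>)" using \<T>(1) M unfolding meets_closures_def by blast
  then have ed: "elts \<delta> = elts M \<inter> \<omega>1"
    unfolding \<delta>_def by (intro elts_vset_countable) (auto simp: ctble_subsets_def)
  have fP: "f n \<in> ?P" for n using DP f(2) .
  have fle: "DSRP_le (f (Suc n)) (f n)" for n using f(4)[of n] unfolding R_def by blast
  have dom_sub: "dom (fst (f n)) \<subseteq> elts \<delta>" "dom (snd (f n)) \<subseteq> elts \<delta>" for n
    using f(3)[of n] DSRP_dom_\<omega>1[OF fP[of n]] unfolding ed support_def by auto
  have meet: "\<exists>n. x \<in> dom (fst (f n)) \<and> (\<exists>\<gamma>\<in>dom (fst (f n)). x \<in> elts \<gamma> \<and> Fmem (check ?P \<gamma>) C (f n))"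
    if "x \<in> elts \<delta>" for x
  proof -
    obtain n where "R (f n) x (f (Suc n))" using f(5) \<open>x \<in> elts \<delta>\<close> unfolding ed by blast
    then show ?thesis using \<open>x \<in> elts \<delta>\<close> unfolding R_def ed by blast
  qed
  have dom: "(\<Union>n. dom (fst (f n))) = elts \<delta>" using dom_sub(1) meet by blast
  have lim: "limit \<delta>"
  proof (rule limitI[OF d1])
    obtain \<eta> where "pre_condition (osuc \<eta>) (f 0)" using fP DSRP_iff by blast
    then have "\<eta> \<in> dom (fst (f 0))" using pre_condition_dom mem_osuc by blast
    then show "elts \<delta> \<noteq> {}" using dom_sub(1) by blast
    show "\<exists>\<gamma>. \<gamma> \<in> elts \<delta> \<and> \<beta> \<in> elts \<gamma>" if "\<beta> \<in> elts \<delta>" for \<beta>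
      using meet[OF that] dom_sub(1) by blast
  qed
  have cov: "elts M = (\<Union>n. covered (f n))"
  proof (intro equalityI subsetI)
    fix x assume "x \<in> elts M"
    then obtain n where "R (f n) x (f (Suc n))" using f(5) by blast
    then show "x \<in> (\<Union>n. covered (f n))" unfolding R_def by blast
  next
    fix x assume "x \<in> (\<Union>n. covered (f n))"
    then show "x \<in> elts M" using f(3) unfolding support_def by blast
  qed
  have T: "(\<exists>n. i \<in> dom (snd (f n)) \<and> M \<in> the (snd (f n) i)) \<or>
      ((\<forall>n. i \<notin> dom (snd (f n))) \<and> M \<in> \<Union>\<S>)" if "i \<in> \<omega>1" "\<delta> \<in> T i" for i
    using \<T>(3)[OF M that(1) that(2)[unfolded \<delta>_def], folded \<delta>_def]
  proof
    assume "i \<in> dom (snd p') \<and> M \<in> the (snd p' i)"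
    then show ?thesis using f(1) by blast
  next
    assume "i \<notin> elts \<delta> \<and> M \<in> \<Union>\<S>"
    then show ?thesis using dom_sub(2) by blast
  qed
  obtain r where r: "pre_condition (osuc \<delta>) r" "\<And>n. DSRP_le r (f n)"
    using limit_condition[OF fP fle dom d1 lim cov T] by blast
  have rP: "r \<in> ?P" using DSRP_I[OF r(1)] .
  have rq: "DSRP_le r q" using DSRP_le_trans[OF r(2)[of 0] ] f(1) p'(2) by simp
  have "\<exists>\<gamma>\<in>elts \<delta>. \<beta> \<in> elts \<gamma> \<and> Fmem (check ?P \<gamma>) C r" if b: "\<beta> \<in> elts \<delta>" for \<beta>
    using meet[OF b] Fmem_mono[OF _ r(2)] dom_sub(1) by blast
  then obtain s where "s \<in> ?P" "DSRP_le s r" "Fmem (check ?P \<delta>) C s"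
    using forces_club_closed[OF C rP rq d1 limit_elts_nonempty[OF lim]] by blast
  then show ?thesis using dB DSRP_le_trans rq by blast
qed

lemma projective_stationary_imp_SSP:
  assumes "projective_stationary_on_seq \<kappa> \<S> T"
  shows "SSP_projective_stationary \<kappa> \<S> T"
  unfolding SSP_projective_stationary_def preserves_stationary_subsets_def
proof (intro allI impI ballI)
  fix B :: "'k V set" and p assume B: "stationary_in \<omega>1 B" and p: "p \<in> DSRP \<kappa> \<S> T"
  show "forces_stationary_in (DSRP \<kappa> \<S> T) DSRP_le
      (check_set (DSRP \<kappa> \<S> T) \<omega>1) (check_set (DSRP \<kappa> \<S> T) B) p"
    by (rule forces_stationaryI[OF stationary_subset[OF B]]) (rule projective_forces_meeting[OF assms B])
qed

section \<open>Preservation implies projective stationarity\<close>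

text \<open>
  The sets \<open>Q\<^sub>\<beta>\<close> need not increase with \<open>\<beta>\<close>, since \<open>Q\<^sub>\<beta> \<in> Q\<^sub>\<gamma>\<close> does not entail \<open>Q\<^sub>\<beta> \<subseteq> Q\<^sub>\<gamma>\<close>. Their initial unions do.
\<close>

definition initial_union :: "('k V \<rightharpoonup> 'k V) \<Rightarrow> 'k V \<Rightarrow> 'k V" where
  "initial_union Q \<gamma> = vset (\<Union>\<beta>\<in>elts (osuc \<gamma>). elts (the (Q \<beta>)))"

text \<open>
  The function \<open>N\<close> is going to map each countable subset of \<open>H\<^sub>\<kappa>\<close> to a superset in the given club. The other
  conjuncts make \<open>Q\<^sub>\<alpha> \<inter> \<omega>1 = \<alpha>\<close> at limits \<open>\<alpha>\<close> of absorbing steps, and the restriction to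
  successors ensures that a limit ordinal is marked only as a limit of marks.
\<close>

definition absorbs :: "('k V \<Rightarrow> 'k V) \<Rightarrow> ('k V \<rightharpoonup> 'k V) \<Rightarrow> 'k V \<Rightarrow> 'k V \<Rightarrow> bool" where
  "absorbs N Q \<gamma> \<xi> \<longleftrightarrow> \<xi> \<in> dom Q \<and> \<gamma> \<in> elts \<xi> \<and> (\<exists>\<eta>. \<xi> = osuc \<eta>) \<and>
     elts (N (initial_union Q \<gamma>)) \<union> elts \<gamma> \<subseteq> elts (the (Q \<xi>)) \<and>
     elts (initial_union Q \<gamma>) \<inter> \<omega>1 \<subseteq> elts \<xi>"

text \<open>
  Proceeding to the least absorbing \<open>\<xi>\<close> is essential. Were all absorbing
  \<open>\<xi>\<close> admitted, a limit of marks could arise from a single \<open>\<gamma>\<close>, and nothing would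
  be known about \<open>Q\<close> there.
\<close>

inductive_set marks :: "('k V \<Rightarrow> 'k V) \<Rightarrow> ('k V \<rightharpoonup> 'k V) \<Rightarrow> 'k V set" for N Q where
  zero: "\<alpha> \<in> dom Q \<Longrightarrow> elts \<alpha> = {} \<Longrightarrow> \<alpha> \<in> marks N Q"
| step: "\<gamma> \<in> marks N Q \<Longrightarrow> absorbs N Q \<gamma> \<xi> \<Longrightarrow> (\<And>\<zeta>. \<zeta> \<in> elts \<xi> \<Longrightarrow> \<not> absorbs N Q \<gamma> \<zeta>) \<Longrightarrow>
    \<xi> \<in> marks N Q"
| limit: "\<alpha> \<in> dom Q \<Longrightarrow> limit \<alpha> \<Longrightarrow>
    (\<And>\<beta>. \<beta> \<in> elts \<alpha> \<Longrightarrow> \<exists>\<gamma>. \<gamma> \<in> marks N Q \<and> \<gamma> \<in> elts \<alpha> \<and> \<beta> \<in> elts \<gamma>) \<Longrightarrow> \<alpha> \<in> marks N Q"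

lemma marks_dom: "\<alpha> \<in> marks N Q \<Longrightarrow> \<alpha> \<in> dom Q"
  by (erule marks.cases) (auto simp: absorbs_def)

lemma elts_initial_union:
  assumes "p \<in> DSRP \<kappa> \<S> T" "\<gamma> \<in> dom (fst p)"
  shows "elts (initial_union (fst p) \<gamma>) = (\<Union>\<beta>\<in>elts (osuc \<gamma>). elts (the (fst p \<beta>)))"
    "initial_union (fst p) \<gamma> \<in> ctble_subsets (H \<kappa>)"
proof -
  obtain \<delta> where d: "pre_condition (osuc \<delta>) p" using assms(1) DSRP_iff by blast
  have g: "\<gamma> \<in> \<omega>1" using DSRP_dom_\<omega>1(1)[OF assms(1)] assms(2) by blast
  have "elts (osuc \<gamma>) \<subseteq> dom (fst p)" using DSRP_dom_trans[OF assms] assms(2) by (simp add: elts_osuc)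
  then have "the (fst p \<beta>) \<in> ctble_subsets (H \<kappa>)" if "\<beta> \<in> elts (osuc \<gamma>)" for \<beta>
    using pre_condition_ctble[OF d] pre_condition_dom[OF d] that by blast
  then have Q: "countable (elts (the (fst p \<beta>)))" "elts (the (fst p \<beta>)) \<subseteq> H \<kappa>" if "\<beta> \<in> elts (osuc \<gamma>)" for \<beta>
    using that unfolding ctble_subsets_def by blast+
  have c: "countable (\<Union>\<beta>\<in>elts (osuc \<gamma>). elts (the (fst p \<beta>)))"
    using Q(1) \<omega>1_countable[OF osuc_\<omega>1[OF g]] by (intro countable_UN) auto
  show eq: "elts (initial_union (fst p) \<gamma>) = (\<Union>\<beta>\<in>elts (osuc \<gamma>). elts (the (fst p \<beta>)))"
    unfolding initial_union_def by (rule elts_vset_countable[OF c])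
  show "initial_union (fst p) \<gamma> \<in> ctble_subsets (H \<kappa>)"
    unfolding ctble_subsets_def mem_Collect_eq eq using c Q(2) by (simp add: UN_least)
qed

lemma fst_agree: "DSRP_le q p \<Longrightarrow> \<beta> \<in> dom (fst p) \<Longrightarrow> fst q \<beta> = fst p \<beta>"
  by (simp add: DSRP_le_def map_le_def)

lemma dom_mono: "DSRP_le q p \<Longrightarrow> dom (fst p) \<subseteq> dom (fst q)"
  using map_le_implies_dom_le[of "fst p" "fst q"] by (simp add: DSRP_le_def)

lemma initial_union_agree:
  assumes "p \<in> DSRP \<kappa> \<S> T" "DSRP_le q p" "\<gamma> \<in> dom (fst p)"
  shows "initial_union (fst q) \<gamma> = initial_union (fst p) \<gamma>"
proof -
  have "elts (osuc \<gamma>) \<subseteq> dom (fst p)" using DSRP_dom_trans[OF assms(1,3)] assms(3) by (simp add: elts_osuc)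
  then have "fst q \<beta> = fst p \<beta>" if "\<beta> \<in> elts (osuc \<gamma>)" for \<beta> using fst_agree[OF assms(2)] that by blast
  then show ?thesis unfolding initial_union_def by simp
qed

lemma absorbs_agree:
  assumes "p \<in> DSRP \<kappa> \<S> T" "DSRP_le q p" "\<xi> \<in> dom (fst p)"
  shows "absorbs N (fst q) \<gamma> \<xi> \<longleftrightarrow> absorbs N (fst p) \<gamma> \<xi>"
proof (cases "\<gamma> \<in> elts \<xi>")
  case True
  then have "\<gamma> \<in> dom (fst p)" using DSRP_dom_trans[OF assms(1,3)] by blast
  then have "initial_union (fst q) \<gamma> = initial_union (fst p) \<gamma>" by (rule initial_union_agree[OF assms(1,2)])
  moreover have "fst q \<xi> = fst p \<xi>" using fst_agree[OF assms(2,3)] .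
  moreover have "\<xi> \<in> dom (fst q)" using dom_mono[OF assms(2)] assms(3) by blast
  ultimately show ?thesis using assms(3) unfolding absorbs_def by simp
qed (simp add: absorbs_def)

lemma marks_mono:
  assumes "p \<in> DSRP \<kappa> \<S> T" "DSRP_le q p" "\<alpha> \<in> marks N (fst p)"
  shows "\<alpha> \<in> marks N (fst q)"
  using assms(3)
proof (induction rule: marks.induct)
  case (zero \<alpha>)
  then show ?case using dom_mono[OF assms(2)] marks.zero by blast
next
  case (step \<gamma> \<xi>)
  have xi: "\<xi> \<in> dom (fst p)" using step(2) by (simp add: absorbs_def)
  have "absorbs N (fst q) \<gamma> \<xi>" using absorbs_agree[OF assms(1,2) xi] step(2) by blast
  moreover have "\<not> absorbs N (fst q) \<gamma> \<zeta>" if "\<zeta> \<in> elts \<xi>" for \<zeta>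
    using absorbs_agree[OF assms(1,2)] step(3)[OF that] DSRP_dom_trans[OF assms(1) xi] that by blast
  ultimately show ?case using marks.step[OF step(4)] by blast
next
  case (limit \<alpha>)
  then show ?case using dom_mono[OF assms(2)] by (intro marks.limit) blast+
qed

text \<open>
  Whether \<open>\<alpha>\<close> is marked depends only on the chain up to \<open>\<alpha>\<close>, so any condition of sufficient length
  decides it.
\<close>

lemma marks_restrict:
  assumes "p \<in> DSRP \<kappa> \<S> T" "DSRP_le q p" "\<alpha> \<in> marks N (fst q)" "\<alpha> \<in> dom (fst p)"
  shows "\<alpha> \<in> marks N (fst p)"
  using assms(3,4)
proof (induction rule: marks.induct)
  case (zero \<alpha>)
  then show ?case using marks.zero by blast
next
  case (step \<gamma> \<xi>)
  note xi = \<open>\<xi> \<in> dom (fst p)\<close>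
  have "\<gamma> \<in> elts \<xi>" using step by (simp add: absorbs_def)
  then have "\<gamma> \<in> dom (fst p)" using DSRP_dom_trans[OF assms(1) xi] by blast
  moreover have "absorbs N (fst p) \<gamma> \<xi>" using absorbs_agree[OF assms(1,2) xi] step by blast
  moreover have "\<not> absorbs N (fst p) \<gamma> \<zeta>" if "\<zeta> \<in> elts \<xi>" for \<zeta>
    using absorbs_agree[OF assms(1,2)] step(3)[OF that] DSRP_dom_trans[OF assms(1) xi] that by blast
  ultimately show ?case using marks.step[of \<gamma>] step by blast
next
  case (limit \<alpha>)
  have "elts \<alpha> \<subseteq> dom (fst p)" using DSRP_dom_trans[OF assms(1)] limit by blast
  then show ?case using limit by (intro marks.limit) blast+
qed

text \<open>
  Marks do not skip: the next mark after \<open>\<gamma>\<close> comes no later than any given larger mark \<open>\<gamma>'\<close>. If \<open>\<gamma>'\<close> was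
  reached from a mark \<open>\<gamma>''\<close> below \<open>\<gamma>\<close>, the statement for \<open>\<gamma>''\<close> and \<open>\<gamma>\<close> contradicts the minimality of \<open>\<gamma>'\<close>.
\<close>

lemma marks_next_below:
  assumes p: "p \<in> DSRP \<kappa> \<S> T"
    and "\<gamma>' \<in> marks N (fst p)" "\<gamma> \<in> marks N (fst p)" "\<gamma> \<in> elts \<gamma>'"
  shows "\<exists>\<xi>. absorbs N (fst p) \<gamma> \<xi> \<and> (\<xi> = \<gamma>' \<or> \<xi> \<in> elts \<gamma>')"
  using assms(2-4)
proof (induction \<gamma>' arbitrary: \<gamma> rule: mem_induct)
  case (1 \<gamma>')
  note IH = 1(1) and g = 1(3,4)
  have in1: "\<beta> \<in> \<omega>1" if "\<beta> \<in> marks N (fst p)" for \<beta>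
    using marks_dom[OF that] DSRP_dom_\<omega>1(1)[OF p] by blast
  have tr: "\<beta> \<in> elts \<gamma>'" if "\<beta> \<in> elts \<eta>" "\<eta> \<in> elts \<gamma>'" for \<beta> \<eta>
    using \<omega>1_trans[OF in1[OF 1(2)] that(2,1)] .
  from 1(2) show ?case
  proof (cases rule: marks.cases)
    case zero
    then show ?thesis using g by simp
  next
    case (step \<gamma>'')
    have g'': "\<gamma>'' \<in> elts \<gamma>'" using step by (simp add: absorbs_def)
    consider "\<gamma> = \<gamma>''" | "\<gamma> \<in> elts \<gamma>''" | "\<gamma>'' \<in> elts \<gamma>"
      using \<omega>1_linear[OF in1[OF g(1)] in1[OF step(1)]] by blast
    then show ?thesis
    proof cases
      case 1
      then show ?thesis using step by blast
    next
      case 2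
      then show ?thesis using IH[OF g'' step(1) g(1)] g'' tr by blast
    next
      case 3
      then obtain \<xi> where "absorbs N (fst p) \<gamma>'' \<xi>" "\<xi> = \<gamma> \<or> \<xi> \<in> elts \<gamma>"
        using IH[OF g(2) g(1) step(1)] by blast
      then have False using step(3)[of \<xi>] g(2) tr by blast
      then show ?thesis ..
    qed
  next
    case limit
    then obtain \<gamma>1 where "\<gamma>1 \<in> marks N (fst p)" "\<gamma>1 \<in> elts \<gamma>'" "\<gamma> \<in> elts \<gamma>1" using g by blast
    then show ?thesis using IH[of \<gamma>1 \<gamma>] g tr by blast
  qed
qed

text \<open>
  Below \<open>\<alpha>\<close> there are cofinally many pairs \<open>\<gamma> < \<xi>\<close> such that \<open>\<xi>\<close> absorbs \<open>\<gamma>\<close>. As \<open>\<alpha>\<close> is countable,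
  \<open>\<omega>\<close> many of these pairs interleave members of \<open>C\<close> with the chain, and \<open>Q\<^sub>\<alpha>\<close> is the union of
  these members of \<open>C\<close>.
\<close>

lemma marks_limit_good:
  assumes p: "p \<in> DSRP \<kappa> \<S> T" and C: "club_ctble (H \<kappa>) C"
    and N: "\<And>M. M \<in> ctble_subsets (H \<kappa>) \<Longrightarrow> N M \<in> C \<and> elts M \<subseteq> elts (N M)"
    and a: "\<alpha> \<in> marks N (fst p)" "limit \<alpha>"
  shows "the (fst p \<alpha>) \<in> C" "elts (the (fst p \<alpha>)) \<inter> \<omega>1 = elts \<alpha>"
proof -
  let ?Q = "fst p"
  have ad: "\<alpha> \<in> dom ?Q" using marks_dom[OF a(1)] .
  have a1: "\<alpha> \<in> \<omega>1" using DSRP_dom_\<omega>1(1)[OF p] ad by blast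
  have sub: "elts \<alpha> \<subseteq> dom ?Q" using DSRP_dom_trans[OF p ad] .
  have cof: "\<exists>\<gamma>. \<gamma> \<in> marks N ?Q \<and> \<gamma> \<in> elts \<alpha> \<and> \<beta> \<in> elts \<gamma>" if "\<beta> \<in> elts \<alpha>" for \<beta>
    using a(1)
  proof (cases rule: marks.cases)
    case zero
    then show ?thesis using that by simp
  next
    case (step \<gamma>)
    then show ?thesis using a(2) not_limit_osuc by (auto simp: absorbs_def)
  next
    case limit
    then show ?thesis using that by blast
  qed
  have ex: "\<exists>\<gamma> \<xi>. \<gamma> \<in> elts \<alpha> \<and> \<xi> \<in> elts \<alpha> \<and> \<beta> \<in> elts \<gamma> \<and> absorbs N ?Q \<gamma> \<xi>" if b: "\<beta> \<in> elts \<alpha>" for \<beta>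
  proof -
    obtain \<gamma> where g: "\<gamma> \<in> marks N ?Q" "\<gamma> \<in> elts \<alpha>" "\<beta> \<in> elts \<gamma>" using cof[OF b] by blast
    obtain \<gamma>' where g': "\<gamma>' \<in> marks N ?Q" "\<gamma>' \<in> elts \<alpha>" "\<gamma> \<in> elts \<gamma>'" using cof[OF g(2)] by blast
    obtain \<xi> where "absorbs N ?Q \<gamma> \<xi>" "\<xi> = \<gamma>' \<or> \<xi> \<in> elts \<gamma>'" using marks_next_below[OF p g'(1) g(1) g'(3)] by blast
    moreover have "\<xi> \<in> elts \<alpha>" using calculation(2) g'(2) \<omega>1_trans[OF a1 g'(2)] by blast
    ultimately show ?thesis using g by blast
  qed
  obtain \<delta> where d: "pre_condition (osuc \<delta>) p" using p DSRP_iff by blast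
  have Qa: "elts (the (?Q \<alpha>)) = (\<Union>\<beta>\<in>elts \<alpha>. elts (the (?Q \<beta>)))"
  proof -
    have "\<alpha> \<in> elts (osuc \<delta>)" using ad pre_condition_dom[OF d] by simp
    then show ?thesis using d a(2) by (simp add: pre_condition_def)
  qed
  have iu: "elts (initial_union ?Q \<gamma>) = (\<Union>\<beta>\<in>elts (osuc \<gamma>). elts (the (?Q \<beta>)))"
    "initial_union ?Q \<gamma> \<in> ctble_subsets (H \<kappa>)" if "\<gamma> \<in> elts \<alpha>" for \<gamma>
    using elts_initial_union[OF p subsetD[OF sub that]] .
  have iu_sub: "elts (the (?Q \<beta>)) \<subseteq> elts (initial_union ?Q \<gamma>)" if "\<gamma> \<in> elts \<alpha>" "\<beta> \<in> elts \<gamma>" for \<beta> \<gamma>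
    using iu(1)[OF that(1)] that(2) unfolding elts_osuc by blast
  show "elts (the (?Q \<alpha>)) \<inter> \<omega>1 = elts \<alpha>"
  proof (intro equalityI subsetI)
    fix x assume x: "x \<in> elts (the (?Q \<alpha>)) \<inter> \<omega>1"
    then obtain \<beta> where b: "\<beta> \<in> elts \<alpha>" "x \<in> elts (the (?Q \<beta>))" using Qa by blast
    obtain \<gamma> \<xi> where g: "\<gamma> \<in> elts \<alpha>" "\<xi> \<in> elts \<alpha>" "\<beta> \<in> elts \<gamma>" "absorbs N ?Q \<gamma> \<xi>" using ex[OF b(1)] by blast
    then have "x \<in> elts \<xi>" using iu_sub[OF g(1,3)] b(2) x unfolding absorbs_def by blast
    then show "x \<in> elts \<alpha>" using \<omega>1_trans[OF a1 g(2)] by blast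
  next
    fix \<beta> assume b: "\<beta> \<in> elts \<alpha>"
    obtain \<gamma> \<xi> where g: "\<xi> \<in> elts \<alpha>" "\<beta> \<in> elts \<gamma>" "absorbs N ?Q \<gamma> \<xi>" using ex[OF b] by blast
    then have "\<beta> \<in> elts (the (?Q \<xi>))" unfolding absorbs_def by blast
    then show "\<beta> \<in> elts (the (?Q \<alpha>)) \<inter> \<omega>1" using Qa g(1) \<omega>1_mem[OF a1 b] by blast
  qed
  have "\<forall>\<beta>. \<exists>\<gamma> \<xi>. \<beta> \<in> elts \<alpha> \<longrightarrow> \<gamma> \<in> elts \<alpha> \<and> \<xi> \<in> elts \<alpha> \<and> \<beta> \<in> elts \<gamma> \<and> absorbs N ?Q \<gamma> \<xi>"
    using ex by blast
  then obtain g x where gx: "\<And>\<beta>. \<beta> \<in> elts \<alpha> \<Longrightarrow> g \<beta> \<in> elts \<alpha> \<and> x \<beta> \<in> elts \<alpha> \<and> \<beta> \<in> elts (g \<beta>) \<and> absorbs N ?Q (g \<beta>) (x \<beta>)"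
    by metis
  have "\<forall>\<beta> \<beta>'. \<exists>\<eta>. \<beta> \<in> elts \<alpha> \<and> \<beta>' \<in> elts \<alpha> \<longrightarrow> \<eta> \<in> elts \<alpha> \<and> {\<beta>, \<beta>'} \<subseteq> elts \<eta>"
    using limit_common_bound[OF a(2), of "{_, _}"] by (metis empty_subsetI finite.emptyI finite.insertI insert_subset)
  then obtain m where m: "\<And>\<beta> \<beta>'. \<beta> \<in> elts \<alpha> \<Longrightarrow> \<beta>' \<in> elts \<alpha> \<Longrightarrow> m \<beta> \<beta>' \<in> elts \<alpha> \<and> {\<beta>, \<beta>'} \<subseteq> elts (m \<beta> \<beta>')"
    by metis
  define b where "b = from_nat_into (elts \<alpha>)"
  have b: "range b = elts \<alpha>" unfolding b_def
    using range_from_nat_into[OF limit_elts_nonempty[OF a(2)] \<omega>1_countable[OF a1]] .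
  \<comment> \<open>A cofinal sequence that exceeds every absorbing step taken so far and every \<open>b n\<close>, where \<open>b\<close>
    enumerates the ordinals below \<open>\<alpha>\<close>.\<close>
  define s where "s = rec_nat (b 0) (\<lambda>n \<beta>. m (x \<beta>) (b n))"
  have s_Suc: "s (Suc n) = m (x (s n)) (b n)" for n by (simp add: s_def)
  have s_in: "s n \<in> elts \<alpha>" for n
  proof (induction n)
    case 0
    then show ?case using b by (auto simp: s_def)
  next
    case (Suc n)
    then show ?case using m[of "x (s n)" "b n"] gx[OF Suc] b s_Suc by auto
  qed
  have mem_s: "x (s n) \<in> elts (s (Suc n))" "b n \<in> elts (s (Suc n))" for n
    using m[of "x (s n)" "b n"] gx[OF s_in[of n]] b s_Suc by auto
  have tr: "\<beta> \<in> elts (g (s n))" if "\<beta> \<in> elts (s n)" for \<beta> n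
    using that gx[OF s_in[of n]] \<omega>1_trans[OF \<omega>1_mem[OF a1]] by blast
  define X where "X n = N (initial_union ?Q (g (s n)))" for n
  have g_in: "g (s n) \<in> elts \<alpha>" for n using gx[OF s_in] by blast
  have X: "X n \<in> C" "elts (initial_union ?Q (g (s n))) \<subseteq> elts (X n)" for n
    unfolding X_def using N[OF iu(2)[OF g_in]] by blast+
  have XQ: "elts (X n) \<subseteq> elts (the (?Q (x (s n))))" for n
    using gx[OF s_in[of n]] unfolding X_def absorbs_def by blast
  have mono: "elts (X n) \<subseteq> elts (X (Suc n))" for n
    using XQ[of n] iu_sub[OF g_in tr[OF mem_s(1)], of n] X(2)[of "Suc n"] by blast
  have "(\<Union>n. elts (X n)) = elts (the (?Q \<alpha>))"
  proof (intro equalityI subsetI)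
    fix y assume "y \<in> (\<Union>n. elts (X n))"
    then obtain n where "y \<in> elts (the (?Q (x (s n))))" using XQ by blast
    then show "y \<in> elts (the (?Q \<alpha>))" unfolding Qa using gx[OF s_in] by blast
  next
    fix y assume "y \<in> elts (the (?Q \<alpha>))"
    then obtain \<beta> where "\<beta> \<in> elts \<alpha>" "y \<in> elts (the (?Q \<beta>))" unfolding Qa by blast
    then obtain n where "y \<in> elts (the (?Q (b n)))" using b by (metis imageE)
    then have "y \<in> elts (X (Suc n))" using iu_sub[OF g_in tr[OF mem_s(2)], of n] X(2)[of "Suc n"] by blast
    then show "y \<in> (\<Union>n. elts (X n))" by blast
  qed
  moreover have "vset (\<Union>n. elts (X n)) \<in> C" using C X(1) mono unfolding club_ctble_def by blast
  ultimately show "the (?Q \<alpha>) \<in> C" by (simp add: vset_elts)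
qed

text \<open>
  Suppose that no extension of \<open>p\<close> has a mark above \<open>\<alpha>\<close>. Then a condition of length beyond \<open>\<alpha>\<close> knows all
  marks of all of its extensions. They are closed, so there is a largest one \<open>\<sigma>\<close>. But one can extend the condition by a top that
  absorbs \<open>\<sigma>\<close>, which creates a larger mark. The argument stays in the ground model,
  hence it is valid even if \<open>\<omega>1\<close> is collapsed.
\<close>

lemma marks_unbounded:
  assumes p: "p \<in> DSRP \<kappa> \<S> T" and \<alpha>: "\<alpha> \<in> \<omega>1"
    and N: "\<And>M. M \<in> ctble_subsets (H \<kappa>) \<Longrightarrow> N M \<in> ctble_subsets (H \<kappa>)"
  shows "\<exists>r\<in>DSRP \<kappa> \<S> T. DSRP_le r p \<and> (\<exists>\<gamma>. \<alpha> \<in> elts \<gamma> \<and> \<gamma> \<in> marks N (fst r))"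
proof (rule ccontr)
  assume neg: "\<not> ?thesis"
  obtain \<zeta>0 p1 where p1: "pre_condition (osuc \<zeta>0) p1" "DSRP_le p1 p" "\<alpha> \<in> elts \<zeta>0"
    using extend_beyond_ordinal[OF p \<alpha>] .
  have P1: "p1 \<in> DSRP \<kappa> \<S> T" using DSRP_I[OF p1(1)] .
  have ad: "\<alpha> \<in> dom (fst p1)" using p1(3) pre_condition_dom[OF p1(1)] by (simp add: elts_osuc)
  have bd: "\<gamma> \<in> elts (osuc \<alpha>)" if "r \<in> DSRP \<kappa> \<S> T" "DSRP_le r p1" "\<gamma> \<in> marks N (fst r)" for r \<gamma>
  proof -
    have "\<gamma> \<in> \<omega>1" using marks_dom[OF that(3)] DSRP_dom_\<omega>1(1)[OF that(1)] by blast
    moreover have "\<alpha> \<notin> elts \<gamma>" using neg that DSRP_le_trans[OF that(2) p1(2)] by blast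
    ultimately show ?thesis using \<omega>1_linear[OF \<alpha>, of \<gamma>] by (auto simp: elts_osuc)
  qed
  let ?X = "marks N (fst p1)"
  have X1: "\<gamma> \<in> \<omega>1" if "\<gamma> \<in> ?X" for \<gamma> using marks_dom[OF that] DSRP_dom_\<omega>1(1)[OF P1] by blast
  have "\<alpha> \<in> {\<sigma> \<in> elts (osuc \<alpha>). \<forall>\<gamma>\<in>?X. \<gamma> \<in> elts (osuc \<sigma>)}" using bd[OF P1 DSRP_le_refl] mem_osuc by blast
  then obtain \<sigma> where s: "\<sigma> \<in> elts (osuc \<alpha>)" "\<And>\<gamma>. \<gamma> \<in> ?X \<Longrightarrow> \<gamma> \<in> elts (osuc \<sigma>)"
    and least: "\<And>\<beta>. \<beta> \<in> elts \<sigma> \<Longrightarrow> \<beta> \<notin> {\<sigma> \<in> elts (osuc \<alpha>). \<forall>\<gamma>\<in>?X. \<gamma> \<in> elts (osuc \<sigma>)}"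
    by (rule mem_minimal) blast
  have s1: "\<sigma> \<in> \<omega>1" using \<omega>1_mem[OF osuc_\<omega>1[OF \<alpha>] s(1)] .
  have sd: "\<sigma> \<in> dom (fst p1)" using s(1) DSRP_dom_trans[OF P1 ad] ad by (auto simp: elts_osuc)
  \<comment> \<open>The least upper bound of the marks is a mark: otherwise it is a limit of marks.\<close>
  have "\<sigma> \<in> ?X"
  proof (rule ccontr)
    assume sX: "\<sigma> \<notin> ?X"
    have below: "\<gamma> \<in> elts \<sigma>" if "\<gamma> \<in> ?X" for \<gamma> using s(2)[OF that] that sX by (auto simp: elts_osuc)
    obtain z where z: "z \<in> dom (fst p1)" "\<And>y. y \<in> elts z \<Longrightarrow> y \<notin> dom (fst p1)"
      using mem_minimal[OF ad] by blast
    then have "elts z = {}" using DSRP_dom_trans[OF P1 z(1)] by blast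
    then have "z \<in> ?X" using marks.zero z(1) by blast
    then have ne: "elts \<sigma> \<noteq> {}" using below by blast
    have cof: "\<exists>\<gamma>. \<gamma> \<in> ?X \<and> \<gamma> \<in> elts \<sigma> \<and> \<beta> \<in> elts \<gamma>" if b: "\<beta> \<in> elts \<sigma>" for \<beta>
    proof -
      have "\<beta> \<in> elts (osuc \<alpha>)" using \<omega>1_trans[OF osuc_\<omega>1[OF \<alpha>] s(1) b] .
      then obtain \<gamma> where g: "\<gamma> \<in> ?X" "\<gamma> \<notin> elts (osuc \<beta>)" using least[OF b] by blast
      then have "\<beta> \<in> elts \<gamma>" using \<omega>1_linear[OF \<omega>1_mem[OF s1 b] X1[OF g(1)]] by (auto simp: elts_osuc)
      then show ?thesis using g below by blast
    qed
    then have "limit \<sigma>" using limitI[OF s1 ne] by blast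
    then have "\<sigma> \<in> ?X" using marks.limit[OF sd _ cof] by blast
    then show False using sX by blast
  qed
  let ?h = "initial_union (fst p1) \<sigma>"
  have h: "?h \<in> ctble_subsets (H \<kappa>)" using elts_initial_union(2)[OF P1 sd] .
  have "countable (elts ?h \<inter> \<omega>1)" using h by (auto simp: ctble_subsets_def)
  then obtain \<zeta> r1 where r1: "pre_condition (osuc \<zeta>) r1" "DSRP_le r1 p1" "elts ?h \<inter> \<omega>1 \<subseteq> elts \<zeta>"
    "dom (fst p1) \<subseteq> elts \<zeta>"
    using extend_beyond[OF P1 _ Int_lower2] by blast
  have Nh: "countable (elts (N ?h) \<union> elts \<sigma>)" "elts (N ?h) \<union> elts \<sigma> \<subseteq> H \<kappa>"
    using N[OF h] \<omega>1_countable[OF s1] \<omega>1_mem[OF s1] \<omega>1_H by (auto simp: ctble_subsets_def)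
  obtain r2 where r2: "pre_condition (osuc (osuc \<zeta>)) r2" "DSRP_le r2 r1"
    "elts (N ?h) \<union> elts \<sigma> \<subseteq> elts (the (fst r2 (osuc \<zeta>)))"
    using extend_successor[OF r1(1) Nh] .
  have R2: "r2 \<in> DSRP \<kappa> \<S> T" using DSRP_I[OF r2(1)] .
  have le: "DSRP_le r2 p1" using DSRP_le_trans[OF r2(2) r1(2)] .
  have "absorbs N (fst r2) \<sigma> (osuc \<zeta>)"
    unfolding absorbs_def initial_union_agree[OF P1 le sd]
    using r2(3) r1(3,4) sd pre_condition_dom[OF r2(1)] mem_osuc[of "osuc \<zeta>"]
    by (auto simp: elts_osuc[of \<zeta>])
  then have "osuc \<zeta> \<in> {\<xi>. absorbs N (fst r2) \<sigma> \<xi>}" by simp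
  then obtain \<xi> where xi: "absorbs N (fst r2) \<sigma> \<xi>" "\<And>\<zeta>. \<zeta> \<in> elts \<xi> \<Longrightarrow> \<not> absorbs N (fst r2) \<sigma> \<zeta>"
    by (rule mem_minimal) blast
  have "\<sigma> \<in> marks N (fst r2)" using marks_mono[OF P1 le \<open>\<sigma> \<in> ?X\<close>] .
  then have xm: "\<xi> \<in> marks N (fst r2)" using marks.step xi by blast
  then have "\<xi> \<in> elts (osuc \<alpha>)" using bd[OF R2 le] by blast
  then have "\<xi> \<in> dom (fst p1)" using DSRP_dom_trans[OF P1 ad] ad by (auto simp: elts_osuc)
  then have "\<xi> \<in> elts (osuc \<sigma>)" using s(2) marks_restrict[OF P1 le xm] by blast
  moreover have "\<sigma> \<in> elts \<xi>" using xi(1) by (simp add: absorbs_def)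
  ultimately show False using mem_asym mem_irrefl by (auto simp: elts_osuc)
qed

lemma marks_closed:
  assumes q: "q \<in> DSRP \<kappa> \<S> T" and \<alpha>: "\<alpha> \<in> \<omega>1" "elts \<alpha> \<noteq> {}"
    and lim: "\<And>\<beta> q'. \<beta> \<in> elts \<alpha> \<Longrightarrow> q' \<in> DSRP \<kappa> \<S> T \<Longrightarrow> DSRP_le q' q \<Longrightarrow>
      \<exists>r\<in>DSRP \<kappa> \<S> T. DSRP_le r q' \<and> (\<exists>\<gamma>\<in>elts \<alpha>. \<beta> \<in> elts \<gamma> \<and> \<gamma> \<in> marks N (fst r))"
  shows "\<exists>r\<in>DSRP \<kappa> \<S> T. DSRP_le r q \<and> \<alpha> \<in> marks N (fst r)"
proof -
  obtain \<zeta> r where r: "pre_condition (osuc \<zeta>) r" "DSRP_le r q" "\<alpha> \<in> elts \<zeta>"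
    using extend_beyond_ordinal[OF q \<alpha>(1)] .
  have R: "r \<in> DSRP \<kappa> \<S> T" using DSRP_I[OF r(1)] .
  have ad: "\<alpha> \<in> dom (fst r)" using r(3) pre_condition_dom[OF r(1)] by (simp add: elts_osuc)
  have cof: "\<exists>\<gamma>. \<gamma> \<in> marks N (fst r) \<and> \<gamma> \<in> elts \<alpha> \<and> \<beta> \<in> elts \<gamma>" if b: "\<beta> \<in> elts \<alpha>" for \<beta>
  proof -
    obtain s \<gamma> where s: "DSRP_le s r" "\<gamma> \<in> elts \<alpha>" "\<beta> \<in> elts \<gamma>" "\<gamma> \<in> marks N (fst s)"
      using lim[OF b R r(2)] by blast
    then have "\<gamma> \<in> marks N (fst r)" using marks_restrict[OF R s(1) s(4)] DSRP_dom_trans[OF R ad] by blast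
    then show ?thesis using s by blast
  qed
  then have "limit \<alpha>" using limitI[OF \<alpha>] by blast
  then have "\<alpha> \<in> marks N (fst r)" using marks.limit[OF ad _ cof] by blast
  then show ?thesis using R r(2) by blast
qed

text \<open>
  Passing to the limit ordinals in \<open>B\<close> discards the marks that are not limits of marks.
\<close>

lemma SSP_meets_club:
  assumes SSP: "SSP_projective_stationary \<kappa> \<S> T" and B: "stationary_in \<omega>1 B"
    and C: "club_ctble (H \<kappa>) C" and p: "p \<in> DSRP \<kappa> \<S> T"
  obtains q \<alpha> where "q \<in> DSRP \<kappa> \<S> T" "DSRP_le q p" "\<alpha> \<in> B" "\<alpha> \<in> dom (fst q)"
    "the (fst q \<alpha>) \<in> C" "vset (elts (the (fst q \<alpha>)) \<inter> \<omega>1) = \<alpha>"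
proof -
  have "\<forall>M. \<exists>N. M \<in> ctble_subsets (H \<kappa>) \<longrightarrow> N \<in> C \<and> elts M \<subseteq> elts N"
    using C unfolding club_ctble_def by blast
  then obtain N where N: "\<And>M. M \<in> ctble_subsets (H \<kappa>) \<Longrightarrow> N M \<in> C \<and> elts M \<subseteq> elts (N M)" by metis
  have NH: "N M \<in> ctble_subsets (H \<kappa>)" if "M \<in> ctble_subsets (H \<kappa>)" for M
    using N[OF that] C unfolding club_ctble_def by blast
  have st: "forces_stationary_in (DSRP \<kappa> \<S> T) DSRP_le (check_set (DSRP \<kappa> \<S> T) \<omega>1)
      (check_set (DSRP \<kappa> \<S> T) {\<alpha>\<in>B. limit \<alpha>}) p"
    using SSP stationary_limits[OF B] p
    unfolding SSP_projective_stationary_def preserves_stationary_subsets_def by blast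
  have "\<exists>q\<in>DSRP \<kappa> \<S> T. DSRP_le q p \<and> (\<exists>\<alpha>\<in>{\<alpha>\<in>B. limit \<alpha>}. \<alpha> \<in> marks N (fst q))"
  proof (rule forces_stationaryD[OF p st, of "\<lambda>\<alpha> q. \<alpha> \<in> marks N (fst q)"])
    show "\<alpha> \<in> marks N (fst r)" if "\<alpha> \<in> marks N (fst q)" "q \<in> DSRP \<kappa> \<S> T" "DSRP_le r q" for \<alpha> q r
      using marks_mono that by blast
    show "\<alpha> \<in> \<omega>1" if "\<alpha> \<in> marks N (fst q)" "q \<in> DSRP \<kappa> \<S> T" for \<alpha> q
      using marks_dom[OF that(1)] DSRP_dom_\<omega>1(1)[OF that(2)] by blast
    show "\<exists>r\<in>DSRP \<kappa> \<S> T. DSRP_le r q \<and> (\<exists>\<gamma>. \<alpha> \<in> elts \<gamma> \<and> \<gamma> \<in> marks N (fst r))"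
      if "q \<in> DSRP \<kappa> \<S> T" "\<alpha> \<in> \<omega>1" for q \<alpha>
      by (rule marks_unbounded[OF that NH])
    show "\<exists>r\<in>DSRP \<kappa> \<S> T. DSRP_le r q \<and> \<alpha> \<in> marks N (fst r)"
      if "q \<in> DSRP \<kappa> \<S> T" "\<alpha> \<in> \<omega>1" "elts \<alpha> \<noteq> {}"
        "\<And>\<beta> q'. \<beta> \<in> elts \<alpha> \<Longrightarrow> q' \<in> DSRP \<kappa> \<S> T \<Longrightarrow> DSRP_le q' q \<Longrightarrow>
          \<exists>r\<in>DSRP \<kappa> \<S> T. DSRP_le r q' \<and> (\<exists>\<gamma>\<in>elts \<alpha>. \<beta> \<in> elts \<gamma> \<and> \<gamma> \<in> marks N (fst r))"
      for q \<alpha>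
      using that by (rule marks_closed)
  qed
  then obtain q \<alpha> where q: "q \<in> DSRP \<kappa> \<S> T" "DSRP_le q p" "\<alpha> \<in> B" "limit \<alpha>" "\<alpha> \<in> marks N (fst q)" by blast
  have good: "the (fst q \<alpha>) \<in> C" "elts (the (fst q \<alpha>)) \<inter> \<omega>1 = elts \<alpha>"
    by (rule marks_limit_good[OF q(1) C N q(5,4)]; assumption)+
  have "vset (elts (the (fst q \<alpha>)) \<inter> \<omega>1) = \<alpha>" unfolding good(2) by (rule vset_elts)
  from that[OF q(1-3) marks_dom[OF q(5)] good(1) this] show ?thesis .
qed

text \<open>
  The one-point chain needs its only model to lie in the set chosen for \<open>j\<close> if \<open>0 \<in> T\<^sub>j\<close>. Using \<open>S\<close>
  as the value at every index up to \<open>i\<close> and \<open>j\<close> allows for any model in \<open>S\<close>.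
\<close>

lemma ex_condition:
  assumes i: "i \<in> \<omega>1" and S: "S \<in> \<S>"
  obtains p where "p \<in> DSRP \<kappa> \<S> T" "snd p i = Some S"
proof -
  let ?z = "vset {} :: 'k V"
  have z: "elts ?z = {}" by (simp add: elts_vset_countable)
  have z1: "?z \<in> \<omega>1" by (rule vset_\<omega>1I) auto
  have nlim: "\<not> limit ?z" using limit_elts_nonempty z by blast
  have nsuc: "?z \<noteq> osuc \<alpha>" for \<alpha> using z mem_osuc[of \<alpha>] by auto
  have S0: "S_sequence Map.empty" unfolding S_sequence_def using z z1 by (auto intro!: bexI[of _ ?z])
  obtain S1 where S1: "S_sequence S1" "Map.empty \<subseteq>\<^sub>m S1" "i \<in> dom S1"
    "\<And>j. j \<in> dom S1 \<Longrightarrow> j \<notin> dom (Map.empty :: 'k V \<rightharpoonup> 'k V set) \<Longrightarrow> S1 j = Some S"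
    using S_extend[OF S0 i S] by blast
  \<comment> \<open>If \<open>0\<close> lies in no \<open>T\<^sub>j\<close>, the index \<open>j\<close> is a dummy.\<close>
  define j where "j = (if \<exists>j\<in>\<omega>1. ?z \<in> T j then SOME j. j \<in> \<omega>1 \<and> ?z \<in> T j else i)"
  have j: "j \<in> \<omega>1" "\<And>i'. i' \<in> \<omega>1 \<Longrightarrow> ?z \<in> T i' \<Longrightarrow> i' = j"
  proof -
    have "j \<in> \<omega>1 \<and> ?z \<in> T j" if "\<exists>j\<in>\<omega>1. ?z \<in> T j"
      unfolding j_def using that someI_ex[of "\<lambda>j. j \<in> \<omega>1 \<and> ?z \<in> T j"] by auto
    moreover have "j = i" if "\<not> (\<exists>j\<in>\<omega>1. ?z \<in> T j)" unfolding j_def using that by simp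
    ultimately show "j \<in> \<omega>1" "\<And>i'. i' \<in> \<omega>1 \<Longrightarrow> ?z \<in> T i' \<Longrightarrow> i' = j"
      using i T_unique by blast+
  qed
  obtain S2 where S2: "S_sequence S2" "S1 \<subseteq>\<^sub>m S2" "j \<in> dom S2"
    "\<And>i'. i' \<in> dom S2 \<Longrightarrow> i' \<notin> dom S1 \<Longrightarrow> S2 i' = Some S"
    using S_extend[OF S1(1) j(1) S] by blast
  have val: "S2 i' = Some S" if "i' \<in> dom S2" for i'
  proof (cases "i' \<in> dom S1")
    case True
    then show ?thesis using S1(4)[OF True] S2(2) by (simp add: map_le_def)
  next
    case False
    then show ?thesis using S2(4) that by blast
  qed
  have i2: "i \<in> dom S2" using map_le_implies_dom_le[OF S2(2)] S1(3) by blast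
  obtain M where M: "M \<in> S" "M \<in> ctble_subsets (H \<kappa>)"
    using stationary_ctble_superset[OF stationary[OF S], of "{}"] by auto
  have T: "i' \<in> dom S2 \<and> M \<in> the (S2 i')" if "i' \<in> \<omega>1" "?z \<in> T i'" for i'
    using j(2)[OF that] S2(3) val[OF S2(3)] M(1) by simp
  have pre: "pre_condition ?z (Map.empty, Map.empty)" using z z1 S0 by (simp add: pre_condition_def)
  have "pre_condition (osuc ?z) (Map.empty(?z \<mapsto> M), S2)"
    by (rule pre_condition_top(1)[OF pre map_le_empty S2(1) M(2)]) (use nlim nsuc T in blast)+
  then show ?thesis using that[of "(Map.empty(?z \<mapsto> M), S2)"] DSRP_I val[OF i2] by simp
qed

lemma DSRP_constraint:
  assumes "q \<in> DSRP \<kappa> \<S> T" "\<alpha> \<in> dom (fst q)" "i \<in> \<omega>1" "\<alpha> \<in> T i"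
  obtains S where "S \<in> \<S>" "snd q i = Some S" "the (fst q \<alpha>) \<in> S"
proof -
  obtain \<delta> where d: "pre_condition (osuc \<delta>) q" using assms(1) DSRP_iff by blast
  have "\<alpha> \<in> elts (osuc \<delta>)" using assms(2) pre_condition_dom[OF d] by simp
  then have "i \<in> dom (snd q) \<and> the (fst q \<alpha>) \<in> the (snd q i)"
    using d assms(3,4) unfolding pre_condition_def by blast
  then obtain S where S: "snd q i = Some S" "the (fst q \<alpha>) \<in> S" by auto
  then have "S \<in> \<S>" using d ranI[where m = "snd q", OF S(1)] unfolding pre_condition_def S_sequence_def by blast
  then show ?thesis using that S by blast
qed

lemma SSP_imp_projective_stationary:
  assumes SSP: "SSP_projective_stationary \<kappa> \<S> T"
  shows "projective_stationary_on_seq \<kappa> \<S> T"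
  unfolding projective_stationary_on_seq_def
proof (intro conjI ballI)
  fix i :: "'k V" and S assume i: "i \<in> \<omega>1" and S: "S \<in> \<S>"
  show "projective_stationary_on \<kappa> S (T i)"
    unfolding projective_stationary_on_def stationary_ctble_def
  proof (intro allI impI conjI)
    fix B assume "B \<subseteq> T i" "stationary_in \<omega>1 B"
    show "{M \<in> S. vset (elts M \<inter> \<omega>1) \<in> B} \<subseteq> ctble_subsets (H \<kappa>)"
      using stationary[OF S] unfolding stationary_ctble_def by blast
  next
    fix B C assume B: "B \<subseteq> T i" "stationary_in \<omega>1 B" and C: "club_ctble (H \<kappa>) C"
    obtain p where p: "p \<in> DSRP \<kappa> \<S> T" "snd p i = Some S" using ex_condition[OF i S] .
    obtain q \<alpha> where q: "q \<in> DSRP \<kappa> \<S> T" "DSRP_le q p" "\<alpha> \<in> B" "\<alpha> \<in> dom (fst q)"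
      "the (fst q \<alpha>) \<in> C" "vset (elts (the (fst q \<alpha>)) \<inter> \<omega>1) = \<alpha>"
      using SSP_meets_club[OF SSP B(2) C p(1)] .
    have "snd q i = Some S" using q(2) p(2) by (auto simp: DSRP_le_def map_le_def dom_def)
    then have "the (fst q \<alpha>) \<in> S" using DSRP_constraint[OF q(1,4) i] q(3) B(1) by (metis option.sel subsetD)
    then show "{M \<in> S. vset (elts M \<inter> \<omega>1) \<in> B} \<inter> C \<noteq> {}" using q by auto
  qed
next
  let ?U = "{\<alpha> \<in> (\<Union>i\<in>\<omega>1. T i). \<forall>\<beta>\<in>elts \<alpha>. \<alpha> \<notin> T \<beta>}"
  show "projective_stationary_on \<kappa> (\<Union>\<S>) ?U"
    unfolding projective_stationary_on_def stationary_ctble_def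
  proof (intro allI impI conjI)
    fix B assume "B \<subseteq> ?U" "stationary_in \<omega>1 B"
    show "{M \<in> \<Union>\<S>. vset (elts M \<inter> \<omega>1) \<in> B} \<subseteq> ctble_subsets (H \<kappa>)"
      using stationary unfolding stationary_ctble_def by blast
  next
    fix B C assume B: "B \<subseteq> ?U" "stationary_in \<omega>1 B" and C: "club_ctble (H \<kappa>) C"
    obtain S where S: "S \<in> \<S>" using nonempty by blast
    have "vset {} \<in> (\<omega>1 :: 'k V set)" by (rule vset_\<omega>1I) auto
    then obtain p where p: "p \<in> DSRP \<kappa> \<S> T" using ex_condition[OF _ S] by blast
    obtain q \<alpha> where q: "q \<in> DSRP \<kappa> \<S> T" "DSRP_le q p" "\<alpha> \<in> B" "\<alpha> \<in> dom (fst q)"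
      "the (fst q \<alpha>) \<in> C" "vset (elts (the (fst q \<alpha>)) \<inter> \<omega>1) = \<alpha>"
      using SSP_meets_club[OF SSP B(2) C p] .
    obtain i where "i \<in> \<omega>1" "\<alpha> \<in> T i" using q(3) B(1) by blast
    then obtain S' where "S' \<in> \<S>" "the (fst q \<alpha>) \<in> S'" using DSRP_constraint[OF q(1,4)] by blast
    then show "{M \<in> \<Union>\<S>. vset (elts M \<inter> \<omega>1) \<in> B} \<inter> C \<noteq> {}" using q by auto
  qed
qed

end

theorem theorem4p6:
  fixes \<kappa> :: "'k rel" and \<S> :: "'k V set set" and T :: "'k V \<Rightarrow> 'k V set"
  assumes "Card_order \<kappa>" and "regularCard \<kappa>" and "cardSuc natLeq <o \<kappa>"
    and "\<S> \<noteq> {}" and "\<And>S. S \<in> \<S> \<Longrightarrow> stationary_ctble (H \<kappa>) S"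
    and "\<And>i. i \<in> \<omega>1 \<Longrightarrow> stationary_in \<omega>1 (T i)" and "disjoint_family_on T \<omega>1"
  shows "projective_stationary_on_seq \<kappa> \<S> T \<longleftrightarrow> SSP_projective_stationary \<kappa> \<S> T"
proof -
  interpret dsrp \<kappa> \<S> T by unfold_locales (fact assms)+
  show ?thesis using projective_stationary_imp_SSP SSP_imp_projective_stationary by blast
qed

end
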